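(* Let $\mathcal{E}$ be an admissible exact structure on a Krull-Schmidt category $\mathcal{A}$. Then the following lattices are isomorphic: (1) the interval $[\mathcal{E}^{\mathrm{add}},\mathcal{E}]$ in the lattice of exact structures on $\mathcal{A}$; (2) the lattice of subsets of the set of (isomorphism classes of) AR conflations in $\mathcal{E}$; (3) the lattice of subsets of the set of all (isomorphism classes of) indecomposable objects of $\mathcal{A}$ that are not projective in $\mathcal{E}$. In particular, the interval $[\mathcal{E}^{\mathrm{add}},\mathcal{E}]$ is a Boolean lattice.
   Context: All categories are essentially small. An exact structure (in the sense of Quillen) on an additive category $\mathcal{A}$ is a class $\mathcal{E}$ of kernel-cokernel pairs, called conflations $A\rightarrowtail B\twoheadrightarrow C$ (first maps: inflations; second maps: deflations), closed under isomorphism and satisfying Quillen's axioms (identities are inflations and deflations; inflations, resp. deflations, are closed under composition; push-outs of inflations along arbitrary morphisms exist and are inflations; pull-backs of deflations along arbitrary morphisms exist and are deflations). Exact structures on $\mathcal{A}$ are ordered by inclusion of classes of conflations; they form a bounded complete lattice with minimal element the split exact structure $\mathcal{E}^{\mathrm{add}}$. The contravariant defect of a conflation $\delta: A\to B\xrightarrow{g}C$ is $\delta^{\sharp}=\operatorname{Coker}(\operatorname{Hom}(-,g))$ in $\operatorname{Mod}\mathcal{A}$, the category of additive functors $\mathcal{A}^{\mathrm{op}}\to\mathbf{Ab}$; $\operatorname{eff}\mathcal{E}$ is the full subcategory of $\operatorname{Mod}\mathcal{A}$ of modules isomorphic to $\delta^\sharp$ for a conflation $\delta$ in $\mathcal{E}$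 (an abelian category). The exact structure $\mathcal{E}$ is admissible if every object of $\operatorname{eff}\mathcal{E}$ has finite length. An object $P$ is projective in $\mathcal{E}$ if $\operatorname{Ext}^1_{\mathcal{E}}(P,B)=0$ for all $B\in\mathcal{A}$. Let $\mathcal{J}$ be the Jacobson radical of $\mathcal{A}$. A conflation $X\xrightarrow{f}Y\xrightarrow{g}Z$ in $\mathcal{E}$ with $X,Z$ indecomposable is an AR (Auslander-Reiten, almost split) conflation if $g$ is not a retraction and every morphism in $\mathcal{J}(-,Z)$ factors through $g$ (equivalently, $f$ is not a section and every morphism in $\mathcal{J}(X,-)$ factors through $f$). Such a conflation is determined up to isomorphism by $X$ and also by $Z$. *)

theory Defs
  imports "HOL-Algebra.Coset" "HOL-Algebra.Ring" "HOL-Algebra.Lattice"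
begin

section \<open>Additive categories\<close>

text \<open>
  A small category is given by carrier sets of objects and arrows.  Every arrow determines its
  source and target, so distinct Hom-sets are disjoint.  Since every notion below is invariant
  under equivalence of categories, small categories represent the essentially small ones.
\<close>

record ('o, 'm) precat =
  Ob :: "'o set"
  Arr :: "'m set"
  src :: "'m \<Rightarrow> 'o"
  tgt :: "'m \<Rightarrow> 'o"
  ident :: "'o \<Rightarrow> 'm"
  cmps :: "'m \<Rightarrow> 'm \<Rightarrow> 'm"  (infixl \<open>\<cdot>\<index>\<close> 70)
  hadd :: "'m \<Rightarrow> 'm \<Rightarrow> 'm"
  hzero :: "'o \<Rightarrow> 'o \<Rightarrow> 'm"

definition Hom :: "('o, 'm, 'z) precat_scheme \<Rightarrow> 'o \<Rightarrow> 'o \<Rightarrow> 'm set" where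
  "Hom C X Y = {f \<in> Arr C. src C f = X \<and> tgt C f = Y}"

definition hom_group :: "('o, 'm, 'z) precat_scheme \<Rightarrow> 'o \<Rightarrow> 'o \<Rightarrow> 'm monoid" where
  "hom_group C X Y = \<lparr>carrier = Hom C X Y, monoid.mult = hadd C, one = hzero C X Y\<rparr>"

definition End_ring :: "('o, 'm, 'z) precat_scheme \<Rightarrow> 'o \<Rightarrow> 'm ring" where
  "End_ring C X =
     \<lparr>carrier = Hom C X X, monoid.mult = cmps C, one = ident C X,
      ring.zero = hzero C X X, ring.add = hadd C\<rparr>"

locale category =
  fixes C :: "('o, 'm, 'z) precat_scheme" (structure)
  assumes src_closed: "f \<in> Arr C \<Longrightarrow> src C f \<in> Ob C"
    and tgt_closed: "f \<in> Arr C \<Longrightarrow> tgt C f \<in> Ob C"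
    and ident_closed: "X \<in> Ob C \<Longrightarrow> ident C X \<in> Hom C X X"
    and comp_closed: "\<lbrakk>f \<in> Hom C X Y; g \<in> Hom C Y Z\<rbrakk> \<Longrightarrow> g \<cdot> f \<in> Hom C X Z"
    and comp_assoc:
      "\<lbrakk>f \<in> Hom C W X; g \<in> Hom C X Y; h \<in> Hom C Y Z\<rbrakk> \<Longrightarrow> (h \<cdot> g) \<cdot> f = h \<cdot> (g \<cdot> f)"
    and ident_left: "f \<in> Hom C X Y \<Longrightarrow> ident C Y \<cdot> f = f"
    and ident_right: "f \<in> Hom C X Y \<Longrightarrow> f \<cdot> ident C X = f"

locale preadditive_category = category +
  assumes hom_comm_group: "\<lbrakk>X \<in> Ob C; Y \<in> Ob C\<rbrakk> \<Longrightarrow> comm_group (hom_group C X Y)"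
    and comp_add_right:
      "\<lbrakk>f \<in> Hom C X Y; f' \<in> Hom C X Y; g \<in> Hom C Y Z\<rbrakk>
        \<Longrightarrow> g \<cdot> hadd C f f' = hadd C (g \<cdot> f) (g \<cdot> f')"
    and comp_add_left:
      "\<lbrakk>f \<in> Hom C X Y; g \<in> Hom C Y Z; g' \<in> Hom C Y Z\<rbrakk>
        \<Longrightarrow> hadd C g g' \<cdot> f = hadd C (g \<cdot> f) (g' \<cdot> f)"

definition direct_sum ::
  "('o, 'm, 'z) precat_scheme \<Rightarrow> nat \<Rightarrow> (nat \<Rightarrow> 'o) \<Rightarrow> 'o \<Rightarrow> (nat \<Rightarrow> 'm) \<Rightarrow> (nat \<Rightarrow> 'm) \<Rightarrow> bool" where
  "direct_sum C n X Y \<iota> \<pi> \<longleftrightarrow>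
     Y \<in> Ob C \<and>
     (\<forall>i<n. X i \<in> Ob C \<and> \<iota> i \<in> Hom C (X i) Y \<and> \<pi> i \<in> Hom C Y (X i)) \<and>
     (\<forall>i<n. \<forall>j<n. cmps C (\<pi> j) (\<iota> i) = (if i = j then ident C (X i) else hzero C (X i) (X j))) \<and>
     finsum (End_ring C Y) (\<lambda>i. cmps C (\<iota> i) (\<pi> i)) {..<n} = ident C Y"

locale additive_category = preadditive_category +
  assumes direct_sums_exist:
    "(\<And>i. i < (n::nat) \<Longrightarrow> X i \<in> Ob C) \<Longrightarrow> \<exists>Y \<iota> \<pi>. direct_sum C n X Y \<iota> \<pi>"

section \<open>Universal constructions\<close>

definition zero_object :: "('o, 'm, 'z) precat_scheme \<Rightarrow> 'o \<Rightarrow> bool" where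
  "zero_object C X \<longleftrightarrow> X \<in> Ob C \<and> (\<forall>Y\<in>Ob C. (\<exists>!f. f \<in> Hom C X Y) \<and> (\<exists>!f. f \<in> Hom C Y X))"

definition is_iso :: "('o, 'm, 'z) precat_scheme \<Rightarrow> 'm \<Rightarrow> bool" where
  "is_iso C f \<longleftrightarrow> f \<in> Arr C \<and>
     (\<exists>g\<in>Hom C (tgt C f) (src C f).
        cmps C g f = ident C (src C f) \<and> cmps C f g = ident C (tgt C f))"

definition isomorphic :: "('o, 'm, 'z) precat_scheme \<Rightarrow> 'o \<Rightarrow> 'o \<Rightarrow> bool" where
  "isomorphic C X Y \<longleftrightarrow> (\<exists>f\<in>Hom C X Y. is_iso C f)"

definition is_mono :: "('o, 'm, 'z) precat_scheme \<Rightarrow> 'm \<Rightarrow> bool" where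
  "is_mono C f \<longleftrightarrow> f \<in> Arr C \<and>
     (\<forall>W\<in>Ob C. \<forall>h\<in>Hom C W (src C f). \<forall>k\<in>Hom C W (src C f). cmps C f h = cmps C f k \<longrightarrow> h = k)"

definition is_retraction :: "('o, 'm, 'z) precat_scheme \<Rightarrow> 'm \<Rightarrow> bool" where
  "is_retraction C g \<longleftrightarrow> g \<in> Arr C \<and>
     (\<exists>s\<in>Hom C (tgt C g) (src C g). cmps C g s = ident C (tgt C g))"

definition is_kernel :: "('o, 'm, 'z) precat_scheme \<Rightarrow> 'm \<Rightarrow> 'm \<Rightarrow> bool" where
  "is_kernel C f g \<longleftrightarrow> f \<in> Arr C \<and> g \<in> Arr C \<and> tgt C f = src C g \<and>
     cmps C g f = hzero C (src C f) (tgt C g) \<and>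
     (\<forall>W\<in>Ob C. \<forall>h\<in>Hom C W (src C g). cmps C g h = hzero C W (tgt C g) \<longrightarrow>
        (\<exists>!k. k \<in> Hom C W (src C f) \<and> cmps C f k = h))"

definition is_cokernel :: "('o, 'm, 'z) precat_scheme \<Rightarrow> 'm \<Rightarrow> 'm \<Rightarrow> bool" where
  "is_cokernel C g f \<longleftrightarrow> f \<in> Arr C \<and> g \<in> Arr C \<and> tgt C f = src C g \<and>
     cmps C g f = hzero C (src C f) (tgt C g) \<and>
     (\<forall>W\<in>Ob C. \<forall>h\<in>Hom C (tgt C f) W. cmps C h f = hzero C (src C f) W \<longrightarrow>
        (\<exists>!k. k \<in> Hom C (tgt C g) W \<and> cmps C k g = h))"

text \<open>
  Pushout of \<open>i : X \<rightarrow> Y\<close> along \<open>f : X \<rightarrow> X'\<close>, with \<open>i' : X' \<rightarrow> Y'\<close> opposite to \<open>i\<close>;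
  pullback of \<open>p : Y \<rightarrow> Z\<close> along \<open>f : Z' \<rightarrow> Z\<close>, with \<open>p' : Y' \<rightarrow> Z'\<close> opposite to \<open>p\<close>.
\<close>

definition is_pushout :: "('o, 'm, 'z) precat_scheme \<Rightarrow> 'm \<Rightarrow> 'm \<Rightarrow> 'm \<Rightarrow> 'm \<Rightarrow> bool" where
  "is_pushout C i f i' f' \<longleftrightarrow>
     {i, f, i', f'} \<subseteq> Arr C \<and> src C i = src C f \<and> src C i' = tgt C f \<and> src C f' = tgt C i \<and>
     tgt C i' = tgt C f' \<and> cmps C i' f = cmps C f' i \<and>
     (\<forall>W\<in>Ob C. \<forall>a\<in>Hom C (tgt C f) W. \<forall>b\<in>Hom C (tgt C i) W. cmps C a f = cmps C b i \<longrightarrow>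
        (\<exists>!k. k \<in> Hom C (tgt C i') W \<and> cmps C k i' = a \<and> cmps C k f' = b))"

definition is_pullback :: "('o, 'm, 'z) precat_scheme \<Rightarrow> 'm \<Rightarrow> 'm \<Rightarrow> 'm \<Rightarrow> 'm \<Rightarrow> bool" where
  "is_pullback C p f p' f' \<longleftrightarrow>
     {p, f, p', f'} \<subseteq> Arr C \<and> tgt C p = tgt C f \<and> tgt C p' = src C f \<and> tgt C f' = src C p \<and>
     src C p' = src C f' \<and> cmps C f p' = cmps C p f' \<and>
     (\<forall>W\<in>Ob C. \<forall>a\<in>Hom C W (src C f). \<forall>b\<in>Hom C W (src C p). cmps C f a = cmps C p b \<longrightarrow>
        (\<exists>!k. k \<in> Hom C W (src C p') \<and> cmps C p' k = a \<and> cmps C f' k = b))"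

definition full_subcategory ::
  "('o, 'm, 'z) precat_scheme \<Rightarrow> 'o set \<Rightarrow> ('o, 'm, 'z) precat_scheme" where
  "full_subcategory C S =
     C\<lparr>Ob := Ob C \<inter> S, Arr := {f \<in> Arr C. src C f \<in> S \<and> tgt C f \<in> S}\<rparr>"

section \<open>Objects of finite length\<close>

definition simple_object :: "('o, 'm, 'z) precat_scheme \<Rightarrow> 'o \<Rightarrow> bool" where
  "simple_object C S \<longleftrightarrow> S \<in> Ob C \<and> \<not> zero_object C S \<and>
     (\<forall>f. is_mono C f \<and> tgt C f = S \<longrightarrow> zero_object C (src C f) \<or> is_iso C f)"

text \<open>A composition series \<open>0 = M\<^sub>0 \<rightarrow> M\<^sub>1 \<rightarrow> \<dots> \<rightarrow> M\<^sub>n = X\<close>.\<close>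

definition finite_length :: "('o, 'm, 'z) precat_scheme \<Rightarrow> 'o \<Rightarrow> bool" where
  "finite_length C X \<longleftrightarrow>
     (\<exists>(n::nat) M j. (\<forall>k\<le>n. M k \<in> Ob C) \<and> zero_object C (M 0) \<and> M n = X \<and>
        (\<forall>k<n. j k \<in> Hom C (M k) (M (Suc k)) \<and> is_mono C (j k) \<and>
           (\<exists>p. is_cokernel C p (j k) \<and> simple_object C (tgt C p))))"

section \<open>Krull-Schmidt categories\<close>

definition local_ring :: "('a, 'b) ring_scheme \<Rightarrow> bool" where
  "local_ring R \<longleftrightarrow> ring R \<and> \<one>\<^bsub>R\<^esub> \<noteq> \<zero>\<^bsub>R\<^esub> \<and>
     (\<forall>a\<in>carrier R. \<forall>b\<in>carrier R. a \<oplus>\<^bsub>R\<^esub> b \<in> Units R \<longrightarrow> a \<in> Units R \<or> b \<in> Units R)"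

locale krull_schmidt_category = additive_category +
  assumes krull_schmidt:
    "Y \<in> Ob C \<Longrightarrow> \<exists>n X \<iota> \<pi>. direct_sum C n X Y \<iota> \<pi> \<and> (\<forall>i<n. local_ring (End_ring C (X i)))"

definition indecomposable :: "('o, 'm, 'z) precat_scheme \<Rightarrow> 'o \<Rightarrow> bool" where
  "indecomposable C Y \<longleftrightarrow> Y \<in> Ob C \<and> \<not> zero_object C Y \<and>
     (\<forall>X \<iota> \<pi>. direct_sum C 2 X Y \<iota> \<pi> \<longrightarrow> zero_object C (X 0) \<or> zero_object C (X 1))"

definition jacobson_radical :: "('o, 'm, 'z) precat_scheme \<Rightarrow> 'o \<Rightarrow> 'o \<Rightarrow> 'm set" where
  "jacobson_radical C X Y =
     {f \<in> Hom C X Y. \<forall>g\<in>Hom C Y X.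
        ident C X \<ominus>\<^bsub>End_ring C X\<^esub> cmps C g f \<in> Units (End_ring C X)}"

section \<open>Exact structures\<close>

definition kernel_cokernel_pair :: "('o, 'm, 'z) precat_scheme \<Rightarrow> 'm \<times> 'm \<Rightarrow> bool" where
  "kernel_cokernel_pair C = (\<lambda>(f, g). is_kernel C f g \<and> is_cokernel C g f)"

definition pair_isomorphic ::
  "('o, 'm, 'z) precat_scheme \<Rightarrow> 'm \<times> 'm \<Rightarrow> 'm \<times> 'm \<Rightarrow> bool" where
  "pair_isomorphic C = (\<lambda>(f, g) (f', g').
     {f, g, f', g'} \<subseteq> Arr C \<and> tgt C f = src C g \<and> tgt C f' = src C g' \<and>
     (\<exists>a\<in>Hom C (src C f) (src C f'). \<exists>b\<in>Hom C (src C g) (src C g').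
      \<exists>c\<in>Hom C (tgt C g) (tgt C g').
        is_iso C a \<and> is_iso C b \<and> is_iso C c \<and>
        cmps C b f = cmps C f' a \<and> cmps C c g = cmps C g' b))"

text \<open>The set \<open>E\<close> consists of the conflations; the inflations and the deflations are its first
  and second projections.\<close>

locale exact_structure = additive_category A
  for A :: "('o, 'm, 'z) precat_scheme" (structure) +
  fixes E :: "('m \<times> 'm) set"
  assumes conflation_kernel_cokernel: "\<delta> \<in> E \<Longrightarrow> kernel_cokernel_pair A \<delta>"
    and iso_closed: "\<lbrakk>\<delta> \<in> E; pair_isomorphic A \<delta> \<delta>'\<rbrakk> \<Longrightarrow> \<delta>' \<in> E"
    and ident_inflation: "X \<in> Ob A \<Longrightarrow> ident A X \<in> fst ` E"
    and ident_deflation: "X \<in> Ob A \<Longrightarrow> ident A X \<in> snd ` E"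
    and inflation_comp: "\<lbrakk>i \<in> fst ` E; j \<in> fst ` E; tgt A i = src A j\<rbrakk> \<Longrightarrow> j \<cdot> i \<in> fst ` E"
    and deflation_comp: "\<lbrakk>p \<in> snd ` E; q \<in> snd ` E; tgt A p = src A q\<rbrakk> \<Longrightarrow> q \<cdot> p \<in> snd ` E"
    and inflation_pushout:
      "\<lbrakk>i \<in> fst ` E; f \<in> Arr A; src A i = src A f\<rbrakk> \<Longrightarrow> \<exists>i' f'. is_pushout A i f i' f' \<and> i' \<in> fst ` E"
    and deflation_pullback:
      "\<lbrakk>p \<in> snd ` E; f \<in> Arr A; tgt A p = tgt A f\<rbrakk> \<Longrightarrow> \<exists>p' f'. is_pullback A p f p' f' \<and> p' \<in> snd ` E"

definition split_exact_structure :: "('o, 'm, 'z) precat_scheme \<Rightarrow> ('m \<times> 'm) set" where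
  "split_exact_structure A = {(f, g). kernel_cokernel_pair A (f, g) \<and> is_retraction A g}"

definition conflations_between ::
  "('o, 'm, 'z) precat_scheme \<Rightarrow> ('m \<times> 'm) set \<Rightarrow> 'o \<Rightarrow> 'o \<Rightarrow> ('m \<times> 'm) set" where
  "conflations_between A E P B = {(f, g) \<in> E. src A f = B \<and> tgt A g = P}"

definition yoneda_equivalence ::
  "('o, 'm, 'z) precat_scheme \<Rightarrow> ('m \<times> 'm) set \<Rightarrow> 'o \<Rightarrow> 'o \<Rightarrow> (('m \<times> 'm) \<times> ('m \<times> 'm)) set" where
  "yoneda_equivalence A E P B =
     {((f, g), (f', g')). (f, g) \<in> conflations_between A E P B \<and>
        (f', g') \<in> conflations_between A E P B \<and>
        (\<exists>b\<in>Hom A (src A g) (src A g'). is_iso A b \<and> cmps A b f = f' \<and> cmps A g' b = g)}"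

definition Ext1 ::
  "('o, 'm, 'z) precat_scheme \<Rightarrow> ('m \<times> 'm) set \<Rightarrow> 'o \<Rightarrow> 'o \<Rightarrow> ('m \<times> 'm) set set" where
  "Ext1 A E P B = conflations_between A E P B // yoneda_equivalence A E P B"

text \<open>The zero element for the Baer sum is the class of the split conflations.\<close>

definition Ext1_zero :: "('o, 'm, 'z) precat_scheme \<Rightarrow> 'o \<Rightarrow> 'o \<Rightarrow> ('m \<times> 'm) set" where
  "Ext1_zero A P B = conflations_between A (split_exact_structure A) P B"

definition projective ::
  "('o, 'm, 'z) precat_scheme \<Rightarrow> ('m \<times> 'm) set \<Rightarrow> 'o \<Rightarrow> bool" where
  "projective A E P \<longleftrightarrow> P \<in> Ob A \<and> (\<forall>B\<in>Ob A. Ext1 A E P B = {Ext1_zero A P B})"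

definition AR_conflations ::
  "('o, 'm, 'z) precat_scheme \<Rightarrow> ('m \<times> 'm) set \<Rightarrow> ('m \<times> 'm) set" where
  "AR_conflations A E =
     {(f, g) \<in> E. indecomposable A (src A f) \<and> indecomposable A (tgt A g) \<and> \<not> is_retraction A g \<and>
        (\<forall>W\<in>Ob A. \<forall>h\<in>jacobson_radical A W (tgt A g). \<exists>k\<in>Hom A W (src A g). cmps A g k = h)}"

section \<open>Modules over an additive category\<close>

text \<open>
  Additive functors from the opposite of \<open>A\<close> to abelian groups carried by sets over \<open>'g\<close>;
  abelian groups are written multiplicatively.  Components of natural transformations are made
  extensional, so that equality of arrows is equality of natural transformations.
\<close>

record ('o, 'm, 'g) presheaf =
  fob :: "'o \<Rightarrow> 'g monoid"
  farr :: "'m \<Rightarrow> 'g \<Rightarrow> 'g"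

record ('o, 'm, 'g) nat_trans =
  nt_src :: "('o, 'm, 'g) presheaf"
  nt_tgt :: "('o, 'm, 'g) presheaf"
  component :: "'o \<Rightarrow> 'g \<Rightarrow> 'g"

definition additive_presheaf ::
  "('o, 'm, 'z) precat_scheme \<Rightarrow> ('o, 'm, 'g) presheaf \<Rightarrow> bool" where
  "additive_presheaf A F \<longleftrightarrow>
     (\<forall>X\<in>Ob A. comm_group (fob F X)) \<and>
     (\<forall>f\<in>Arr A. farr F f \<in> hom (fob F (tgt A f)) (fob F (src A f))) \<and>
     (\<forall>X\<in>Ob A. \<forall>x\<in>carrier (fob F X). farr F (ident A X) x = x) \<and>
     (\<forall>f\<in>Arr A. \<forall>g\<in>Arr A. tgt A f = src A g \<longrightarrow>
        (\<forall>x\<in>carrier (fob F (tgt A g)). farr F (cmps A g f) x = farr F f (farr F g x))) \<and>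
     (\<forall>X\<in>Ob A. \<forall>Y\<in>Ob A. \<forall>f\<in>Hom A X Y. \<forall>g\<in>Hom A X Y. \<forall>x\<in>carrier (fob F Y).
        farr F (hadd A f g) x = farr F f x \<otimes>\<^bsub>fob F X\<^esub> farr F g x)"

definition is_natural ::
  "('o, 'm, 'z) precat_scheme \<Rightarrow> ('o, 'm, 'g) nat_trans \<Rightarrow> bool" where
  "is_natural A t \<longleftrightarrow>
     component t \<in> extensional (Ob A) \<and>
     (\<forall>X\<in>Ob A. component t X \<in> hom (fob (nt_src t) X) (fob (nt_tgt t) X) \<and>
        component t X \<in> extensional (carrier (fob (nt_src t) X))) \<and>
     (\<forall>f\<in>Arr A. \<forall>x\<in>carrier (fob (nt_src t) (tgt A f)).
        component t (src A f) (farr (nt_src t) f x) = farr (nt_tgt t) f (component t (tgt A f) x))"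

definition Mod_category ::
  "('o, 'm, 'z) precat_scheme \<Rightarrow> (('o, 'm, 'g) presheaf, ('o, 'm, 'g) nat_trans) precat" where
  "Mod_category A =
     \<lparr>Ob = {F. additive_presheaf A F},
      Arr = {t. additive_presheaf A (nt_src t) \<and> additive_presheaf A (nt_tgt t) \<and> is_natural A t},
      src = nt_src,
      tgt = nt_tgt,
      ident = (\<lambda>F. \<lparr>nt_src = F, nt_tgt = F,
        component = (\<lambda>X\<in>Ob A. \<lambda>x\<in>carrier (fob F X). x)\<rparr>),
      cmps = (\<lambda>t s. \<lparr>nt_src = nt_src s, nt_tgt = nt_tgt t,
        component = (\<lambda>X\<in>Ob A. \<lambda>x\<in>carrier (fob (nt_src s) X). component t X (component s X x))\<rparr>),
      hadd = (\<lambda>s t. \<lparr>nt_src = nt_src s, nt_tgt = nt_tgt s,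
        component = (\<lambda>X\<in>Ob A. \<lambda>x\<in>carrier (fob (nt_src s) X).
          component s X x \<otimes>\<^bsub>fob (nt_tgt s) X\<^esub> component t X x)\<rparr>),
      hzero = (\<lambda>F G. \<lparr>nt_src = F, nt_tgt = G,
        component = (\<lambda>X\<in>Ob A. \<lambda>x\<in>carrier (fob F X). \<one>\<^bsub>fob G X\<^esub>)\<rparr>)\<rparr>"

text \<open>
  The cokernel of \<open>Hom(-, g) : Hom(-, B) \<rightarrow> Hom(-, C)\<close> is computed pointwise: its value at \<open>X\<close> is
  the quotient of \<open>Hom(X, C)\<close> by the morphisms factoring through \<open>g\<close>, and an arrow acts by
  precomposition on representatives.
\<close>

definition hom_image :: "('o, 'm, 'z) precat_scheme \<Rightarrow> 'm \<Rightarrow> 'o \<Rightarrow> 'm set" where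
  "hom_image A g X = (\<lambda>k. cmps A g k) ` Hom A X (src A g)"

definition defect ::
  "('o, 'm, 'z) precat_scheme \<Rightarrow> 'm \<times> 'm \<Rightarrow> ('o, 'm, 'm set) presheaf" where
  "defect A = (\<lambda>(f, g).
     \<lparr>fob = (\<lambda>X. hom_group A X (tgt A g) Mod hom_image A g X),
      farr = (\<lambda>h U. \<Union>u\<in>U. hom_image A g (src A h) #>\<^bsub>hom_group A (src A h) (tgt A g)\<^esub> cmps A u h)\<rparr>)"

text \<open>
  Every defect, and hence up to isomorphism every object of the category \<open>eff\<close>, takes values in
  groups carried by sets over \<open>'m set\<close>; so this universe of values loses nothing.
\<close>

definition eff ::
  "('o, 'm, 'z) precat_scheme \<Rightarrow> ('m \<times> 'm) set \<Rightarrow>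
     (('o, 'm, 'm set) presheaf, ('o, 'm, 'm set) nat_trans) precat" where
  "eff A E = full_subcategory (Mod_category A)
     {F. \<exists>\<delta>\<in>E. isomorphic (Mod_category A) F (defect A \<delta>)}"

definition admissible :: "('o, 'm, 'z) precat_scheme \<Rightarrow> ('m \<times> 'm) set \<Rightarrow> bool" where
  "admissible A E \<longleftrightarrow> (\<forall>F\<in>Ob (eff A E). finite_length (eff A E) F)"

section \<open>Lattices\<close>

definition inclusion_order :: "'a set set \<Rightarrow> 'a set gorder" where
  "inclusion_order S = \<lparr>carrier = S, eq = (=), le = (\<subseteq>)\<rparr>"

definition exact_structure_lattice :: "('o, 'm, 'z) precat_scheme \<Rightarrow> ('m \<times> 'm) set gorder" where
  "exact_structure_lattice A = inclusion_order {E. exact_structure A E}"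

definition interval_lattice :: "('a, 'b) gorder_scheme \<Rightarrow> 'a \<Rightarrow> 'a \<Rightarrow> ('a, 'b) gorder_scheme" where
  "interval_lattice L x y = L\<lparr>carrier := \<lbrace>x..y\<rbrace>\<^bsub>L\<^esub>\<rparr>"

definition AR_conflation_classes ::
  "('o, 'm, 'z) precat_scheme \<Rightarrow> ('m \<times> 'm) set \<Rightarrow> ('m \<times> 'm) set set" where
  "AR_conflation_classes A E =
     AR_conflations A E //
       {(\<delta>, \<delta>'). \<delta> \<in> AR_conflations A E \<and> \<delta>' \<in> AR_conflations A E \<and> pair_isomorphic A \<delta> \<delta>'}"

definition nonprojective_indecomposables ::
  "('o, 'm, 'z) precat_scheme \<Rightarrow> ('m \<times> 'm) set \<Rightarrow> 'o set" where
  "nonprojective_indecomposables A E = {X. indecomposable A X \<and> \<not> projective A E X}"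

definition nonprojective_indecomposable_classes ::
  "('o, 'm, 'z) precat_scheme \<Rightarrow> ('m \<times> 'm) set \<Rightarrow> 'o set set" where
  "nonprojective_indecomposable_classes A E =
     nonprojective_indecomposables A E //
       {(X, Y). X \<in> nonprojective_indecomposables A E \<and>
          Y \<in> nonprojective_indecomposables A E \<and> isomorphic A X Y}"

definition lattices_isomorphic ::
  "('a, 'c) gorder_scheme \<Rightarrow> ('b, 'd) gorder_scheme \<Rightarrow> bool" where
  "lattices_isomorphic L M \<longleftrightarrow>
     (\<exists>h. bij_betw h (carrier L) (carrier M) \<and> join_pres L M h \<and> meet_pres L M h)"

locale boolean_lattice = bounded_lattice +
  assumes meet_join_distrib:
    "\<lbrakk>x \<in> carrier L; y \<in> carrier L; z \<in> carrier L\<rbrakk> \<Longrightarrow> x \<sqinter> (y \<squnion> z) = (x \<sqinter> y) \<squnion> (x \<sqinter> z)"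
    and complement_exists:
    "x \<in> carrier L \<Longrightarrow> \<exists>y\<in>carrier L. x \<sqinter> y = \<bottom> \<and> x \<squnion> y = \<top>"

end

theory Submission
  imports Defs
begin

text \<open>
  The conflations of an admissible structure \<open>E\<close> have defects of finite length, so a Serre
  subcategory of \<open>eff E\<close> is determined by the simple objects in it.  The simple objects are the
  functors \<open>Hom(-, Z) / J(-, Z)\<close>, which are the defects of the AR conflations, and there is one of
  them for every nonprojective indecomposable \<open>Z\<close>.  The proof follows this idea, but it handles
  deflations instead of subcategories: a deflation \<open>g : B \<rightarrow> C\<close> enters through the subfunctor
  \<open>im g\<close> of \<open>Hom(-, C)\<close> formed by the morphisms that factor through \<open>g\<close> (\<open>hom_image\<close>), and its
  defect is \<open>Hom(-, C) / im g\<close>.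

  \<^bold>\<open>From indecomposables to exact structures.\<close>  Let \<open>\<S>\<close> be a set of nonprojective indecomposables,
  closed under isomorphism.  The conflations in \<open>E\<close> for which all indecomposables outside \<open>\<S>\<close> are
  projective form an exact structure; this holds for any class of objects (\<open>relative_exact\<close>).  The
  structure determines \<open>\<S>\<close>: an AR conflation ending in \<open>Z \<in> \<S>\<close> belongs to it, because a morphism
  to \<open>Z\<close> from an indecomposable that is not isomorphic to \<open>Z\<close> is radical (\<open>NP_substructure_of\<close>).

  \<^bold>\<open>From exact structures to indecomposables.\<close>  Let \<open>F \<subseteq> E\<close> be exact and let \<open>g\<close> be a deflation of \<open>E\<close>
  through which every morphism from an \<open>F\<close>-projective indecomposable factors.  It has to be shown
  that \<open>g\<close> is a deflation of \<open>F\<close> (\<open>deflation_in_substructure\<close>), and this goes by induction on the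
  length of the defect \<open>M\<close> of \<open>g\<close>.  A maximal subobject \<open>N\<close> of \<open>M\<close> is generated by the class of some
  \<open>a : X \<rightarrow> C\<close>.  The pullback \<open>g'\<close> of \<open>g\<close> along \<open>a\<close> has defect \<open>N\<close>, and \<open>G = (g, a) : B \<oplus> X \<rightarrow> C\<close> has
  the simple defect \<open>M / N\<close>.  The induction hypothesis covers \<open>g'\<close>; comparison with an AR conflation of
  \<open>F\<close> covers \<open>G\<close>; and \<open>deflation_glue\<close> deduces the claim for \<open>g\<close> from these two.  The AR conflation
  exists for a similar reason: if \<open>g\<close> is a nonsplit deflation of \<open>F\<close> onto \<open>Z\<close>, then so is \<open>G\<close>, and its
  image is \<open>J(-, Z)\<close> (\<open>AR_conflation_exists\<close>).  Every such step rests on Quillen's obscure axiom: if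
  \<open>p q\<close> is a deflation of \<open>F\<close> and \<open>p\<close> has a kernel, then \<open>p\<close> is a deflation of \<open>F\<close>
  (\<open>deflation_cancel\<close>).

  \<^bold>\<open>Composition series.\<close>  Admissibility speaks about monomorphisms, cokernels and simple objects inside
  the category \<open>eff E\<close>.  They are the pointwise ones, because \<open>eff E\<close> contains with an object
  also the subobject generated by a single element (the defect of a pullback of \<open>g\<close>) and the quotient
  by it (the defect of a deflation of the form \<open>G\<close>).  Thus a composition series yields the chain of
  pairs \<open>G\<close>, \<open>g'\<close> used in the induction (\<open>composition_step\<close>, \<open>admissible_finite_defect\<close>).
\<close>

section \<open>Calculation in preadditive categories\<close>

lemma Hom_iff: "f \<in> Hom C X Y \<longleftrightarrow> f \<in> Arr C \<and> src C f = X \<and> tgt C f = Y"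
  by (simp add: Hom_def)

text \<open>
  Side conditions of the rewrite rules are stated by sources and targets instead of Hom-sets: in
  this form they contain no variable that is absent from the rewritten term.
\<close>

context category
begin

lemma Hom_Ob: "f \<in> Hom C X Y \<Longrightarrow> X \<in> Ob C \<and> Y \<in> Ob C"
  using src_closed tgt_closed by (auto simp: Hom_iff)

lemma comp_Arr [simp]:
  assumes "f \<in> Arr C" "g \<in> Arr C" "tgt C f = src C g"
  shows "g \<cdot> f \<in> Arr C" "src C (g \<cdot> f) = src C f" "tgt C (g \<cdot> f) = tgt C g"
  using comp_closed[of f "src C f" "tgt C f" g "tgt C g"] assms by (auto simp: Hom_iff)

lemma ident_Arr [simp]:
  assumes "X \<in> Ob C"
  shows "ident C X \<in> Arr C" "src C (ident C X) = X" "tgt C (ident C X) = X"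
  using ident_closed[OF assms] by (auto simp: Hom_iff)

lemma comp_assoc_right [simp]:
  assumes "f \<in> Arr C" "g \<in> Arr C" "h \<in> Arr C" "tgt C f = src C g" "tgt C g = src C h"
  shows "(h \<cdot> g) \<cdot> f = h \<cdot> (g \<cdot> f)"
  using comp_assoc[of f "src C f" "tgt C f" g "tgt C g" h "tgt C h"] assms by (auto simp: Hom_iff)

lemma comp_ident_left [simp]: "f \<in> Arr C \<Longrightarrow> tgt C f = Y \<Longrightarrow> ident C Y \<cdot> f = f"
  using ident_left[of f "src C f"] by (auto simp: Hom_iff)

lemma comp_ident_right [simp]: "f \<in> Arr C \<Longrightarrow> src C f = X \<Longrightarrow> f \<cdot> ident C X = f"
  using ident_right[of f "src C f"] by (auto simp: Hom_iff)

declare src_closed [simp] tgt_closed [simp]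

end

context preadditive_category
begin

abbreviation plus :: "'b \<Rightarrow> 'b \<Rightarrow> 'b" (infixl \<open>\<boxplus>\<close> 65) where "f \<boxplus> g \<equiv> hadd C f g"

definition hneg :: "'b \<Rightarrow> 'b" where
  "hneg f = inv\<^bsub>hom_group C (src C f) (tgt C f)\<^esub> f"

abbreviation minus :: "'b \<Rightarrow> 'b \<Rightarrow> 'b" (infixl \<open>\<boxminus>\<close> 65) where "f \<boxminus> g \<equiv> f \<boxplus> hneg g"

lemma hom_group_sel [simp]: "carrier (hom_group C X Y) = Hom C X Y"
  "x \<otimes>\<^bsub>hom_group C X Y\<^esub> y = x \<boxplus> y" "\<one>\<^bsub>hom_group C X Y\<^esub> = hzero C X Y"
  by (auto simp: hom_group_def)

lemma hadd_Arr [simp]: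
  assumes "f \<in> Arr C" "g \<in> Arr C" "src C f = src C g" "tgt C f = tgt C g"
  shows "f \<boxplus> g \<in> Arr C" "src C (f \<boxplus> g) = src C g" "tgt C (f \<boxplus> g) = tgt C g"
proof -
  interpret G: comm_group "hom_group C (src C g) (tgt C g)" using assms by (intro hom_comm_group) auto
  show "f \<boxplus> g \<in> Arr C" "src C (f \<boxplus> g) = src C g" "tgt C (f \<boxplus> g) = tgt C g"
    using G.m_closed[of f g] assms by (auto simp: Hom_iff)
qed

lemma hzero_Arr [simp]:
  assumes "X \<in> Ob C" "Y \<in> Ob C"
  shows "hzero C X Y \<in> Arr C" "src C (hzero C X Y) = X" "tgt C (hzero C X Y) = Y"
proof -
  interpret G: comm_group "hom_group C X Y" using assms by (intro hom_comm_group) auto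
  show "hzero C X Y \<in> Arr C" "src C (hzero C X Y) = X" "tgt C (hzero C X Y) = Y"
    using G.one_closed assms by (auto simp: Hom_iff)
qed

lemma hneg_Arr [simp]:
  assumes "f \<in> Arr C"
  shows "hneg f \<in> Arr C" "src C (hneg f) = src C f" "tgt C (hneg f) = tgt C f"
proof -
  interpret G: comm_group "hom_group C (src C f) (tgt C f)" using assms by (intro hom_comm_group) auto
  show "hneg f \<in> Arr C" "src C (hneg f) = src C f" "tgt C (hneg f) = tgt C f"
    using G.inv_closed[of f] assms by (auto simp: Hom_iff hneg_def)
qed

lemma add_comm:
  assumes "f \<in> Arr C" "g \<in> Arr C" "src C f = src C g" "tgt C f = tgt C g"
  shows "f \<boxplus> g = g \<boxplus> f"
proof -
  interpret G: comm_group "hom_group C (src C g) (tgt C g)" using assms by (intro hom_comm_group) auto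
  show ?thesis using G.m_comm[of f g] assms by (auto simp: Hom_iff)
qed

lemma add_assoc:
  assumes "f \<in> Arr C" "g \<in> Arr C" "h \<in> Arr C" "src C f = src C g" "tgt C f = tgt C g"
    "src C g = src C h" "tgt C g = tgt C h"
  shows "f \<boxplus> g \<boxplus> h = f \<boxplus> (g \<boxplus> h)"
proof -
  interpret G: comm_group "hom_group C (src C g) (tgt C g)" using assms by (intro hom_comm_group) auto
  show ?thesis using G.m_assoc[of f g h] assms by (auto simp: Hom_iff)
qed

lemma add_left_comm:
  assumes "f \<in> Arr C" "g \<in> Arr C" "h \<in> Arr C" "src C f = src C g" "tgt C f = tgt C g"
    "src C g = src C h" "tgt C g = tgt C h"
  shows "f \<boxplus> (g \<boxplus> h) = g \<boxplus> (f \<boxplus> h)"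
  using add_assoc[of f g h] add_assoc[of g f h] add_comm[of f g] assms by simp

lemmas add_ac = add_assoc add_comm add_left_comm

lemma add_zero [simp]:
  assumes "f \<in> Arr C" "src C f = X" "tgt C f = Y"
  shows "f \<boxplus> hzero C X Y = f" "hzero C X Y \<boxplus> f = f"
proof -
  interpret G: comm_group "hom_group C (src C f) (tgt C f)" using assms by (intro hom_comm_group) auto
  show "f \<boxplus> hzero C X Y = f" "hzero C X Y \<boxplus> f = f"
    using G.r_one[of f] G.l_one[of f] assms by (auto simp: Hom_iff)
qed

lemma add_neg_self [simp]:
  assumes "f \<in> Arr C"
  shows "f \<boxplus> hneg f = hzero C (src C f) (tgt C f)" "hneg f \<boxplus> f = hzero C (src C f) (tgt C f)"
proof -
  interpret G: comm_group "hom_group C (src C f) (tgt C f)" using assms by (intro hom_comm_group) auto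
  show "f \<boxplus> hneg f = hzero C (src C f) (tgt C f)" "hneg f \<boxplus> f = hzero C (src C f) (tgt C f)"
    using G.r_inv[of f] G.l_inv[of f] assms by (auto simp: Hom_iff hneg_def)
qed

lemma add_cancel:
  assumes "f \<in> Arr C" "g \<in> Arr C" "h \<in> Arr C" "src C f = src C g" "tgt C f = tgt C g"
    "src C g = src C h" "tgt C g = tgt C h"
  shows "f \<boxplus> g = f \<boxplus> h \<longleftrightarrow> g = h"
proof -
  interpret G: comm_group "hom_group C (src C g) (tgt C g)" using assms by (intro hom_comm_group) auto
  show ?thesis using G.Units_l_cancel[of f g h, unfolded G.Units_eq] assms by (auto simp: Hom_iff)
qed

lemma add_neg_cancel [simp]:
  assumes "f \<in> Arr C" "g \<in> Arr C" "src C f = src C g" "tgt C f = tgt C g"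
  shows "f \<boxplus> (hneg f \<boxplus> g) = g" "hneg f \<boxplus> (f \<boxplus> g) = g"
  using add_assoc[of f "hneg f" g] add_assoc[of "hneg f" f g] assms by auto

lemma comp_distrib_left [simp]:
  assumes "f \<in> Arr C" "f' \<in> Arr C" "g \<in> Arr C" "src C f = src C f'" "tgt C f = src C g"
    "tgt C f' = src C g"
  shows "g \<cdot> (f \<boxplus> f') = g \<cdot> f \<boxplus> g \<cdot> f'"
  using comp_add_right[of f "src C f'" "src C g" f' g "tgt C g"] assms by (auto simp: Hom_iff)

lemma comp_distrib_right [simp]:
  assumes "f \<in> Arr C" "g' \<in> Arr C" "g \<in> Arr C" "src C g = tgt C f" "src C g' = tgt C f"
    "tgt C g = tgt C g'"
  shows "(g \<boxplus> g') \<cdot> f = g \<cdot> f \<boxplus> g' \<cdot> f"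
  using comp_add_left[of f "src C f" "tgt C f" g "tgt C g" g'] assms by (auto simp: Hom_iff)

lemma eq_zeroI:
  assumes "f \<in> Arr C" "f \<boxplus> f = f" "src C f = X" "tgt C f = Y" shows "f = hzero C X Y"
proof -
  have "f \<boxplus> f = f \<boxplus> hzero C X Y \<longleftrightarrow> f = hzero C X Y"
    by (rule add_cancel) (use assms in auto)
  then show ?thesis using assms by simp
qed

lemma comp_zero [simp]:
  assumes "g \<in> Arr C" "W \<in> Ob C"
  shows "Y = src C g \<Longrightarrow> g \<cdot> hzero C W Y = hzero C W (tgt C g)"
    "Y = tgt C g \<Longrightarrow> hzero C Y W \<cdot> g = hzero C (src C g) W"
proof -
  assume Y: "Y = src C g"
  have "g \<cdot> (hzero C W Y \<boxplus> hzero C W Y) = g \<cdot> hzero C W Y \<boxplus> g \<cdot> hzero C W Y"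
    using assms Y by (intro comp_distrib_left) auto
  then show "g \<cdot> hzero C W Y = hzero C W (tgt C g)"
    using assms Y by (intro eq_zeroI) auto
next
  assume Y: "Y = tgt C g"
  have "(hzero C Y W \<boxplus> hzero C Y W) \<cdot> g = hzero C Y W \<cdot> g \<boxplus> hzero C Y W \<cdot> g"
    using assms Y by (intro comp_distrib_right) auto
  then show "hzero C Y W \<cdot> g = hzero C (src C g) W"
    using assms Y by (intro eq_zeroI) auto
qed

lemma eq_negI:
  assumes "f \<in> Arr C" "g \<in> Arr C" "src C f = src C g" "tgt C f = tgt C g"
    "f \<boxplus> g = hzero C (src C f) (tgt C f)" shows "g = hneg f"
proof -
  have "f \<boxplus> g = f \<boxminus> f \<longleftrightarrow> g = hneg f"
    by (rule add_cancel) (use assms in auto)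
  then show ?thesis using assms by simp
qed

lemma comp_neg [simp]:
  assumes "g \<in> Arr C" "f \<in> Arr C" "tgt C f = src C g"
  shows "g \<cdot> hneg f = hneg (g \<cdot> f)" "hneg g \<cdot> f = hneg (g \<cdot> f)"
proof -
  have "g \<cdot> f \<boxplus> g \<cdot> hneg f = g \<cdot> (f \<boxminus> f)"
    using assms by (intro comp_distrib_left[symmetric]) auto
  also have "\<dots> = hzero C (src C (g \<cdot> f)) (tgt C (g \<cdot> f))"
    using assms by simp
  finally show "g \<cdot> hneg f = hneg (g \<cdot> f)"
    using assms by (intro eq_negI) auto
  have "g \<cdot> f \<boxplus> hneg g \<cdot> f = (g \<boxminus> g) \<cdot> f"
    using assms by (intro comp_distrib_right[symmetric]) auto
  also have "\<dots> = hzero C (src C (g \<cdot> f)) (tgt C (g \<cdot> f))"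
    using assms by simp
  finally show "hneg g \<cdot> f = hneg (g \<cdot> f)"
    using assms by (intro eq_negI) auto
qed

lemma neg_neg [simp]: "f \<in> Arr C \<Longrightarrow> hneg (hneg f) = f"
  by (rule eq_negI[symmetric]) auto

lemma neg_zero [simp]: "X \<in> Ob C \<Longrightarrow> Y \<in> Ob C \<Longrightarrow> hneg (hzero C X Y) = hzero C X Y"
  by (rule eq_negI[symmetric]) auto

lemma neg_add [simp]:
  assumes "f \<in> Arr C" "g \<in> Arr C" "src C f = src C g" "tgt C f = tgt C g"
  shows "hneg (f \<boxplus> g) = hneg f \<boxplus> hneg g"
proof (rule eq_negI[symmetric])
  show "f \<boxplus> g \<boxplus> (hneg f \<boxplus> hneg g) = hzero C (src C (f \<boxplus> g)) (tgt C (f \<boxplus> g))"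
    using assms add_comm[of "hneg f" "hneg g"] by (simp add: add_assoc)
qed (use assms in auto)

lemma diff_add [simp]:
  assumes "f \<in> Arr C" "g \<in> Arr C" "src C f = src C g" "tgt C f = tgt C g"
  shows "f \<boxminus> g \<boxplus> g = f" "g \<boxplus> (f \<boxminus> g) = f" "f \<boxplus> g \<boxminus> g = f"
proof -
  show "f \<boxminus> g \<boxplus> g = f" "f \<boxplus> g \<boxminus> g = f" using assms by (auto simp: add_assoc)
  then show "g \<boxplus> (f \<boxminus> g) = f" using add_comm[of "f \<boxminus> g" g] assms by auto
qed

lemma diff_eq_iff:
  assumes "f \<in> Arr C" "g \<in> Arr C" "h \<in> Arr C" "src C f = src C g" "tgt C f = tgt C g"
    "src C g = src C h" "tgt C g = tgt C h"
  shows "f \<boxminus> g = h \<longleftrightarrow> f = h \<boxplus> g"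
proof
  assume "f \<boxminus> g = h"
  then show "f = h \<boxplus> g" using assms(1-5) by (metis diff_add(1))
next
  assume "f = h \<boxplus> g"
  then show "f \<boxminus> g = h" using assms by (simp only: diff_add)
qed

section \<open>Endomorphism rings\<close>

lemma End_ring_sel [simp]: "carrier (End_ring C X) = Hom C X X"
  "x \<otimes>\<^bsub>End_ring C X\<^esub> y = x \<cdot> y" "\<one>\<^bsub>End_ring C X\<^esub> = ident C X"
  "x \<oplus>\<^bsub>End_ring C X\<^esub> y = x \<boxplus> y" "\<zero>\<^bsub>End_ring C X\<^esub> = hzero C X X"
  by (auto simp: End_ring_def)

lemma End_ring_ring:
  assumes X: "X \<in> Ob C" shows "ring (End_ring C X)"
proof (rule ringI)
  have e: "add_monoid (End_ring C X) = hom_group C X X"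
    by (simp add: hom_group_def End_ring_def)
  show "abelian_group (End_ring C X)"
    using hom_comm_group[OF X X] unfolding abelian_group_def abelian_group_axioms_def abelian_monoid_def e
    by (auto simp: comm_group_def)
  show "monoid (End_ring C X)"
    using X by (auto simp: monoid_def Hom_iff)
qed (auto simp: Hom_iff)

lemma End_minus:
  assumes "f \<in> Hom C X X" "g \<in> Hom C X X"
  shows "f \<ominus>\<^bsub>End_ring C X\<^esub> g = f \<boxminus> g"
proof -
  interpret R: ring "End_ring C X" using assms by (intro End_ring_ring) (auto simp: Hom_iff)
  have "\<ominus>\<^bsub>End_ring C X\<^esub> g = hneg g"
    using R.r_neg[of g] R.a_inv_closed[of g] assms by (intro eq_negI) (auto simp: Hom_iff simp del: R.r_neg R.a_inv_closed)
  then show ?thesis by (simp add: a_minus_def)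
qed

lemma End_Units_iff:
  "f \<in> Units (End_ring C X) \<longleftrightarrow> f \<in> Hom C X X \<and>
     (\<exists>g\<in>Hom C X X. g \<cdot> f = ident C X \<and> f \<cdot> g = ident C X)"
  by (auto simp: Units_def)

text \<open>The Jacobson trick: \<open>(1 - xy)\<^sup>-\<^sup>1 = 1 + x (1 - yx)\<^sup>-\<^sup>1 y\<close>.\<close>

lemma unit_one_minus_swap:
  assumes x: "x \<in> Hom C Y X" and y: "y \<in> Hom C X Y"
    and u: "ident C Y \<boxminus> y \<cdot> x \<in> Units (End_ring C Y)"
  shows "ident C X \<boxminus> x \<cdot> y \<in> Units (End_ring C X)"
proof -
  note [simp] = Hom_Ob[OF x] x[unfolded Hom_iff] y[unfolded Hom_iff]
  obtain v where v: "v \<in> Hom C Y Y" "v \<cdot> (ident C Y \<boxminus> y \<cdot> x) = ident C Y"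
    "(ident C Y \<boxminus> y \<cdot> x) \<cdot> v = ident C Y"
    using u by (auto simp: End_Units_iff)
  note [simp] = v(1)[unfolded Hom_iff]
  have 1: "v = ident C Y \<boxplus> v \<cdot> (y \<cdot> x)"
    using v(2) by (subst diff_eq_iff[symmetric]) auto
  have 2: "v = ident C Y \<boxplus> y \<cdot> (x \<cdot> v)"
    using v(3) by (subst diff_eq_iff[symmetric]) auto
  let ?w = "ident C X \<boxplus> x \<cdot> (v \<cdot> y)"
  have "x \<cdot> (v \<cdot> y) = x \<cdot> ((ident C Y \<boxplus> v \<cdot> (y \<cdot> x)) \<cdot> y)" by (rule arg_cong[OF 1, of "\<lambda>v. x \<cdot> (v \<cdot> y)"])
  then have 3: "x \<cdot> (v \<cdot> y) = x \<cdot> y \<boxplus> x \<cdot> (v \<cdot> (y \<cdot> (x \<cdot> y)))" by simp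
  have "x \<cdot> (v \<cdot> y) = x \<cdot> ((ident C Y \<boxplus> y \<cdot> (x \<cdot> v)) \<cdot> y)" by (rule arg_cong[OF 2, of "\<lambda>v. x \<cdot> (v \<cdot> y)"])
  then have 4: "x \<cdot> (v \<cdot> y) = x \<cdot> y \<boxplus> x \<cdot> (y \<cdot> (x \<cdot> (v \<cdot> y)))" by simp
  have "?w \<cdot> (ident C X \<boxminus> x \<cdot> y) = ident C X \<boxplus> (x \<cdot> (v \<cdot> y) \<boxminus> (x \<cdot> y \<boxplus> x \<cdot> (v \<cdot> (y \<cdot> (x \<cdot> y)))))"
    by (simp add: add_ac)
  then have 5: "?w \<cdot> (ident C X \<boxminus> x \<cdot> y) = ident C X"
    unfolding 3[symmetric] by simp
  have "(ident C X \<boxminus> x \<cdot> y) \<cdot> ?w = ident C X \<boxplus> (x \<cdot> (v \<cdot> y) \<boxminus> (x \<cdot> y \<boxplus> x \<cdot> (y \<cdot> (x \<cdot> (v \<cdot> y)))))"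
    by (simp add: add_ac)
  then have 6: "(ident C X \<boxminus> x \<cdot> y) \<cdot> ?w = ident C X"
    unfolding 4[symmetric] by simp
  show ?thesis unfolding End_Units_iff
    using 5 6 by (intro conjI bexI[of _ ?w]) (auto simp: Hom_iff)
qed

end

section \<open>Isomorphisms, retractions and images\<close>

context category
begin

text \<open>
  Composites are normalized by bracketing to the right.  This rule makes an equation \<open>g f = k\<close>
  applicable in the middle of such a composite.
\<close>

lemma comp_assoc_eq:
  assumes "g \<cdot> f = k" "f \<in> Arr C" "g \<in> Arr C" "h \<in> Arr C" "tgt C h = src C f" "tgt C f = src C g"
  shows "g \<cdot> (f \<cdot> h) = k \<cdot> h"
  using assms by (auto simp flip: assms(1))

lemma isoI:
  assumes "f \<in> Hom C X Y" "g \<in> Hom C Y X" "g \<cdot> f = ident C X" "f \<cdot> g = ident C Y"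
  shows "is_iso C f"
  using assms by (auto simp: is_iso_def Hom_iff)

lemma isoE:
  assumes "is_iso C f"
  obtains g where "f \<in> Arr C" "g \<in> Arr C" "src C g = tgt C f" "tgt C g = src C f"
    "g \<cdot> f = ident C (src C f)" "f \<cdot> g = ident C (tgt C f)"
  using assms by (auto simp: is_iso_def Hom_iff)

lemma iso_ident: "X \<in> Ob C \<Longrightarrow> is_iso C (ident C X)"
  by (rule isoI[of _ X X "ident C X"]) (auto simp: Hom_iff)

lemma retractionE:
  assumes "is_retraction C g"
  obtains s where "g \<in> Arr C" "s \<in> Arr C" "src C s = tgt C g" "tgt C s = src C g"
    "g \<cdot> s = ident C (tgt C g)"
  using assms by (auto simp: is_retraction_def Hom_iff)

lemma retractionI:
  assumes "g \<in> Hom C X Y" "s \<in> Hom C Y X" "g \<cdot> s = ident C Y"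
  shows "is_retraction C g"
  using assms by (auto simp: is_retraction_def Hom_iff)

lemma zero_objectD:
  assumes "zero_object C Z" "f \<in> Hom C X Y" "g \<in> Hom C X Y" "X = Z \<or> Y = Z"
  shows "f = g"
  using assms Hom_Ob[OF assms(2)] unfolding zero_object_def by metis

lemma hom_image_iff: "h \<in> hom_image C g X \<longleftrightarrow> (\<exists>k\<in>Hom C X (src C g). g \<cdot> k = h)"
  by (auto simp: hom_image_def)

lemma hom_imageI: "k \<in> Hom C X (src C g) \<Longrightarrow> g \<cdot> k \<in> hom_image C g X"
  by (auto simp: hom_image_def)

lemma hom_image_sub: "g \<in> Arr C \<Longrightarrow> hom_image C g X \<subseteq> Hom C X (tgt C g)"
  by (auto simp: hom_image_def Hom_iff)

lemma hom_image_comp: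
  "g \<in> Arr C \<Longrightarrow> u \<in> hom_image C g X \<Longrightarrow> h \<in> Hom C W X \<Longrightarrow> u \<cdot> h \<in> hom_image C g W"
  unfolding hom_image_iff by (elim bexE, rule bexI[where x = "_ \<cdot> h"]) (auto simp: Hom_iff)

lemma retraction_iff_hom_image:
  "g \<in> Arr C \<Longrightarrow> is_retraction C g \<longleftrightarrow> ident C (tgt C g) \<in> hom_image C g (tgt C g)"
  by (auto simp: is_retraction_def hom_image_def image_iff) (metis)

lemma hom_image_retraction:
  assumes "is_retraction C g" shows "hom_image C g X = Hom C X (tgt C g)"
proof
  obtain s where s: "g \<in> Arr C" "s \<in> Arr C" "src C s = tgt C g" "tgt C s = src C g"
    "g \<cdot> s = ident C (tgt C g)" using assms by (rule retractionE)
  show "hom_image C g X \<subseteq> Hom C X (tgt C g)" using s hom_image_sub by blast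
  show "Hom C X (tgt C g) \<subseteq> hom_image C g X"
  proof
    fix h assume "h \<in> Hom C X (tgt C g)"
    then have "g \<cdot> (s \<cdot> h) = h" "s \<cdot> h \<in> Hom C X (src C g)"
      using s comp_assoc_right[of h s g] by (auto simp: Hom_iff simp del: comp_assoc_right)
    then show "h \<in> hom_image C g X" using hom_imageI by metis
  qed
qed

section \<open>Pullbacks and pushouts\<close>

lemma pullbackD:
  assumes "is_pullback C p f p' f'"
  shows "p \<in> Arr C" "f \<in> Arr C" "p' \<in> Arr C" "f' \<in> Arr C" "tgt C f = tgt C p" "tgt C p' = src C f"
    "tgt C f' = src C p" "src C f' = src C p'" "f \<cdot> p' = p \<cdot> f'"
  using assms by (auto simp: is_pullback_def)

lemma pullback_lift:
  assumes "is_pullback C p f p' f'" "a \<in> Hom C W (src C f)" "b \<in> Hom C W (src C p)" "f \<cdot> a = p \<cdot> b"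
  obtains k where "k \<in> Hom C W (src C p')" "p' \<cdot> k = a" "f' \<cdot> k = b"
  using assms Hom_Ob[OF assms(2)] unfolding is_pullback_def by blast

lemma pullback_unique:
  assumes "is_pullback C p f p' f'" "k \<in> Hom C W (src C p')" "k' \<in> Hom C W (src C p')"
    "p' \<cdot> k = p' \<cdot> k'" "f' \<cdot> k = f' \<cdot> k'"
  shows "k = k'"
proof -
  note p = pullbackD[OF assms(1)]
  have "p' \<cdot> k \<in> Hom C W (src C f)" "f' \<cdot> k \<in> Hom C W (src C p)" "f \<cdot> (p' \<cdot> k) = p \<cdot> (f' \<cdot> k)"
    using p assms(2) comp_assoc_right[of k p' f] comp_assoc_right[of k f' p] by (auto simp: Hom_iff simp del: comp_assoc_right)
  then have "\<exists>!x. x \<in> Hom C W (src C p') \<and> p' \<cdot> x = p' \<cdot> k \<and> f' \<cdot> x = f' \<cdot> k"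
    using assms(1) Hom_Ob[OF assms(2)] unfolding is_pullback_def by blast
  then show ?thesis using assms by metis
qed

text \<open>
  On subfunctors a pullback is an inverse image.  Hence the defect of \<open>p'\<close> is the subobject of the
  defect of \<open>p\<close> generated by the class of \<open>f\<close>.
\<close>

lemma pullback_hom_image:
  assumes "is_pullback C p f p' f'"
  shows "hom_image C p' W = {h \<in> Hom C W (src C f). f \<cdot> h \<in> hom_image C p W}"
proof (intro Set.set_eqI iffI)
  note p = pullbackD[OF assms]
  fix h assume "h \<in> hom_image C p' W"
  then obtain k where k: "k \<in> Hom C W (src C p')" "p' \<cdot> k = h" by (auto simp: hom_image_iff)
  then have "f \<cdot> h = p \<cdot> (f' \<cdot> k)"
    using p comp_assoc_right[of k p' f] comp_assoc_right[of k f' p] by (auto simp: Hom_iff simp del: comp_assoc_right)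
  then show "h \<in> {h \<in> Hom C W (src C f). f \<cdot> h \<in> hom_image C p W}"
    using k p by (auto simp: hom_image_iff Hom_iff intro!: bexI[of _ "f' \<cdot> k"])
next
  fix h assume "h \<in> {h \<in> Hom C W (src C f). f \<cdot> h \<in> hom_image C p W}"
  then obtain k where "h \<in> Hom C W (src C f)" "k \<in> Hom C W (src C p)" "f \<cdot> h = p \<cdot> k"
    by (auto simp: hom_image_iff)
  with assms show "h \<in> hom_image C p' W"
    by (elim pullback_lift) (auto simp: hom_image_iff)
qed

lemma pullback_iso:
  assumes "is_pullback C p f p1 f1" "is_pullback C p f p2 f2"
  obtains a where "a \<in> Hom C (src C p1) (src C p2)" "is_iso C a" "p2 \<cdot> a = p1" "f2 \<cdot> a = f1"
proof -
  note p = pullbackD[OF assms(1)] and q = pullbackD[OF assms(2)]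
  obtain a where a: "a \<in> Hom C (src C p1) (src C p2)" "p2 \<cdot> a = p1" "f2 \<cdot> a = f1"
    by (rule pullback_lift[OF assms(2), of p1 "src C p1" f1]) (use p q in \<open>auto simp: Hom_iff\<close>)
  obtain b where b: "b \<in> Hom C (src C p2) (src C p1)" "p1 \<cdot> b = p2" "f1 \<cdot> b = f2"
    by (rule pullback_lift[OF assms(1), of p2 "src C p2" f2]) (use p q in \<open>auto simp: Hom_iff\<close>)
  have "b \<cdot> a = ident C (src C p1)"
    by (rule pullback_unique[OF assms(1), where W = "src C p1"]) (use a b p q in \<open>auto simp: Hom_iff comp_assoc_eq[OF b(2)] comp_assoc_eq[OF b(3)]\<close>)
  moreover have "a \<cdot> b = ident C (src C p2)"
    by (rule pullback_unique[OF assms(2), where W = "src C p2"]) (use a b p q in \<open>auto simp: Hom_iff comp_assoc_eq[OF a(2)] comp_assoc_eq[OF a(3)]\<close>)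
  ultimately show ?thesis using a b isoI that by blast
qed

lemma pushoutD:
  assumes "is_pushout C i f i' f'"
  shows "i \<in> Arr C" "f \<in> Arr C" "i' \<in> Arr C" "f' \<in> Arr C" "src C f = src C i" "src C i' = tgt C f"
    "src C f' = tgt C i" "tgt C f' = tgt C i'" "i' \<cdot> f = f' \<cdot> i"
  using assms by (auto simp: is_pushout_def)

lemma pushout_lift:
  assumes "is_pushout C i f i' f'" "a \<in> Hom C (tgt C f) W" "b \<in> Hom C (tgt C i) W" "a \<cdot> f = b \<cdot> i"
  obtains k where "k \<in> Hom C (tgt C i') W" "k \<cdot> i' = a" "k \<cdot> f' = b"
  using assms Hom_Ob[OF assms(2)] unfolding is_pushout_def by blast

lemma pushout_unique:
  assumes "is_pushout C i f i' f'" "k \<in> Hom C (tgt C i') W" "k' \<in> Hom C (tgt C i') W"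
    "k \<cdot> i' = k' \<cdot> i'" "k \<cdot> f' = k' \<cdot> f'"
  shows "k = k'"
proof -
  note p = pushoutD[OF assms(1)]
  have "k \<cdot> i' \<in> Hom C (tgt C f) W" "k \<cdot> f' \<in> Hom C (tgt C i) W" "(k \<cdot> i') \<cdot> f = (k \<cdot> f') \<cdot> i"
    using p assms(2) by (auto simp: Hom_iff)
  then have "\<exists>!x. x \<in> Hom C (tgt C i') W \<and> x \<cdot> i' = k \<cdot> i' \<and> x \<cdot> f' = k \<cdot> f'"
    using assms(1) Hom_Ob[OF assms(2)] unfolding is_pushout_def by blast
  then show ?thesis using assms by metis
qed

lemma pushout_iso:
  assumes "is_pushout C i f i1 f1" "is_pushout C i f i2 f2"
  obtains a where "a \<in> Hom C (tgt C i1) (tgt C i2)" "is_iso C a" "a \<cdot> i1 = i2" "a \<cdot> f1 = f2"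
proof -
  note p = pushoutD[OF assms(1)] and q = pushoutD[OF assms(2)]
  obtain a where a: "a \<in> Hom C (tgt C i1) (tgt C i2)" "a \<cdot> i1 = i2" "a \<cdot> f1 = f2"
    by (rule pushout_lift[OF assms(1), of i2 "tgt C i2" f2]) (use p q in \<open>auto simp: Hom_iff\<close>)
  obtain b where b: "b \<in> Hom C (tgt C i2) (tgt C i1)" "b \<cdot> i2 = i1" "b \<cdot> f2 = f1"
    by (rule pushout_lift[OF assms(2), of i1 "tgt C i1" f1]) (use p q in \<open>auto simp: Hom_iff\<close>)
  have "b \<cdot> a = ident C (tgt C i1)"
    by (rule pushout_unique[OF assms(1), where W = "tgt C i1"]) (use a b p q in \<open>auto simp: Hom_iff\<close>)
  moreover have "a \<cdot> b = ident C (tgt C i2)"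
    by (rule pushout_unique[OF assms(2), where W = "tgt C i2"]) (use a b p q in \<open>auto simp: Hom_iff\<close>)
  ultimately show ?thesis using a b isoI that by blast
qed

section \<open>Kernels and cokernels\<close>

lemma kernelD:
  assumes "is_kernel C f g"
  shows "f \<in> Arr C" "g \<in> Arr C" "src C g = tgt C f" "g \<cdot> f = hzero C (src C f) (tgt C g)"
  using assms by (auto simp: is_kernel_def)

lemma kernel_lift:
  assumes "is_kernel C f g" "h \<in> Hom C W (src C g)" "g \<cdot> h = hzero C W (tgt C g)"
  obtains k where "k \<in> Hom C W (src C f)" "f \<cdot> k = h"
  using assms Hom_Ob[OF assms(2)] unfolding is_kernel_def by blast

lemma cokernelD:
  assumes "is_cokernel C g f"
  shows "f \<in> Arr C" "g \<in> Arr C" "src C g = tgt C f" "g \<cdot> f = hzero C (src C f) (tgt C g)"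
  using assms by (auto simp: is_cokernel_def)

lemma cokernel_lift:
  assumes "is_cokernel C g f" "h \<in> Hom C (tgt C f) W" "h \<cdot> f = hzero C (src C f) W"
  obtains k where "k \<in> Hom C (tgt C g) W" "k \<cdot> g = h"
  using assms Hom_Ob[OF assms(2)] unfolding is_cokernel_def by blast

end

context preadditive_category
begin

lemma kernel_mono:
  assumes "is_kernel C f g" "k \<in> Hom C W (src C f)" "k' \<in> Hom C W (src C f)" "f \<cdot> k = f \<cdot> k'"
  shows "k = k'"
proof -
  note K = kernelD[OF assms(1)]
  have W: "W \<in> Ob C" using Hom_Ob[OF assms(2)] by simp
  have "g \<cdot> (f \<cdot> k) = hzero C W (tgt C g)" "f \<cdot> k \<in> Hom C W (src C g)"
    using K W assms(2) comp_assoc_right[of k f g] by (auto simp: Hom_iff simp del: comp_assoc_right)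
  then have "\<exists>!x. x \<in> Hom C W (src C f) \<and> f \<cdot> x = f \<cdot> k"
    using assms(1) W unfolding is_kernel_def by blast
  then show ?thesis using assms by metis
qed

lemma cokernel_epi:
  assumes "is_cokernel C g f" "k \<in> Hom C (tgt C g) W" "k' \<in> Hom C (tgt C g) W" "k \<cdot> g = k' \<cdot> g"
  shows "k = k'"
proof -
  note K = cokernelD[OF assms(1)]
  have W: "W \<in> Ob C" using Hom_Ob[OF assms(2)] by simp
  have "(k \<cdot> g) \<cdot> f = hzero C (src C f) W" "k \<cdot> g \<in> Hom C (tgt C f) W"
    using K W assms(2) by (auto simp: Hom_iff)
  then have "\<exists>!x. x \<in> Hom C (tgt C g) W \<and> x \<cdot> g = k \<cdot> g"
    using assms(1) W unfolding is_cokernel_def by blast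
  then show ?thesis using assms by metis
qed

lemma kernelI:
  assumes "f \<in> Arr C" "g \<in> Arr C" "src C g = tgt C f" "g \<cdot> f = hzero C (src C f) (tgt C g)"
    and lift: "\<And>W h. \<lbrakk>W \<in> Ob C; h \<in> Hom C W (tgt C f); g \<cdot> h = hzero C W (tgt C g)\<rbrakk> \<Longrightarrow>
        \<exists>k\<in>Hom C W (src C f). f \<cdot> k = h"
    and mono: "\<And>W k k'. \<lbrakk>k \<in> Hom C W (src C f); k' \<in> Hom C W (src C f); f \<cdot> k = f \<cdot> k'\<rbrakk> \<Longrightarrow> k = k'"
  shows "is_kernel C f g"
  unfolding is_kernel_def using assms(1-4)
  by auto (metis lift, metis mono)

lemma cokernelI:
  assumes "f \<in> Arr C" "g \<in> Arr C" "src C g = tgt C f" "g \<cdot> f = hzero C (src C f) (tgt C g)"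
    and lift: "\<And>W h. \<lbrakk>W \<in> Ob C; h \<in> Hom C (tgt C f) W; h \<cdot> f = hzero C (src C f) W\<rbrakk> \<Longrightarrow>
        \<exists>k\<in>Hom C (tgt C g) W. k \<cdot> g = h"
    and epi: "\<And>W k k'. \<lbrakk>k \<in> Hom C (tgt C g) W; k' \<in> Hom C (tgt C g) W; k \<cdot> g = k' \<cdot> g\<rbrakk> \<Longrightarrow> k = k'"
  shows "is_cokernel C g f"
  unfolding is_cokernel_def using assms(1-4)
  by auto (metis lift, metis epi)

lemma kernel_iso:
  assumes "is_kernel C f g" "is_kernel C f' g"
  obtains a where "a \<in> Hom C (src C f) (src C f')" "is_iso C a" "f' \<cdot> a = f"
proof -
  note p = kernelD[OF assms(1)] and q = kernelD[OF assms(2)]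
  obtain a where a: "a \<in> Hom C (src C f) (src C f')" "f' \<cdot> a = f"
    by (rule kernel_lift[OF assms(2), of f "src C f"]) (use p q in \<open>auto simp: Hom_iff\<close>)
  obtain b where b: "b \<in> Hom C (src C f') (src C f)" "f \<cdot> b = f'"
    by (rule kernel_lift[OF assms(1), of f' "src C f'"]) (use p q in \<open>auto simp: Hom_iff\<close>)
  have "b \<cdot> a = ident C (src C f)"
    by (rule kernel_mono[OF assms(1), where W = "src C f"]) (use a b p q in \<open>auto simp: Hom_iff comp_assoc_eq[OF b(2)]\<close>)
  moreover have "a \<cdot> b = ident C (src C f')"
    by (rule kernel_mono[OF assms(2), where W = "src C f'"]) (use a b p q in \<open>auto simp: Hom_iff comp_assoc_eq[OF a(2)]\<close>)
  ultimately show ?thesis using a b isoI that by blast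
qed

lemma cokernel_iso:
  assumes "is_cokernel C g f" "is_cokernel C g' f"
  obtains a where "a \<in> Hom C (tgt C g) (tgt C g')" "is_iso C a" "a \<cdot> g = g'"
proof -
  note p = cokernelD[OF assms(1)] and q = cokernelD[OF assms(2)]
  obtain a where a: "a \<in> Hom C (tgt C g) (tgt C g')" "a \<cdot> g = g'"
    by (rule cokernel_lift[OF assms(1), of g' "tgt C g'"]) (use p q in \<open>auto simp: Hom_iff\<close>)
  obtain b where b: "b \<in> Hom C (tgt C g') (tgt C g)" "b \<cdot> g' = g"
    by (rule cokernel_lift[OF assms(2), of g "tgt C g"]) (use p q in \<open>auto simp: Hom_iff\<close>)
  have "b \<cdot> a = ident C (tgt C g)"
    by (rule cokernel_epi[OF assms(1), where W = "tgt C g"]) (use a b p q in \<open>auto simp: Hom_iff\<close>)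
  moreover have "a \<cdot> b = ident C (tgt C g')"
    by (rule cokernel_epi[OF assms(2), where W = "tgt C g'"]) (use a b p q in \<open>auto simp: Hom_iff\<close>)
  ultimately show ?thesis using a b isoI that by blast
qed

text \<open>
  Pushing out does not change the end term, and the new cokernel map has a larger image than the
  old one, which factors through it.
\<close>

lemma pushout_cokernel:
  assumes po: "is_pushout C i f i' f'" and c: "is_cokernel C c i"
  obtains e where "is_cokernel C e i'" "tgt C e = tgt C c" "e \<cdot> f' = c"
proof -
  note P = pushoutD[OF po] and K = cokernelD[OF c]
  note [simp] = P(1-8) K(2,3)
  obtain e where e: "e \<in> Hom C (tgt C i') (tgt C c)" "e \<cdot> i' = hzero C (tgt C f) (tgt C c)" "e \<cdot> f' = c"
    by (rule pushout_lift[OF po, of "hzero C (tgt C f) (tgt C c)" "tgt C c" c]) (auto simp: Hom_iff K(4))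
  note [simp] = e(1)[unfolded Hom_iff]
  have "is_cokernel C e i'"
  proof (rule cokernelI)
    fix W h assume "W \<in> Ob C" "h \<in> Hom C (tgt C i') W" and h: "h \<cdot> i' = hzero C (src C i') W"
    then have [simp]: "W \<in> Ob C" "h \<in> Arr C" "src C h = tgt C i'" "tgt C h = W" by (auto simp: Hom_iff)
    have "(h \<cdot> f') \<cdot> i = (h \<cdot> i') \<cdot> f" by (simp add: P(9))
    also have "\<dots> = hzero C (src C i) W" unfolding h by simp
    finally obtain n where n: "n \<in> Hom C (tgt C c) W" "n \<cdot> c = h \<cdot> f'"
      by (rule cokernel_lift[OF c, of "h \<cdot> f'" W, rotated]) (auto simp: Hom_iff)
    have "n \<cdot> e = h"
      by (rule pushout_unique[OF po, of _ W]) (use n in \<open>auto simp: Hom_iff e(2,3) h\<close>)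
    then show "\<exists>n\<in>Hom C (tgt C e) W. n \<cdot> e = h" using n by auto
  next
    fix W x y assume xy: "x \<in> Hom C (tgt C e) W" "y \<in> Hom C (tgt C e) W" "x \<cdot> e = y \<cdot> e"
    then have "(x \<cdot> e) \<cdot> f' = (y \<cdot> e) \<cdot> f'" by (simp only:)
    then have "x \<cdot> c = y \<cdot> c" using xy(1,2) e(3) by (simp add: Hom_iff)
    then show "x = y" using cokernel_epi[OF c] xy by auto
  qed (auto simp: e(2))
  then show ?thesis using that e by auto
qed

lemma kernel_section_retraction:
  assumes k: "is_kernel C f g" and c: "is_cokernel C g f"
  shows "is_retraction C g \<longleftrightarrow> (\<exists>r\<in>Hom C (tgt C f) (src C f). r \<cdot> f = ident C (src C f))"
proof
  note K = kernelD[OF k]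
  note [simp] = K(1-3)
  note gf = K(4) comp_assoc_eq[OF K(4)]
  assume "is_retraction C g"
  then obtain s where s: "s \<in> Arr C" "src C s = tgt C g" "tgt C s = src C g" "g \<cdot> s = ident C (tgt C g)"
    using retractionE by blast
  note [simp] = s(1-3)
  obtain r where r: "r \<in> Hom C (tgt C f) (src C f)" "f \<cdot> r = ident C (tgt C f) \<boxminus> s \<cdot> g"
    by (rule kernel_lift[OF k, of "ident C (tgt C f) \<boxminus> s \<cdot> g" "tgt C f"]) (auto simp: Hom_iff comp_assoc_eq[OF s(4)])
  note [simp] = r(1)[unfolded Hom_iff]
  have "r \<cdot> f = ident C (src C f)"
    by (rule kernel_mono[OF k, of _ "src C f"]) (auto simp: Hom_iff comp_assoc_eq[OF r(2)] gf)
  with r show "\<exists>r\<in>Hom C (tgt C f) (src C f). r \<cdot> f = ident C (src C f)" by auto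
next
  note K = kernelD[OF k]
  note [simp] = K(1-3)
  note gf = K(4) comp_assoc_eq[OF K(4)]
  assume "\<exists>r\<in>Hom C (tgt C f) (src C f). r \<cdot> f = ident C (src C f)"
  then obtain r where r: "r \<in> Hom C (tgt C f) (src C f)" "r \<cdot> f = ident C (src C f)" by auto
  note [simp] = r(1)[unfolded Hom_iff]
  obtain s where s: "s \<in> Hom C (tgt C g) (tgt C f)" "s \<cdot> g = ident C (tgt C f) \<boxminus> f \<cdot> r"
    by (rule cokernel_lift[OF c, of "ident C (tgt C f) \<boxminus> f \<cdot> r" "tgt C f"]) (auto simp: Hom_iff r(2))
  note [simp] = s(1)[unfolded Hom_iff]
  have "g \<cdot> s = ident C (tgt C g)"
    by (rule cokernel_epi[OF c, of _ "tgt C g"]) (auto simp: Hom_iff s(2) gf)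
  then show "is_retraction C g" using s by (intro retractionI[of g "tgt C f" _ s]) (auto simp: Hom_iff)
qed

lemma hom_image_add:
  assumes "g \<in> Arr C" "u \<in> hom_image C g X" "v \<in> hom_image C g X"
  shows "u \<boxplus> v \<in> hom_image C g X"
proof -
  obtain k l where "k \<in> Hom C X (src C g)" "l \<in> Hom C X (src C g)" "u = g \<cdot> k" "v = g \<cdot> l"
    using assms by (auto simp: hom_image_iff)
  then show ?thesis unfolding hom_image_iff using assms
    by (intro bexI[of _ "k \<boxplus> l"]) (auto simp: Hom_iff)
qed

lemma hom_image_neg:
  assumes "g \<in> Arr C" "u \<in> hom_image C g X"
  shows "hneg u \<in> hom_image C g X"
proof -
  obtain k where "k \<in> Hom C X (src C g)" "u = g \<cdot> k"
    using assms by (auto simp: hom_image_iff)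
  then show ?thesis unfolding hom_image_iff using assms
    by (intro bexI[of _ "hneg k"]) (auto simp: Hom_iff)
qed

lemma hom_image_zero:
  assumes "g \<in> Arr C" "X \<in> Ob C"
  shows "hzero C X (tgt C g) \<in> hom_image C g X"
  unfolding hom_image_iff using assms
    by (intro bexI[of _ "hzero C X (src C g)"]) (auto simp: Hom_iff)

section \<open>The radical of an object with local endomorphism ring\<close>

abbreviation local_object where "local_object Z \<equiv> Z \<in> Ob C \<and> local_ring (End_ring C Z)"

lemma local_objectD:
  assumes "local_object Z"
  shows "ident C Z \<noteq> hzero C Z Z"
    "\<lbrakk>f \<in> Hom C Z Z; f \<notin> Units (End_ring C Z)\<rbrakk> \<Longrightarrow> ident C Z \<boxminus> f \<in> Units (End_ring C Z)"
proof -
  show "ident C Z \<noteq> hzero C Z Z" using assms by (auto simp: local_ring_def)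
  assume f: "f \<in> Hom C Z Z" "f \<notin> Units (End_ring C Z)"
  have "ident C Z \<in> Units (End_ring C Z)"
    unfolding End_Units_iff using assms by (auto simp: Hom_iff intro!: bexI[of _ "ident C Z"])
  then have "ident C Z \<boxminus> f \<boxplus> f \<in> Units (End_ring C Z)"
    using f assms by (auto simp: Hom_iff)
  moreover have "ident C Z \<boxminus> f \<in> Hom C Z Z" using f assms by (auto simp: Hom_iff)
  moreover have "\<forall>a\<in>Hom C Z Z. \<forall>b\<in>Hom C Z Z. a \<boxplus> b \<in> Units (End_ring C Z) \<longrightarrow>
      a \<in> Units (End_ring C Z) \<or> b \<in> Units (End_ring C Z)"
    using assms by (auto simp: local_ring_def)
  ultimately show "ident C Z \<boxminus> f \<in> Units (End_ring C Z)"
    using f by blast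
qed

lemma jacobson_radical_iff:
  "f \<in> jacobson_radical C X Y \<longleftrightarrow> f \<in> Hom C X Y \<and>
     (\<forall>g\<in>Hom C Y X. ident C X \<boxminus> g \<cdot> f \<in> Units (End_ring C X))"
proof -
  have "ident C X \<ominus>\<^bsub>End_ring C X\<^esub> g \<cdot> f = ident C X \<boxminus> g \<cdot> f" if "f \<in> Hom C X Y" "g \<in> Hom C Y X" for g
    using that Hom_Ob[OF that(1)] by (intro End_minus) (auto simp: Hom_iff)
  then show ?thesis by (auto simp: jacobson_radical_def)
qed

text \<open>
  If \<open>h\<close> is not a retraction, then no \<open>h g\<close> is a unit of the local ring \<open>End Z\<close>; therefore \<open>1 - h g\<close>
  is one, and so is \<open>1 - g h\<close> by \<open>unit_one_minus_swap\<close>.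
\<close>

lemma jacobson_radical_local:
  assumes Z: "local_object Z"
  shows "h \<in> jacobson_radical C W Z \<longleftrightarrow> h \<in> Hom C W Z \<and> \<not> is_retraction C h"
proof
  assume h: "h \<in> jacobson_radical C W Z"
  then have hh: "h \<in> Hom C W Z" by (simp add: jacobson_radical_iff)
  have "\<not> is_retraction C h"
  proof
    assume "is_retraction C h"
    then obtain s where s: "s \<in> Hom C Z W" "h \<cdot> s = ident C Z"
      using hh by (auto simp: is_retraction_def Hom_iff)
    then have "ident C W \<boxminus> s \<cdot> h \<in> Units (End_ring C W)" using h by (auto simp: jacobson_radical_iff)
    then have "ident C Z \<boxminus> h \<cdot> s \<in> Units (End_ring C Z)"
      by (rule unit_one_minus_swap[OF hh s(1)])
    then obtain v where "v \<in> Hom C Z Z" "v \<cdot> hzero C Z Z = ident C Z"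
      using s Z by (auto simp: End_Units_iff)
    then show False using Z local_objectD[OF Z] by (auto simp: Hom_iff)
  qed
  with hh show "h \<in> Hom C W Z \<and> \<not> is_retraction C h" by simp
next
  assume h: "h \<in> Hom C W Z \<and> \<not> is_retraction C h"
  have "ident C W \<boxminus> g \<cdot> h \<in> Units (End_ring C W)" if g: "g \<in> Hom C Z W" for g
  proof (rule unit_one_minus_swap[OF g])
    have "h \<cdot> g \<notin> Units (End_ring C Z)"
    proof
      assume "h \<cdot> g \<in> Units (End_ring C Z)"
      then obtain v where "v \<in> Hom C Z Z" "(h \<cdot> g) \<cdot> v = ident C Z" by (auto simp: End_Units_iff)
      then have "is_retraction C h" using h g
        by (intro retractionI[of h W Z "g \<cdot> v"]) (auto simp: Hom_iff)
      with h show False by simp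
    qed
    then show "ident C Z \<boxminus> h \<cdot> g \<in> Units (End_ring C Z)"
      using h g Z by (intro local_objectD[OF Z]) (auto simp: Hom_iff)
  qed (use h in auto)
  with h show "h \<in> jacobson_radical C W Z" by (auto simp: jacobson_radical_iff)
qed

lemma jacobson_radical_unit:
  assumes h: "h \<in> jacobson_radical C W Z" and m: "m \<in> Hom C Z W"
  shows "ident C Z \<boxminus> h \<cdot> m \<in> Units (End_ring C Z)"
  using assms by (intro unit_one_minus_swap[of h W Z m]) (auto simp: jacobson_radical_iff)

text \<open>
  Let \<open>h s = 1\<close>.  Were the idempotent \<open>s h\<close> not a unit, then \<open>1 - s h\<close> would be one, and
  \<open>h (1 - s h) = 0\<close> would give \<open>h = 0\<close>.  So \<open>s h\<close> is a unit, and an idempotent unit is \<open>1\<close>.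
\<close>

lemma local_retraction_iso:
  assumes W: "local_object W" and Z: "local_object Z" and h: "h \<in> Hom C W Z" "is_retraction C h"
  shows "is_iso C h"
proof -
  obtain s where s: "s \<in> Hom C Z W" "h \<cdot> s = ident C Z"
    using h by (auto simp: is_retraction_def Hom_iff)
  note [simp] = s[unfolded Hom_iff] h(1)[unfolded Hom_iff]
  have [simp]: "W \<in> Ob C" "Z \<in> Ob C" using W Z by auto
  have hsh: "h \<cdot> (s \<cdot> h) = h" by (simp add: comp_assoc_eq[OF s(2)])
  have "s \<cdot> h \<in> Units (End_ring C W)"
  proof (rule ccontr)
    assume "s \<cdot> h \<notin> Units (End_ring C W)"
    then have "ident C W \<boxminus> s \<cdot> h \<in> Units (End_ring C W)"
      by (intro local_objectD[OF W]) (auto simp: Hom_iff)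
    then obtain v where v: "v \<in> Hom C W W" "(ident C W \<boxminus> s \<cdot> h) \<cdot> v = ident C W"
      by (auto simp: End_Units_iff)
    have "h = h \<cdot> ((ident C W \<boxminus> s \<cdot> h) \<cdot> v)" unfolding v by simp
    also have "\<dots> = (h \<cdot> (ident C W \<boxminus> s \<cdot> h)) \<cdot> v" using v by (intro comp_assoc_right[symmetric]) (auto simp: Hom_iff)
    also have "\<dots> = hzero C W Z" using v by (simp add: hsh Hom_iff)
    finally have "h \<cdot> s = hzero C Z Z" by simp
    then show False using s local_objectD(1)[OF Z] by simp
  qed
  then obtain v where v: "v \<in> Hom C W W" "v \<cdot> (s \<cdot> h) = ident C W"
    by (auto simp: End_Units_iff)
  have "s \<cdot> h = (v \<cdot> (s \<cdot> h)) \<cdot> (s \<cdot> h)" unfolding v by simp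
  also have "\<dots> = v \<cdot> (s \<cdot> (h \<cdot> (s \<cdot> h)))" using v(1) by (simp add: Hom_iff)
  also have "\<dots> = ident C W" unfolding hsh by (rule v)
  finally show ?thesis using s h by (intro isoI[of h W Z s]) auto
qed

lemma local_object_iso:
  assumes X: "local_object X" and f: "f \<in> Hom C X Y" "is_iso C f"
  shows "local_object Y"
proof -
  obtain g where g: "g \<in> Arr C" "src C g = Y" "tgt C g = X" "g \<cdot> f = ident C X" "f \<cdot> g = ident C Y"
    using f by (elim isoE) (auto simp: Hom_iff)
  note [simp] = f(1)[unfolded Hom_iff] g
  have [simp]: "X \<in> Ob C" "Y \<in> Ob C" using Hom_Ob[OF f(1)] by auto
  have gf [simp]: "g \<cdot> (f \<cdot> x) = x" if "x \<in> Arr C" "tgt C x = X" for x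
    using that by (simp add: comp_assoc_eq[OF g(4)])
  have fg [simp]: "f \<cdot> (g \<cdot> x) = x" if "x \<in> Arr C" "tgt C x = Y" for x
    using that by (simp add: comp_assoc_eq[OF g(5)])
  have reflect: "a \<in> Units (End_ring C Y)" if a: "a \<in> Hom C Y Y" "g \<cdot> (a \<cdot> f) \<in> Units (End_ring C X)" for a
  proof -
    note [simp] = a(1)[unfolded Hom_iff]
    obtain v where v: "v \<in> Hom C X X" "v \<cdot> (g \<cdot> (a \<cdot> f)) = ident C X" "g \<cdot> (a \<cdot> (f \<cdot> v)) = ident C X"
      using a(2) by (auto simp: End_Units_iff Hom_iff)
    note [simp] = v(1)[unfolded Hom_iff]
    have "(f \<cdot> (v \<cdot> g)) \<cdot> a = f \<cdot> ((v \<cdot> (g \<cdot> (a \<cdot> f))) \<cdot> g)" by simp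
    also have "\<dots> = ident C Y" by (simp only: v) simp
    finally have 1: "(f \<cdot> (v \<cdot> g)) \<cdot> a = ident C Y" .
    have "a \<cdot> (f \<cdot> (v \<cdot> g)) = f \<cdot> ((g \<cdot> (a \<cdot> (f \<cdot> v))) \<cdot> g)" by simp
    also have "\<dots> = ident C Y" by (simp only: v) simp
    finally have 2: "a \<cdot> (f \<cdot> (v \<cdot> g)) = ident C Y" .
    show ?thesis unfolding End_Units_iff using 1 2 by (auto simp: Hom_iff intro!: bexI[of _ "f \<cdot> (v \<cdot> g)"])
  qed
  have forth: "g \<cdot> (a \<cdot> f) \<in> Units (End_ring C X)" if a: "a \<in> Units (End_ring C Y)" for a
  proof -
    obtain v where v: "a \<in> Hom C Y Y" "v \<in> Hom C Y Y" "v \<cdot> a = ident C Y" "a \<cdot> v = ident C Y"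
      using a by (auto simp: End_Units_iff)
    note [simp] = v(1,2)[unfolded Hom_iff] v(3,4)
    have [simp]: "v \<cdot> (a \<cdot> f) = f" using comp_assoc_right[of f a v] by (simp del: comp_assoc_right)
    have [simp]: "a \<cdot> (v \<cdot> f) = f" using comp_assoc_right[of f v a] by (simp del: comp_assoc_right)
    show ?thesis unfolding End_Units_iff by (auto simp: Hom_iff intro!: bexI[of _ "g \<cdot> (v \<cdot> f)"])
  qed
  have "a \<in> Units (End_ring C Y) \<or> b \<in> Units (End_ring C Y)"
    if ab: "a \<in> Hom C Y Y" "b \<in> Hom C Y Y" "a \<boxplus> b \<in> Units (End_ring C Y)" for a b
  proof -
    have "g \<cdot> (a \<cdot> f) \<boxplus> g \<cdot> (b \<cdot> f) \<in> Units (End_ring C X)"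
      using forth[OF ab(3)] ab by (auto simp: Hom_iff)
    then have "g \<cdot> (a \<cdot> f) \<in> Units (End_ring C X) \<or> g \<cdot> (b \<cdot> f) \<in> Units (End_ring C X)"
      using X ab unfolding local_ring_def by (auto simp: Hom_iff)
    then show ?thesis using reflect ab by auto
  qed
  moreover have "ident C Y \<noteq> hzero C Y Y"
  proof
    assume "ident C Y = hzero C Y Y"
    then have "g \<cdot> (ident C Y \<cdot> f) = g \<cdot> (hzero C Y Y \<cdot> f)" by simp
    then show False using local_objectD(1)[OF X] by simp
  qed
  ultimately show ?thesis using End_ring_ring by (auto simp: local_ring_def)
qed

section \<open>Direct sums\<close>

lemma finsum_induct:
  assumes Y: "Y \<in> Ob C" and "finite I" and "\<And>i. i \<in> I \<Longrightarrow> k i \<in> Hom C Y Y \<and> P (k i)"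
    and "P (hzero C Y Y)" and "\<And>a b. \<lbrakk>a \<in> Hom C Y Y; b \<in> Hom C Y Y; P a; P b\<rbrakk> \<Longrightarrow> P (a \<boxplus> b)"
  shows "P (finsum (End_ring C Y) k I)"
proof -
  interpret R: ring "End_ring C Y" by (rule End_ring_ring[OF Y])
  from assms(2,3) have "finsum (End_ring C Y) k I \<in> Hom C Y Y \<and> P (finsum (End_ring C Y) k I)"
  proof (induction I rule: finite_induct)
    case empty
    then show ?case using assms(4) Y by (auto simp: Hom_iff)
  next
    case (insert x I)
    then have "finsum (End_ring C Y) k (insert x I) = k x \<boxplus> finsum (End_ring C Y) k I"
      by (subst R.finsum_insert) auto
    then show ?case using insert assms(5) by (auto simp: Hom_iff)
  qed
  then show ?thesis by simp
qed

lemma direct_sumD: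
  assumes "direct_sum C n X Y i p" "j < n"
  shows "Y \<in> Ob C" "X j \<in> Ob C" "i j \<in> Hom C (X j) Y" "p j \<in> Hom C Y (X j)"
    "p j \<cdot> i j = ident C (X j)" "k < n \<Longrightarrow> k \<noteq> j \<Longrightarrow> p j \<cdot> i k = hzero C (X k) (X j)"
  using assms by (auto simp: direct_sum_def)

text \<open>
  The equation \<open>\<Sum>\<^sub>j i\<^sub>j p\<^sub>j = 1\<close> as an induction principle: a property that is closed under addition
  passes from the \<open>i\<^sub>j p\<^sub>j\<close> to the identity.  It takes the place of calculations with sums.
\<close>

lemma direct_sum_induct:
  assumes ds: "direct_sum C n X Y i p" and "\<And>j. j < n \<Longrightarrow> P (i j \<cdot> p j)"
    and "P (hzero C Y Y)" and "\<And>a b. \<lbrakk>a \<in> Hom C Y Y; b \<in> Hom C Y Y; P a; P b\<rbrakk> \<Longrightarrow> P (a \<boxplus> b)"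
  shows "P (ident C Y)"
proof -
  have "P (finsum (End_ring C Y) (\<lambda>j. i j \<cdot> p j) {..<n})"
    by (rule finsum_induct) (use assms in \<open>auto simp: direct_sum_def Hom_iff\<close>)
  then show ?thesis using ds by (simp add: direct_sum_def)
qed

lemma direct_sum_ext:
  assumes ds: "direct_sum C n X Y i p" and f: "f \<in> Hom C Y W" "g \<in> Hom C Y W"
    and eq: "\<And>j. j < n \<Longrightarrow> f \<cdot> i j = g \<cdot> i j"
  shows "f = g"
proof -
  have "f \<cdot> ident C Y = g \<cdot> ident C Y"
  proof (rule direct_sum_induct[OF ds])
    fix j assume j: "j < n"
    note [simp] = direct_sumD(3,4)[OF ds j, unfolded Hom_iff]
    show "f \<cdot> (i j \<cdot> p j) = g \<cdot> (i j \<cdot> p j)"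
      using f eq[OF j] comp_assoc_right[of "p j" "i j" f] comp_assoc_right[of "p j" "i j" g] by (simp add: Hom_iff del: comp_assoc_right)
  qed (use f Hom_Ob[OF f(1)] in \<open>auto simp: Hom_iff\<close>)
  then show ?thesis using f by (simp add: Hom_iff)
qed

lemma direct_sum_map:
  assumes ds: "direct_sum C n X Y i p" and W: "W \<in> Ob C" and f: "\<And>j. j < n \<Longrightarrow> f j \<in> Hom C (X j) W"
  obtains g where "g \<in> Hom C Y W" "\<And>j. j < n \<Longrightarrow> g \<cdot> i j = f j"
proof -
  have Y: "Y \<in> Ob C" using ds by (simp add: direct_sum_def)
  have "\<exists>g\<in>Hom C Y W. \<forall>j<n. g \<cdot> i j = (if j < m then f j else hzero C (X j) W)" if "m \<le> n" for m
    using that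
  proof (induction m)
    case 0
    then show ?case using Y W direct_sumD(3)[OF ds]
      by (intro bexI[of _ "hzero C Y W"]) (auto simp: Hom_iff)
  next
    case (Suc m)
    then obtain g where g: "g \<in> Hom C Y W" "\<forall>j<n. g \<cdot> i j = (if j < m then f j else hzero C (X j) W)"
      by auto
    have m: "m < n" using Suc by simp
    note [simp] = direct_sumD(1-4)[OF ds m, unfolded Hom_iff] f[OF m, unfolded Hom_iff] g(1)[unfolded Hom_iff]
    show ?case
    proof (intro bexI[of _ "g \<boxplus> f m \<cdot> p m"] allI impI)
      fix j assume j: "j < n"
      note [simp] = direct_sumD(2,3)[OF ds j, unfolded Hom_iff] f[OF j, unfolded Hom_iff]
      show "(g \<boxplus> f m \<cdot> p m) \<cdot> i j = (if j < Suc m then f j else hzero C (X j) W)"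
        using g(2) j m W direct_sumD(5)[OF ds m] direct_sumD(6)[OF ds m, of j] by (auto simp: less_Suc_eq)
    qed (auto simp: Hom_iff)
  qed
  from this[of n] show ?thesis using that by auto
qed

lemma direct_sum_2I:
  assumes "i0 \<in> Hom C X0 Y" "i1 \<in> Hom C X1 Y" "p0 \<in> Hom C Y X0" "p1 \<in> Hom C Y X1"
    "p0 \<cdot> i0 = ident C X0" "p1 \<cdot> i1 = ident C X1" "p0 \<cdot> i1 = hzero C X1 X0" "p1 \<cdot> i0 = hzero C X0 X1"
    "i0 \<cdot> p0 \<boxplus> i1 \<cdot> p1 = ident C Y"
  shows "direct_sum C 2 (\<lambda>k. if k = 0 then X0 else X1) Y (\<lambda>k. if k = 0 then i0 else i1) (\<lambda>k. if k = 0 then p0 else p1)"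
proof -
  have Ob: "X0 \<in> Ob C" "X1 \<in> Ob C" "Y \<in> Ob C" using assms Hom_Ob by auto
  interpret R: ring "End_ring C Y" by (rule End_ring_ring[OF Ob(3)])
  have "finsum (End_ring C Y) (\<lambda>k. (if k = 0 then i0 else i1) \<cdot> (if k = 0 then p0 else p1)) {..<2::nat} =
      i1 \<cdot> p1 \<boxplus> i0 \<cdot> p0"
    using assms Ob by (simp add: numeral_2_eq_2 lessThan_Suc R.finsum_insert Hom_iff)
  also have "\<dots> = ident C Y" using assms by (subst add_comm) (auto simp: Hom_iff)
  finally show ?thesis using assms Ob by (auto simp: direct_sum_def less_2_cases_iff)
qed

lemma direct_sum_2D:
  assumes "direct_sum C 2 X Y i p"
  shows "i 0 \<cdot> p 0 \<boxplus> i (Suc 0) \<cdot> p (Suc 0) = ident C Y"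
proof -
  have Ob: "Y \<in> Ob C" using assms by (simp add: direct_sum_def)
  interpret R: ring "End_ring C Y" by (rule End_ring_ring[OF Ob])
  note [simp] = direct_sumD(1-4)[OF assms, of 0, simplified, unfolded Hom_iff]
    direct_sumD(1-4)[OF assms, of "Suc 0", simplified, unfolded Hom_iff]
  have "finsum (End_ring C Y) (\<lambda>k. i k \<cdot> p k) {..<2::nat} = i (Suc 0) \<cdot> p (Suc 0) \<boxplus> i 0 \<cdot> p 0"
    by (simp add: numeral_2_eq_2 lessThan_Suc R.finsum_insert Hom_iff)
  then show ?thesis using assms add_comm[of "i 0 \<cdot> p 0" "i (Suc 0) \<cdot> p (Suc 0)"] by (simp add: direct_sum_def)
qed

lemma zero_objectI:
  assumes "X \<in> Ob C" "ident C X = hzero C X X"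
  shows "zero_object C X"
proof -
  have "f = hzero C X Y" if "f \<in> Hom C X Y" for f Y
  proof -
    have "f = f \<cdot> ident C X" using that by (simp add: Hom_iff)
    also have "\<dots> = hzero C X Y" unfolding assms(2) using that assms(1) by (simp add: Hom_iff)
    finally show ?thesis .
  qed
  moreover have "f = hzero C Y X" if "f \<in> Hom C Y X" for f Y
  proof -
    have "f = ident C X \<cdot> f" using that by (simp add: Hom_iff)
    also have "\<dots> = hzero C Y X" unfolding assms(2) using that assms(1) by (simp add: Hom_iff)
    finally show ?thesis .
  qed
  ultimately show ?thesis using assms(1) unfolding zero_object_def by (metis hzero_Arr Hom_iff)
qed

lemma zero_object_iff: "zero_object C X \<longleftrightarrow> X \<in> Ob C \<and> ident C X = hzero C X X"
proof
  assume z: "zero_object C X"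
  then have "X \<in> Ob C" by (simp add: zero_object_def)
  then show "X \<in> Ob C \<and> ident C X = hzero C X X"
    using zero_objectD[OF z, of "ident C X" X X "hzero C X X"] by (auto simp: Hom_iff)
qed (auto intro: zero_objectI)

text \<open>
  The identity is the sum of the two idempotents \<open>i\<^sub>k p\<^sub>k\<close> of a decomposition, so one of them is a unit.
  It annihilates the other summand.
\<close>

lemma local_indecomposable:
  assumes Y: "local_object Y"
  shows "indecomposable C Y"
  unfolding indecomposable_def
proof (intro conjI allI impI)
  show "\<not> zero_object C Y" using local_objectD(1)[OF Y] by (simp add: zero_object_iff)
  fix X i p assume ds: "direct_sum C 2 X Y i p"
  note D0 = direct_sumD[OF ds, of 0, simplified, unfolded Hom_iff]
  note D1 = direct_sumD[OF ds, of "Suc 0", simplified, unfolded Hom_iff]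
  note [simp] = D0(1-4) D1(1-4)
  have swap: "zero_object C (X l)" if kl: "k < 2" "l < 2" "l \<noteq> k" "i k \<cdot> p k \<in> Units (End_ring C Y)" for k l
  proof -
    note D = direct_sumD(1-5)[OF ds \<open>k < 2\<close>, unfolded Hom_iff] direct_sumD(1-5)[OF ds \<open>l < 2\<close>, unfolded Hom_iff]
    note [simp] = D
    obtain v where v: "v \<in> Hom C Y Y" "v \<cdot> (i k \<cdot> p k) = ident C Y" using kl(4) by (auto simp: End_Units_iff)
    have pk: "p k \<cdot> i l = hzero C (X l) (X k)" using direct_sumD(6)[OF ds kl(1,2,3)] .
    have "i l = (v \<cdot> (i k \<cdot> p k)) \<cdot> i l" unfolding v by simp
    also have "\<dots> = hzero C (X l) Y" using v(1) pk by (simp add: Hom_iff)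
    finally have "p l \<cdot> i l = hzero C (X l) (X l)" by simp
    then show ?thesis by (simp add: zero_object_iff)
  qed
  have "ident C Y \<in> Units (End_ring C Y)"
    unfolding End_Units_iff by (auto simp: Hom_iff intro!: bexI[of _ "ident C Y"])
  then have "i 0 \<cdot> p 0 \<boxplus> i (Suc 0) \<cdot> p (Suc 0) \<in> Units (End_ring C Y)"
    using direct_sum_2D[OF ds] by simp
  then have "i 0 \<cdot> p 0 \<in> Units (End_ring C Y) \<or> i (Suc 0) \<cdot> p (Suc 0) \<in> Units (End_ring C Y)"
    using Y unfolding local_ring_def by (auto simp: Hom_iff)
  then show "zero_object C (X 0) \<or> zero_object C (X 1)"
    using swap[of 0 1] swap[of 1 0] by auto
qed (use Y in auto)

end

lemma (in additive_category) biproduct_exists: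
  assumes "X \<in> Ob C" "Y \<in> Ob C"
  obtains D i0 i1 p0 p1 where "i0 \<in> Hom C X D" "i1 \<in> Hom C Y D" "p0 \<in> Hom C D X" "p1 \<in> Hom C D Y"
    "p0 \<cdot> i0 = ident C X" "p1 \<cdot> i1 = ident C Y" "p0 \<cdot> i1 = hzero C Y X" "p1 \<cdot> i0 = hzero C X Y"
    "hadd C (i0 \<cdot> p0) (i1 \<cdot> p1) = ident C D"
proof -
  obtain D i p where ds: "direct_sum C 2 (\<lambda>k. if k = 0 then X else Y) D i p"
    using direct_sums_exist[of 2 "\<lambda>k. if k = 0 then X else Y"] assms by fastforce
  show ?thesis
    using direct_sumD[OF ds, of 0] direct_sumD[OF ds, of "Suc 0"] direct_sum_2D[OF ds]
      direct_sumD(6)[OF ds, of 0 "Suc 0"] direct_sumD(6)[OF ds, of "Suc 0" 0]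
    by (intro that[of "i 0" D "i (Suc 0)" "p 0" "p (Suc 0)"]) auto
qed

text \<open>
  A nonzero indecomposable \<open>Y\<close> is a direct sum of \<open>n \<ge> 1\<close> objects with local endomorphism rings.  Let
  \<open>X m\<close> be the last of them and \<open>Y'\<close> the direct sum of the others.  Then \<open>Y\<close> is the direct sum of \<open>Y'\<close> and
  \<open>X m\<close>, whence \<open>Y' = 0\<close> and \<open>Y\<close> is isomorphic to \<open>X m\<close>.
\<close>

lemma (in krull_schmidt_category) indecomposable_iff_local:
  "indecomposable C Y \<longleftrightarrow> local_object Y"
proof
  assume ind: "indecomposable C Y"
  then have Y [simp]: "Y \<in> Ob C" and nz: "ident C Y \<noteq> hzero C Y Y"
    by (auto simp: indecomposable_def zero_object_iff)
  obtain n X i p where ds: "direct_sum C n X Y i p" and loc: "\<And>j. j < n \<Longrightarrow> local_ring (End_ring C (X j))"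
    using krull_schmidt[OF Y] by blast
  have "n \<noteq> 0"
  proof
    assume "n = 0"
    interpret R: ring "End_ring C Y" by (rule End_ring_ring[OF Y])
    show False using ds \<open>n = 0\<close> nz by (simp add: direct_sum_def)
  qed
  then obtain m where n: "n = Suc m" using not0_implies_Suc by blast
  have m: "m < n" using n by simp
  note D = direct_sumD[OF ds m, unfolded Hom_iff] and D' = direct_sumD(1-5)[OF ds, unfolded Hom_iff]
  note [simp] = D(1-5)
  obtain Y' i' p' where ds': "direct_sum C m X Y' i' p'"
    using direct_sums_exist[of m X] D'(2) n by auto
  have Y' [simp]: "Y' \<in> Ob C" using ds' by (simp add: direct_sum_def)
  note E' = direct_sumD(1-5)[OF ds', unfolded Hom_iff]
  obtain a where a: "a \<in> Hom C Y' Y" "\<And>j. j < m \<Longrightarrow> a \<cdot> i' j = i j"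
    using direct_sum_map[OF ds' Y, of i] D'(3) n by (auto simp: Hom_iff)
  obtain b where b: "b \<in> Hom C Y Y'" "\<And>j. j < n \<Longrightarrow> b \<cdot> i j = (if j < m then i' j else hzero C (X j) Y')"
    by (rule direct_sum_map[OF ds Y', of "\<lambda>j. if j < m then i' j else hzero C (X j) Y'"])
      (use D'(2) E'(3) in \<open>auto simp: Hom_iff\<close>)
  note [simp] = a(1)[unfolded Hom_iff] b(1)[unfolded Hom_iff]
  have bi: "b \<cdot> i m = hzero C (X m) Y'" using b n by simp
  have ba: "b \<cdot> a = ident C Y'"
    by (rule direct_sum_ext[OF ds']) (use a b n E'(3) in \<open>auto simp: Hom_iff\<close>)
  have pa: "p m \<cdot> a = hzero C Y' (X m)"
    by (rule direct_sum_ext[OF ds']) (use a b n E'(3) D(6) in \<open>auto simp: Hom_iff\<close>)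
  have ab: "a \<cdot> b \<boxplus> i m \<cdot> p m = ident C Y"
  proof (rule direct_sum_ext[OF ds])
    fix j assume j: "j < n"
    note [simp] = D'(3,4)[OF j]
    show "(a \<cdot> b \<boxplus> i m \<cdot> p m) \<cdot> i j = ident C Y \<cdot> i j"
      using a(2)[of j] b(2)[OF j] D(5) D(6)[of j] j n D'(2)[OF j] by (cases "j = m") auto
  qed (auto simp: Hom_iff)
  have "direct_sum C 2 (\<lambda>k. if k = 0 then Y' else X m) Y (\<lambda>k. if k = 0 then a else i m) (\<lambda>k. if k = 0 then b else p m)"
    by (rule direct_sum_2I) (auto simp: Hom_iff bi ba pa ab)
  then have "zero_object C Y' \<or> zero_object C (X m)"
    using ind unfolding indecomposable_def by fastforce
  moreover have lm: "local_object (X m)" using loc m by simp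
  ultimately have "zero_object C Y'" using local_objectD(1)[OF lm] by (simp add: zero_object_iff)
  then have "a = hzero C Y' Y" using zero_objectD[of Y' a Y' Y "hzero C Y' Y"] by (simp add: Hom_iff)
  then have "i m \<cdot> p m = ident C Y" using ab by simp
  then have "is_iso C (i m)" by (intro isoI[of "i m" "X m" Y "p m"]) (auto simp: Hom_iff)
  then show "local_object Y" using local_object_iso[OF lm, of "i m" Y] by (simp add: Hom_iff)
qed (rule local_indecomposable)

section \<open>Deflations and their images\<close>

text \<open>
  The image of \<open>G\<close> is that of \<open>(g, x) : B \<oplus> X \<rightarrow> C\<close>.  Only images occur in what follows, and this form
  avoids the choice of a biproduct.
\<close>

definition adjoined :: "('o, 'm, 'z) precat_scheme \<Rightarrow> 'm \<Rightarrow> 'm \<Rightarrow> 'm \<Rightarrow> bool" where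
  "adjoined A g x G \<longleftrightarrow> G \<in> Arr A \<and> tgt A G = tgt A g \<and> tgt A x = tgt A g \<and> x \<in> Arr A \<and> g \<in> Arr A \<and>
     (\<forall>W\<in>Ob A. \<forall>h. h \<in> hom_image A G W \<longleftrightarrow>
        (\<exists>u\<in>hom_image A g W. \<exists>m\<in>Hom A W (src A x). h = hadd A u (cmps A x m)))"

text \<open>
  The exact structure of relative homological algebra: it consists of the conflations for which the
  objects in \<open>\<X>\<close> are projective.
\<close>

definition relative_structure :: "('o, 'm, 'z) precat_scheme \<Rightarrow> ('m \<times> 'm) set \<Rightarrow> 'o set \<Rightarrow> ('m \<times> 'm) set" where
  "relative_structure A E \<X> = {(f, g) \<in> E. \<forall>W\<in>\<X>. Hom A W (tgt A g) \<subseteq> hom_image A g W}"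

lemma (in category) pair_isomorphicI:
  assumes "f \<in> Arr C" "g \<in> Arr C" "f' \<in> Arr C" "g' \<in> Arr C" "src C g = tgt C f" "src C g' = tgt C f'"
    "a \<in> Hom C (src C f) (src C f')" "b \<in> Hom C (src C g) (src C g')" "c \<in> Hom C (tgt C g) (tgt C g')"
    "is_iso C a" "is_iso C b" "is_iso C c" "b \<cdot> f = f' \<cdot> a" "c \<cdot> g = g' \<cdot> b"
  shows "pair_isomorphic C (f, g) (f', g')"
  unfolding pair_isomorphic_def using assms by auto

context exact_structure
begin

abbreviation add_mor (infixl \<open>\<boxplus>\<close> 65) where "f \<boxplus> g \<equiv> hadd A f g"
abbreviation sub_mor (infixl \<open>\<boxminus>\<close> 65) where "f \<boxminus> g \<equiv> hadd A f (hneg g)"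

lemma conflationD:
  assumes "(f, g) \<in> E"
  shows "is_kernel A f g" "is_cokernel A g f"
  using conflation_kernel_cokernel[OF assms] by (auto simp: kernel_cokernel_pair_def)

lemma conflation_Arr:
  assumes "(f, g) \<in> E"
  shows "f \<in> Arr A" "g \<in> Arr A" "src A g = tgt A f" "g \<cdot> f = hzero A (src A f) (tgt A g)"
  using kernelD[OF conflationD(1)[OF assms]] by auto

lemma deflation_Arr: "p \<in> snd ` E \<Longrightarrow> p \<in> Arr A"
  using conflation_Arr by fastforce

lemma deflation_kernel:
  assumes "p \<in> snd ` E" "is_kernel A k p"
  shows "(k, p) \<in> E"
proof -
  obtain f where f: "(f, p) \<in> E" using assms by auto
  obtain a where "a \<in> Hom A (src A f) (src A k)" "is_iso A a" "k \<cdot> a = f"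
    using kernel_iso[OF conflationD(1)[OF f] assms(2)] by blast
  then have "pair_isomorphic A (f, p) (k, p)"
    using kernelD[OF assms(2)] conflation_Arr[OF f]
    by (intro pair_isomorphicI[where a = "a" and b = "ident A (src A p)" and c = "ident A (tgt A p)"]) (auto simp: Hom_iff iso_ident)
  with f show ?thesis by (rule iso_closed)
qed

lemma inflation_cokernel:
  assumes "i \<in> fst ` E" "is_cokernel A d i"
  shows "(i, d) \<in> E"
proof -
  obtain g where g: "(i, g) \<in> E" using assms by auto
  obtain a where "a \<in> Hom A (tgt A g) (tgt A d)" "is_iso A a" "a \<cdot> g = d"
    using cokernel_iso[OF conflationD(2)[OF g] assms(2)] by blast
  then have "pair_isomorphic A (i, g) (i, d)"
    using cokernelD[OF assms(2)] conflation_Arr[OF g]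
    by (intro pair_isomorphicI[where a = "ident A (src A i)" and b = "ident A (src A g)" and c = "a"]) (auto simp: Hom_iff iso_ident)
  with g show ?thesis by (rule iso_closed)
qed

lemma deflation_epi:
  assumes "p \<in> snd ` E" "x \<in> Hom A (tgt A p) W" "y \<in> Hom A (tgt A p) W" "x \<cdot> p = y \<cdot> p"
  shows "x = y"
  using assms conflationD(2) cokernel_epi by fastforce

lemma deflation_iso:
  assumes "p \<in> snd ` E" "is_iso A s" "tgt A s = src A p"
  shows "p \<cdot> s \<in> snd ` E"
proof -
  obtain f where f: "(f, p) \<in> E" using assms by auto
  obtain t where t: "s \<in> Arr A" "t \<in> Arr A" "src A t = tgt A s" "tgt A t = src A s"
    "t \<cdot> s = ident A (src A s)" "s \<cdot> t = ident A (tgt A s)"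
    using isoE[OF assms(2)] by blast
  have "is_iso A t" using t by (intro isoI[of t "tgt A s" "src A s" s]) (auto simp: Hom_iff)
  then have "pair_isomorphic A (f, p) (t \<cdot> f, p \<cdot> s)"
    using t assms(3) conflation_Arr[OF f]
    by (intro pair_isomorphicI[where a = "ident A (src A f)" and b = "t" and c = "ident A (tgt A p)"]) (auto simp: Hom_iff iso_ident)
  from iso_closed[OF f this] show ?thesis by force
qed

lemma inflation_iso:
  assumes "i \<in> fst ` E" "is_iso A s" "src A s = tgt A i"
  shows "s \<cdot> i \<in> fst ` E"
proof -
  obtain q where f: "(i, q) \<in> E" using assms by auto
  obtain t where t: "s \<in> Arr A" "t \<in> Arr A" "src A t = tgt A s" "tgt A t = src A s"
    "t \<cdot> s = ident A (src A s)" "s \<cdot> t = ident A (tgt A s)"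
    using isoE[OF assms(2)] by blast
  have "pair_isomorphic A (i, q) (s \<cdot> i, q \<cdot> t)"
    using t assms(2,3) conflation_Arr[OF f]
    by (intro pair_isomorphicI[where a = "ident A (src A i)" and b = "s" and c = "ident A (tgt A q)"]) (auto simp: Hom_iff iso_ident)
  from iso_closed[OF f this] show ?thesis by force
qed

lemma pullback_deflation:
  assumes "is_pullback A p f p1 f1" "p \<in> snd ` E"
  shows "p1 \<in> snd ` E"
proof -
  note P = pullbackD[OF assms(1)]
  obtain p2 f2 where p2: "is_pullback A p f p2 f2" "p2 \<in> snd ` E"
    using deflation_pullback[OF assms(2) P(2)] P by auto
  obtain a where "a \<in> Hom A (src A p1) (src A p2)" "is_iso A a" "p2 \<cdot> a = p1"
    using pullback_iso[OF assms(1) p2(1)] by blast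
  then show ?thesis using deflation_iso[OF p2(2), of a] by (auto simp: Hom_iff)
qed

lemma pushout_inflation:
  assumes "is_pushout A i f i1 f1" "i \<in> fst ` E"
  shows "i1 \<in> fst ` E"
proof -
  note P = pushoutD[OF assms(1)]
  obtain i2 f2 where i2: "is_pushout A i f i2 f2" "i2 \<in> fst ` E"
    using inflation_pushout[OF assms(2) P(2)] P by auto
  obtain a where "a \<in> Hom A (tgt A i2) (tgt A i1)" "is_iso A a" "a \<cdot> i2 = i1"
    using pushout_iso[OF i2(1) assms(1)] by blast
  then show ?thesis using inflation_iso[OF i2(2), of a] by (auto simp: Hom_iff)
qed

text \<open>
  The map \<open>r\<close> is a projection \<open>K \<oplus> Z \<rightarrow> Z\<close>, which is the pullback of the deflation \<open>z : K \<rightarrow> 0\<close> along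
  \<open>Z \<rightarrow> 0\<close>.
\<close>

lemma split_deflation:
  assumes r: "is_retraction A r" and k: "is_kernel A k r"
  shows "(k, r) \<in> E"
proof -
  obtain s where s: "r \<in> Arr A" "s \<in> Arr A" "src A s = tgt A r" "tgt A s = src A r" "r \<cdot> s = ident A (tgt A r)"
    using retractionE[OF r] by blast
  note K = kernelD[OF k]
  note [simp] = s(1-4) K(1-3) comp_assoc_eq[OF s(5)] s(5) comp_assoc_eq[OF K(4)] K(4)
  let ?e = "ident A (src A r) \<boxminus> s \<cdot> r"
  obtain \<rho> where \<rho>: "\<rho> \<in> Hom A (src A r) (src A k)" "k \<cdot> \<rho> = ?e"
    by (rule kernel_lift[OF k, of ?e "src A r"]) (auto simp: Hom_iff)
  note [simp] = \<rho>(1)[unfolded Hom_iff]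
  obtain z where z: "(ident A (src A k), z) \<in> E" using ident_inflation[of "src A k"] by auto
  note Z = conflation_Arr[OF z]
  note [simp] = Z(1-3)
  have z0: "z = hzero A (src A k) (tgt A z)" using Z(4) Z(3) by simp
  have "is_pullback A z (hzero A (tgt A r) (tgt A z)) r \<rho>"
    unfolding is_pullback_def
  proof (intro conjI ballI impI)
    show "hzero A (tgt A r) (tgt A z) \<cdot> r = z \<cdot> \<rho>" by (subst (2) z0) simp
    fix W a b
    assume W: "W \<in> Ob A" "a \<in> Hom A W (src A (hzero A (tgt A r) (tgt A z)))" "b \<in> Hom A W (src A z)"
    have [simp]: "a \<in> Arr A" "src A a = W" "tgt A a = tgt A r" "b \<in> Arr A" "src A b = W" "tgt A b = src A k" "W \<in> Ob A"
      using W by (auto simp: Hom_iff)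
    let ?v = "s \<cdot> a \<boxplus> k \<cdot> b"
    have 1: "r \<cdot> ?v = a" by simp
    have "k \<cdot> (\<rho> \<cdot> ?v) = k \<cdot> b"
      using 1 by (simp add: comp_assoc_eq[OF \<rho>(2)] diff_eq_iff add_comm)
    then have 2: "\<rho> \<cdot> ?v = b"
      by (rule kernel_mono[OF k, of _ W, rotated 2]) (auto simp: Hom_iff)
    show "\<exists>!v. v \<in> Hom A W (src A r) \<and> r \<cdot> v = a \<and> \<rho> \<cdot> v = b"
    proof (rule ex1I[of _ ?v])
      show "?v \<in> Hom A W (src A r) \<and> r \<cdot> ?v = a \<and> \<rho> \<cdot> ?v = b"
        using 1 2 by (auto simp: Hom_iff)
      fix v assume v: "v \<in> Hom A W (src A r) \<and> r \<cdot> v = a \<and> \<rho> \<cdot> v = b"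
      then have [simp]: "v \<in> Arr A" "src A v = W" "tgt A v = src A r" by (auto simp: Hom_iff)
      have "k \<cdot> (\<rho> \<cdot> v) = ?e \<cdot> v" by (rule comp_assoc_eq[OF \<rho>(2)]) auto
      then have "v \<boxminus> s \<cdot> a = k \<cdot> b" using v by simp
      then show "v = ?v" by (subst (asm) diff_eq_iff) (auto simp: add_comm)
    qed
  qed auto
  then have "r \<in> snd ` E" by (rule pullback_deflation) (use z in force)
  then show ?thesis using k by (rule deflation_kernel)
qed

text \<open>
  Quillen's obscure axiom.  Let \<open>d\<close> and \<open>r\<close> be the projections of the pullback of \<open>e = p q\<close> and \<open>p\<close>, so
  that \<open>p d = e r\<close>.  Since \<open>r\<close> has a section, it is a deflation, and therefore so is \<open>p d\<close>.  The kernel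
  \<open>m\<close> of \<open>p d\<close> restricts to a map \<open>l\<close> onto the kernel \<open>k\<close> of \<open>p\<close>, and \<open>k\<close> is the pushout of \<open>m\<close> along \<open>l\<close>.
  So \<open>k\<close> is an inflation, and \<open>p\<close> is its cokernel.
\<close>

lemma deflation_cancel:
  assumes pq: "p \<cdot> q \<in> snd ` E" and p: "p \<in> Arr A" and q: "q \<in> Arr A" "tgt A q = src A p"
    and k: "is_kernel A k p"
  shows "(k, p) \<in> E"
proof -
  let ?e = "p \<cdot> q"
  note K = kernelD[OF k]
  note [simp] = p q K(1,3)
  note pk = K(4) comp_assoc_eq[OF K(4)]
  obtain d r where dr: "is_pullback A ?e p d r" "d \<in> snd ` E"
    using deflation_pullback[OF pq p] by auto
  have [simp]: "d \<in> Arr A" "r \<in> Arr A" "tgt A d = src A p" "tgt A r = src A q" "src A r = src A d"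
    using pullbackD[OF dr(1)] by auto
  have pd: "p \<cdot> d = p \<cdot> (q \<cdot> r)" using pullbackD[OF dr(1)] by simp
  obtain t where t: "t \<in> Hom A (src A q) (src A d)" "d \<cdot> t = q" "r \<cdot> t = ident A (src A q)"
    by (rule pullback_lift[OF dr(1), of q "src A q" "ident A (src A q)"]) (auto simp: Hom_iff)
  have r: "is_retraction A r" by (rule retractionI[OF _ t(1) t(3)]) (auto simp: Hom_iff)
  obtain \<kappa> where \<kappa>: "\<kappa> \<in> Hom A (src A k) (src A d)" "d \<cdot> \<kappa> = k" "r \<cdot> \<kappa> = hzero A (src A k) (src A q)"
    by (rule pullback_lift[OF dr(1), of k "src A k" "hzero A (src A k) (src A q)"]) (auto simp: Hom_iff pk)
  note [simp] = \<kappa>(1)[unfolded Hom_iff]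
  note d\<kappa> = \<kappa>(2) comp_assoc_eq[OF \<kappa>(2)] and r\<kappa> = \<kappa>(3) comp_assoc_eq[OF \<kappa>(3)]
  have "is_kernel A \<kappa> r"
  proof (rule kernelI)
    fix W h assume "W \<in> Ob A" and h: "h \<in> Hom A W (tgt A \<kappa>)" "r \<cdot> h = hzero A W (tgt A r)"
    then have [simp]: "h \<in> Arr A" "src A h = W" "tgt A h = src A d" "W \<in> Ob A" by (auto simp: Hom_iff)
    have "p \<cdot> (d \<cdot> h) = p \<cdot> (q \<cdot> (r \<cdot> h))" by (simp add: comp_assoc_eq[OF pd])
    then have "p \<cdot> (d \<cdot> h) = hzero A W (tgt A p)" using h by simp
    then obtain l where l: "l \<in> Hom A W (src A k)" "k \<cdot> l = d \<cdot> h"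
      by (rule kernel_lift[OF k, of "d \<cdot> h" W, rotated]) (auto simp: Hom_iff)
    note [simp] = l(1)[unfolded Hom_iff]
    have "\<kappa> \<cdot> l = h"
      by (rule pullback_unique[OF dr(1), of _ W]) (auto simp: Hom_iff d\<kappa> r\<kappa> l h(2))
    then show "\<exists>l\<in>Hom A W (src A \<kappa>). \<kappa> \<cdot> l = h" using l by auto
  next
    fix W x y assume xy: "x \<in> Hom A W (src A \<kappa>)" "y \<in> Hom A W (src A \<kappa>)" "\<kappa> \<cdot> x = \<kappa> \<cdot> y"
    then have "d \<cdot> (\<kappa> \<cdot> x) = d \<cdot> (\<kappa> \<cdot> y)" by simp
    then have "k \<cdot> x = k \<cdot> y" using xy(1,2) by (simp add: d\<kappa> Hom_iff)
    then show "x = y" using kernel_mono[OF k] xy by auto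
  qed (auto simp: \<kappa>)
  then have "(\<kappa>, r) \<in> E" by (rule split_deflation[OF r])
  then have "?e \<cdot> r \<in> snd ` E" by (intro deflation_comp pq) force+
  then have pdE: "p \<cdot> d \<in> snd ` E" using pd by simp
  then obtain m where m: "(m, p \<cdot> d) \<in> E" by auto
  note M = conflation_Arr[OF m]
  have [simp]: "m \<in> Arr A" "tgt A m = src A d" using M by auto
  have pdm: "p \<cdot> (d \<cdot> m) = hzero A (src A m) (tgt A p)" using M(4) by simp
  obtain l where l: "l \<in> Hom A (src A m) (src A k)" "k \<cdot> l = d \<cdot> m"
    by (rule kernel_lift[OF k, of "d \<cdot> m" "src A m"]) (auto simp: Hom_iff pdm)
  note [simp] = l(1)[unfolded Hom_iff]
  note km = kernel_mono[OF conflationD(1)[OF m]]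
  note kl = comp_assoc_eq[OF l(2)]
  have "is_pullback A d k l m" unfolding is_pullback_def
  proof (intro conjI ballI impI)
    fix W a b assume "W \<in> Ob A" "a \<in> Hom A W (src A k)" "b \<in> Hom A W (src A d)" and ab: "k \<cdot> a = d \<cdot> b"
    then have [simp]: "a \<in> Arr A" "src A a = W" "tgt A a = src A k" "b \<in> Arr A" "src A b = W" "tgt A b = src A d" "W \<in> Ob A"
      by (auto simp: Hom_iff)
    have "(p \<cdot> d) \<cdot> b = hzero A W (tgt A (p \<cdot> d))" by (simp add: ab[symmetric] pk)
    then obtain c where c: "c \<in> Hom A W (src A m)" "m \<cdot> c = b"
      by (rule kernel_lift[OF conflationD(1)[OF m], of b W, rotated]) (auto simp: Hom_iff)
    note [simp] = c(1)[unfolded Hom_iff]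
    have "l \<cdot> c = a"
      by (rule kernel_mono[OF k, of _ W]) (auto simp: Hom_iff kl c(2) ab)
    show "\<exists>!x. x \<in> Hom A W (src A l) \<and> l \<cdot> x = a \<and> m \<cdot> x = b"
    proof (rule ex1I[of _ c])
      show "c \<in> Hom A W (src A l) \<and> l \<cdot> c = a \<and> m \<cdot> c = b"
        using c \<open>l \<cdot> c = a\<close> by (simp add: Hom_iff)
      fix x assume "x \<in> Hom A W (src A l) \<and> l \<cdot> x = a \<and> m \<cdot> x = b"
      then show "x = c" using c by (intro km[of x W c]) (auto simp: Hom_iff)
    qed
  qed (auto simp: l(2))
  then have lE: "l \<in> snd ` E" using dr(2) by (rule pullback_deflation)
  have "is_pushout A m l k d" unfolding is_pushout_def
  proof (intro conjI ballI impI)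
    fix W a b assume "W \<in> Ob A" "a \<in> Hom A (tgt A l) W" "b \<in> Hom A (tgt A m) W" and ab: "a \<cdot> l = b \<cdot> m"
    then have [simp]: "a \<in> Arr A" "src A a = src A k" "tgt A a = W" "b \<in> Arr A" "src A b = src A d" "tgt A b = W" "W \<in> Ob A"
      by (auto simp: Hom_iff)
    obtain n where n: "(n, d) \<in> E" using dr(2) by auto
    note N = conflation_Arr[OF n]
    have [simp]: "n \<in> Arr A" "tgt A n = src A d" using N by auto
    have dn: "d \<cdot> n = hzero A (src A n) (src A p)" using N(4) by simp
    obtain n' where n': "n' \<in> Hom A (src A n) (src A m)" "m \<cdot> n' = n"
      by (rule kernel_lift[OF conflationD(1)[OF m], of n "src A n"]) (auto simp: Hom_iff dn)
    note [simp] = n'(1)[unfolded Hom_iff]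
    have "k \<cdot> (l \<cdot> n') = k \<cdot> hzero A (src A n) (src A k)" by (simp add: kl n'(2) dn)
    then have ln: "l \<cdot> n' = hzero A (src A n) (src A k)"
      by (rule kernel_mono[OF k, of _ "src A n", rotated 2]) (auto simp: Hom_iff)
    have "b \<cdot> n = (b \<cdot> m) \<cdot> n'" by (simp add: n'(2))
    also have "\<dots> = hzero A (src A n) W" by (simp add: ab[symmetric] ln)
    finally obtain c where c: "c \<in> Hom A (src A p) W" "c \<cdot> d = b"
      by (rule cokernel_lift[OF conflationD(2)[OF n], of b W, rotated]) (auto simp: Hom_iff)
    note [simp] = c(1)[unfolded Hom_iff]
    have "(c \<cdot> k) \<cdot> l = (c \<cdot> d) \<cdot> m" by (simp add: l(2))
    then have "(c \<cdot> k) \<cdot> l = a \<cdot> l" unfolding c(2) ab .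
    then have ck: "c \<cdot> k = a" by (rule deflation_epi[OF lE, of _ W, rotated 2]) (auto simp: Hom_iff)
    show "\<exists>!x. x \<in> Hom A (tgt A k) W \<and> x \<cdot> k = a \<and> x \<cdot> d = b"
    proof (rule ex1I[of _ c])
      show "c \<in> Hom A (tgt A k) W \<and> c \<cdot> k = a \<and> c \<cdot> d = b"
        using c(2) ck K by (simp add: Hom_iff)
      fix x assume "x \<in> Hom A (tgt A k) W \<and> x \<cdot> k = a \<and> x \<cdot> d = b"
      then show "x = c" using c(2) K by (intro deflation_epi[OF dr(2), of x W c]) (auto simp: Hom_iff)
    qed
  qed (use K in \<open>auto simp: l(2)\<close>)
  then have kE: "k \<in> fst ` E" by (rule pushout_inflation) (use m in force)
  have "is_cokernel A p k"
  proof (rule cokernelI)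
    fix W h assume "W \<in> Ob A" "h \<in> Hom A (tgt A k) W" and hk: "h \<cdot> k = hzero A (src A k) W"
    then have [simp]: "h \<in> Arr A" "src A h = src A p" "tgt A h = W" "W \<in> Ob A" using K by (auto simp: Hom_iff)
    have "(h \<cdot> d) \<cdot> m = (h \<cdot> k) \<cdot> l" by (simp add: l(2))
    then have "(h \<cdot> d) \<cdot> m = hzero A (src A m) W" unfolding hk by simp
    then obtain c where c: "c \<in> Hom A (tgt A (p \<cdot> d)) W" "c \<cdot> (p \<cdot> d) = h \<cdot> d"
      by (rule cokernel_lift[OF conflationD(2)[OF m], of "h \<cdot> d" W, rotated]) (auto simp: Hom_iff)
    have [simp]: "c \<in> Arr A" "src A c = tgt A p" "tgt A c = W" using c(1) by (auto simp: Hom_iff)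
    have "c \<cdot> p = h" by (rule deflation_epi[OF dr(2), of _ W]) (use c(2) in \<open>auto simp: Hom_iff\<close>)
    then show "\<exists>c\<in>Hom A (tgt A p) W. c \<cdot> p = h" using c(1) by auto
  next
    fix W x y assume xy: "x \<in> Hom A (tgt A p) W" "y \<in> Hom A (tgt A p) W" "x \<cdot> p = y \<cdot> p"
    then have "(x \<cdot> p) \<cdot> d = (y \<cdot> p) \<cdot> d" by simp
    then have "x \<cdot> (p \<cdot> d) = y \<cdot> (p \<cdot> d)" using xy(1,2) by (simp add: Hom_iff)
    then show "x = y" using deflation_epi[OF pdE, of x W y] xy by auto
  qed (use K in auto)
  with kE show ?thesis by (rule inflation_cokernel)
qed

lemma deflation_of_image:
  assumes G: "G \<in> snd ` E" and "G \<in> hom_image A g (src A G)" and "is_kernel A k g"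
  shows "(k, g) \<in> E"
proof -
  obtain q where "q \<in> Hom A (src A G) (src A g)" "g \<cdot> q = G" using assms(2) by (auto simp: hom_image_iff)
  then show ?thesis using G kernelD[OF assms(3)] by (intro deflation_cancel[of g q]) (auto simp: Hom_iff assms(3))
qed

text \<open>
  The map \<open>(g, x)\<close> factors as \<open>B \<oplus> X \<rightarrow> C \<oplus> X \<rightarrow> C\<close>.  The first map \<open>g1\<close> is the pullback of \<open>g\<close> along the
  projection of \<open>C \<oplus> X\<close>, and the second one, \<open>t\<close>, is a split epimorphism with kernel \<open>X\<close>.
\<close>

lemma adjoin_deflation:
  assumes g: "g \<in> snd ` E" and x: "x \<in> Arr A" "tgt A x = tgt A g"
  obtains G where "G \<in> snd ` E" "adjoined A g x G"
proof -
  have [simp]: "g \<in> Arr A" using g by (rule deflation_Arr)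
  note [simp] = x
  have Ob: "tgt A g \<in> Ob A" "src A x \<in> Ob A" using x by auto
  obtain D i0 i1 p0 p1 where H: "i0 \<in> Hom A (tgt A g) D" "i1 \<in> Hom A (src A x) D" "p0 \<in> Hom A D (tgt A g)" "p1 \<in> Hom A D (src A x)"
    and inv: "p0 \<cdot> i0 = ident A (tgt A g)" "p1 \<cdot> i1 = ident A (src A x)"
    and orth: "p0 \<cdot> i1 = hzero A (src A x) (tgt A g)" "p1 \<cdot> i0 = hzero A (tgt A g) (src A x)"
    and ip: "i0 \<cdot> p0 \<boxplus> i1 \<cdot> p1 = ident A D"
    by (rule biproduct_exists[OF Ob])
  note [simp] = H[unfolded Hom_iff] inv orth inv[THEN comp_assoc_eq] orth[THEN comp_assoc_eq]
  have [simp]: "D \<in> Ob A" using Hom_Ob[OF H(1)] by simp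
  have decomp: "v = i0 \<cdot> (p0 \<cdot> v) \<boxplus> i1 \<cdot> (p1 \<cdot> v)" if "v \<in> Arr A" "tgt A v = D" for v
  proof -
    have "v = ident A D \<cdot> v" using that by simp
    also have "\<dots> = i0 \<cdot> (p0 \<cdot> v) \<boxplus> i1 \<cdot> (p1 \<cdot> v)" unfolding ip[symmetric] using that by simp
    finally show ?thesis .
  qed
  define t where "t = p0 \<boxplus> x \<cdot> p1"
  have tA [simp]: "t \<in> Arr A" "src A t = D" "tgt A t = tgt A g" by (auto simp: t_def)
  have t: "is_retraction A t" by (rule retractionI[of t D _ i0]) (auto simp: Hom_iff t_def)
  define \<kappa> where "\<kappa> = i1 \<boxminus> i0 \<cdot> x"
  have \<kappa>A [simp]: "\<kappa> \<in> Arr A" "src A \<kappa> = src A x" "tgt A \<kappa> = D" by (auto simp: \<kappa>_def)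
  have p1\<kappa>: "p1 \<cdot> \<kappa> = ident A (src A x)" by (simp add: \<kappa>_def)
  have "is_kernel A \<kappa> t"
  proof (rule kernelI)
    show "t \<cdot> \<kappa> = hzero A (src A \<kappa>) (tgt A t)" by (simp add: t_def \<kappa>_def add_comm)
    fix W h assume W: "W \<in> Ob A" "h \<in> Hom A W (tgt A \<kappa>)" "t \<cdot> h = hzero A W (tgt A t)"
    then have [simp]: "h \<in> Arr A" "src A h = W" "tgt A h = D" by (auto simp: Hom_iff)
    have "p0 \<cdot> h \<boxplus> x \<cdot> (p1 \<cdot> h) = hzero A W (tgt A g)" using W(3) by (simp add: t_def)
    then have p0h: "p0 \<cdot> h = hneg (x \<cdot> (p1 \<cdot> h))"
      using add_comm[of "p0 \<cdot> h" "x \<cdot> (p1 \<cdot> h)"] by (intro eq_negI) (auto simp del: comp_neg)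
    have "\<kappa> \<cdot> (p1 \<cdot> h) = i1 \<cdot> (p1 \<cdot> h) \<boxplus> i0 \<cdot> (p0 \<cdot> h)" by (simp add: \<kappa>_def p0h)
    also have "\<dots> = h" by (subst (3) decomp) (auto simp: add_comm)
    finally show "\<exists>k\<in>Hom A W (src A \<kappa>). \<kappa> \<cdot> k = h" by (intro bexI[of _ "p1 \<cdot> h"]) (auto simp: Hom_iff)
  next
    fix W a b assume ab: "a \<in> Hom A W (src A \<kappa>)" "b \<in> Hom A W (src A \<kappa>)" "\<kappa> \<cdot> a = \<kappa> \<cdot> b"
    then have "p1 \<cdot> (\<kappa> \<cdot> a) = p1 \<cdot> (\<kappa> \<cdot> b)" by simp
    then show "a = b" using ab(1,2) by (simp add: comp_assoc_eq[OF p1\<kappa>] Hom_iff)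
  qed auto
  then have "(\<kappa>, t) \<in> E" by (rule split_deflation[OF t])
  then have tE: "t \<in> snd ` E" by force
  obtain g1 g2 where g1: "is_pullback A g p0 g1 g2" "g1 \<in> snd ` E"
    using deflation_pullback[OF g, of p0] by auto
  have [simp]: "g1 \<in> Arr A" "tgt A g1 = D" using pullbackD[OF g1(1)] by auto
  have G: "t \<cdot> g1 \<in> snd ` E" by (rule deflation_comp[OF g1(2) tE]) auto
  have "h \<in> hom_image A (t \<cdot> g1) W \<longleftrightarrow>
    (\<exists>u\<in>hom_image A g W. \<exists>m\<in>Hom A W (src A x). h = u \<boxplus> x \<cdot> m)" if W: "W \<in> Ob A" for W h
  proof
    assume "h \<in> hom_image A (t \<cdot> g1) W"
    then obtain k where k: "k \<in> Hom A W (src A g1)" "h = t \<cdot> (g1 \<cdot> k)" by (auto simp: hom_image_iff Hom_iff)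
    then have "g1 \<cdot> k \<in> hom_image A g1 W" by (auto simp: hom_image_iff)
    then have "p0 \<cdot> (g1 \<cdot> k) \<in> hom_image A g W" using pullback_hom_image[OF g1(1)] by auto
    moreover have "h = p0 \<cdot> (g1 \<cdot> k) \<boxplus> x \<cdot> (p1 \<cdot> (g1 \<cdot> k))" using k by (simp add: t_def Hom_iff)
    ultimately show "\<exists>u\<in>hom_image A g W. \<exists>m\<in>Hom A W (src A x). h = u \<boxplus> x \<cdot> m"
      using k by (intro bexI[of _ "p0 \<cdot> (g1 \<cdot> k)"] bexI[of _ "p1 \<cdot> (g1 \<cdot> k)"]) (auto simp: Hom_iff)
  next
    assume "\<exists>u\<in>hom_image A g W. \<exists>m\<in>Hom A W (src A x). h = u \<boxplus> x \<cdot> m"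
    then obtain u m where um: "u \<in> hom_image A g W" "m \<in> Hom A W (src A x)" "h = u \<boxplus> x \<cdot> m" by blast
    have uH: "u \<in> Hom A W (tgt A g)" using um hom_image_sub[of g W] by auto
    note [simp] = um(2)[unfolded Hom_iff] uH[unfolded Hom_iff]
    let ?v = "i0 \<cdot> u \<boxplus> i1 \<cdot> m"
    have "p0 \<cdot> ?v = u" using W by simp
    then have "?v \<in> hom_image A g1 W" using um W pullback_hom_image[OF g1(1)] by (auto simp: Hom_iff)
    then obtain k where k: "k \<in> Hom A W (src A g1)" "g1 \<cdot> k = ?v" by (auto simp: hom_image_iff)
    have "t \<cdot> ?v = h" using um(3) W by (simp add: t_def)
    then have "(t \<cdot> g1) \<cdot> k = h" using k by (simp add: Hom_iff)
    then show "h \<in> hom_image A (t \<cdot> g1) W" using k by (auto simp: hom_image_iff)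
  qed
  then have "adjoined A g x (t \<cdot> g1)" by (auto simp: adjoined_def)
  with G show ?thesis by (rule that)
qed

text \<open>
  The defect of \<open>g\<close> is an extension of the defect of \<open>G\<close> by that of \<open>g'\<close>.  Write \<open>G = g \<beta> + x \<xi>\<close> and let
  \<open>g''\<close> be the pullback of \<open>g'\<close> along \<open>\<xi>\<close>.  Then \<open>G g''\<close> is a deflation that factors through \<open>g\<close>, because
  \<open>x \<xi> g''\<close> does.
\<close>

lemma deflation_glue:
  assumes k: "is_kernel A k g" and G: "G \<in> snd ` E" "adjoined A g x G"
    and g': "is_pullback A g x g' x'" "g' \<in> snd ` E"
  shows "(k, g) \<in> E"
proof -
  have [simp]: "g \<in> Arr A" "x \<in> Arr A" "G \<in> Arr A" "tgt A x = tgt A g" "tgt A G = tgt A g"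
    using G(2) by (auto simp: adjoined_def)
  have "G \<in> hom_image A G (src A G)" by (auto simp: hom_image_iff Hom_iff intro!: bexI[of _ "ident A (src A G)"])
  then obtain u \<xi> where "u \<in> hom_image A g (src A G)" and \<xi>: "\<xi> \<in> Hom A (src A G) (src A x)" "G = u \<boxplus> x \<cdot> \<xi>"
    using G(2) by (auto simp: adjoined_def)
  then obtain \<beta> where \<beta>: "\<beta> \<in> Hom A (src A G) (src A g)" "G = g \<cdot> \<beta> \<boxplus> x \<cdot> \<xi>" by (auto simp: hom_image_iff)
  note [simp] = \<xi>(1)[unfolded Hom_iff] \<beta>(1)[unfolded Hom_iff]
  note P = pullbackD[OF g'(1)]
  obtain g'' \<xi>' where g'': "is_pullback A g' \<xi> g'' \<xi>'" "g'' \<in> snd ` E"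
    using deflation_pullback[OF g'(2), of \<xi>] P by auto
  note Q = pullbackD[OF g''(1)]
  have [simp]: "g'' \<in> Arr A" "tgt A g'' = src A G" "\<xi>' \<in> Arr A" "tgt A \<xi>' = src A g'" "src A \<xi>' = src A g''"
    "g' \<in> Arr A" "tgt A g' = src A x" "x' \<in> Arr A" "tgt A x' = src A g" "src A x' = src A g'"
    using P Q by auto
  have xg': "x \<cdot> g' = g \<cdot> x'" using P by simp
  have "G \<cdot> g'' = g \<cdot> (\<beta> \<cdot> g'') \<boxplus> x \<cdot> (\<xi> \<cdot> g'')" by (subst \<beta>(2)) simp
  also have "x \<cdot> (\<xi> \<cdot> g'') = g \<cdot> (x' \<cdot> \<xi>')" using Q(9) by (simp add: comp_assoc_eq[OF xg'])
  also have "g \<cdot> (\<beta> \<cdot> g'') \<boxplus> g \<cdot> (x' \<cdot> \<xi>') = g \<cdot> (\<beta> \<cdot> g'' \<boxplus> x' \<cdot> \<xi>')" by simp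
  finally have e: "G \<cdot> g'' = g \<cdot> (\<beta> \<cdot> g'' \<boxplus> x' \<cdot> \<xi>')" .
  have "G \<cdot> g'' \<in> snd ` E" using g''(2) G(1) by (rule deflation_comp) simp
  then show ?thesis unfolding e by (rule deflation_cancel) (auto simp: k)
qed

section \<open>Relative exact structures\<close>

text \<open>
  The Noether isomorphism: for inflations \<open>A \<rightarrow> B \<rightarrow> C\<close> the sequence \<open>B/A \<rightarrow> C/A \<rightarrow> C/B\<close> is a conflation.
  Its inflation is the pushout of \<open>j\<close> along \<open>p\<close>.
\<close>

lemma inflation_comp_cokernels:
  assumes ip: "(i, p) \<in> E" and jq: "(j, q) \<in> E" and c: "(j \<cdot> i, c) \<in> E" and t: "tgt A i = src A j"
  obtains s r where "(s, r) \<in> E" "tgt A s = tgt A c" "src A s = tgt A p" "r \<cdot> c = q" "c \<cdot> j = s \<cdot> p"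
proof -
  note I = conflation_Arr[OF ip] and J = conflation_Arr[OF jq]
  note [simp] = I(1-3) J(1-3) t
  obtain s0 c' where s0: "is_pushout A j p s0 c'" "s0 \<in> fst ` E"
    using inflation_pushout[of j p] jq by force
  note P = pushoutD[OF s0(1)]
  have [simp]: "s0 \<in> Arr A" "c' \<in> Arr A" "src A s0 = tgt A p" "src A c' = tgt A j" "tgt A c' = tgt A s0"
    using P by auto
  have sp: "s0 \<cdot> p = c' \<cdot> j" using P by simp
  have c'c: "is_cokernel A c' (j \<cdot> i)"
  proof (rule cokernelI)
    have "c' \<cdot> (j \<cdot> i) = s0 \<cdot> (p \<cdot> i)" by (simp add: comp_assoc_eq[OF sp])
    then show "c' \<cdot> (j \<cdot> i) = hzero A (src A (j \<cdot> i)) (tgt A c')" using I(4) by simp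
    fix W h assume "W \<in> Ob A" "h \<in> Hom A (tgt A (j \<cdot> i)) W" and h: "h \<cdot> (j \<cdot> i) = hzero A (src A (j \<cdot> i)) W"
    then have [simp]: "h \<in> Arr A" "src A h = tgt A j" "tgt A h = W" by (auto simp: Hom_iff)
    have "(h \<cdot> j) \<cdot> i = hzero A (src A i) W" using h by simp
    then obtain l where l: "l \<in> Hom A (tgt A p) W" "l \<cdot> p = h \<cdot> j"
      by (rule cokernel_lift[OF conflationD(2)[OF ip], of "h \<cdot> j" W, rotated]) (auto simp: Hom_iff)
    then obtain k where "k \<in> Hom A (tgt A s0) W" "k \<cdot> s0 = l" "k \<cdot> c' = h"
      by (elim pushout_lift[OF s0(1), of l W h, rotated 2]) (auto simp: Hom_iff)
    then show "\<exists>k\<in>Hom A (tgt A c') W. k \<cdot> c' = h" by auto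
  next
    fix W x y assume xy: "x \<in> Hom A (tgt A c') W" "y \<in> Hom A (tgt A c') W" "x \<cdot> c' = y \<cdot> c'"
    then have [simp]: "x \<in> Arr A" "src A x = tgt A s0" "tgt A x = W" "y \<in> Arr A" "src A y = tgt A s0" "tgt A y = W"
      by (auto simp: Hom_iff)
    have "(x \<cdot> c') \<cdot> j = (y \<cdot> c') \<cdot> j" using xy by (simp only:)
    then have "(x \<cdot> s0) \<cdot> p = (y \<cdot> s0) \<cdot> p" by (simp add: sp)
    then have "x \<cdot> s0 = y \<cdot> s0"
      by (rule cokernel_epi[OF conflationD(2)[OF ip], of _ W, rotated 2]) (auto simp: Hom_iff)
    then show "x = y" using pushout_unique[OF s0(1), of x W y] xy by auto
  qed auto
  note cc = conflationD(2)[OF c]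
  obtain a where a: "a \<in> Hom A (tgt A c') (tgt A c)" "is_iso A a" "a \<cdot> c' = c"
    using cokernel_iso[OF c'c cc] by blast
  note [simp] = a(1)[unfolded Hom_iff]
  define s where "s = a \<cdot> s0"
  have [simp]: "s \<in> Arr A" "src A s = tgt A p" "tgt A s = tgt A c" by (auto simp: s_def)
  have C: "c \<in> Arr A" "src A c = tgt A j" using conflation_Arr[OF c] by auto
  note [simp] = C
  have sE: "s \<in> fst ` E" unfolding s_def by (rule inflation_iso[OF s0(2) a(2)]) simp
  have cj: "c \<cdot> j = s \<cdot> p" by (simp add: s_def sp) (simp add: a(3)[symmetric])
  have "q \<cdot> (j \<cdot> i) = hzero A (src A (j \<cdot> i)) (tgt A q)" by (simp add: comp_assoc_eq[OF J(4)])
  then obtain r where r: "r \<in> Hom A (tgt A c) (tgt A q)" "r \<cdot> c = q"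
    by (rule cokernel_lift[OF cc, of q "tgt A q", rotated]) (auto simp: Hom_iff)
  note [simp] = r(1)[unfolded Hom_iff]
  have "(r \<cdot> s) \<cdot> p = (r \<cdot> c) \<cdot> j" by (simp add: cj)
  then have "(r \<cdot> s) \<cdot> p = hzero A (tgt A p) (tgt A q) \<cdot> p" using r(2) J(4) I(3) by simp
  then have rs: "r \<cdot> s = hzero A (tgt A p) (tgt A q)"
    by (rule cokernel_epi[OF conflationD(2)[OF ip], of _ "tgt A q", rotated 2]) (auto simp: Hom_iff)
  have "is_cokernel A r s"
  proof (rule cokernelI)
    show "r \<cdot> s = hzero A (src A s) (tgt A r)" using rs by simp
    fix W h assume "W \<in> Ob A" "h \<in> Hom A (tgt A s) W" and h: "h \<cdot> s = hzero A (src A s) W"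
    then have [simp]: "h \<in> Arr A" "src A h = tgt A c" "tgt A h = W" "W \<in> Ob A" by (auto simp: Hom_iff)
    have "(h \<cdot> c) \<cdot> j = (h \<cdot> s) \<cdot> p" by (simp add: cj)
    then have "(h \<cdot> c) \<cdot> j = hzero A (src A j) W" using h by simp
    then obtain n where n: "n \<in> Hom A (tgt A q) W" "n \<cdot> q = h \<cdot> c"
      by (rule cokernel_lift[OF conflationD(2)[OF jq], of "h \<cdot> c" W, rotated]) (auto simp: Hom_iff)
    then have "n \<cdot> (r \<cdot> c) = h \<cdot> c" using r(2) by (simp add: Hom_iff)
    with n(1) have "n \<cdot> r = h" by (intro cokernel_epi[OF cc, of "n \<cdot> r" W h]) (auto simp: Hom_iff)
    then show "\<exists>n\<in>Hom A (tgt A r) W. n \<cdot> r = h" using n by auto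
  next
    fix W x y assume xy: "x \<in> Hom A (tgt A r) W" "y \<in> Hom A (tgt A r) W" "x \<cdot> r = y \<cdot> r"
    then have "(x \<cdot> r) \<cdot> c = (y \<cdot> r) \<cdot> c" by (simp only:)
    then have "x \<cdot> q = y \<cdot> q" using xy(1,2) r(2) by (simp add: Hom_iff)
    then show "x = y" using cokernel_epi[OF conflationD(2)[OF jq]] xy by auto
  qed auto
  with sE have "(s, r) \<in> E" by (rule inflation_cokernel)
  then show ?thesis using that r(2) cj by auto
qed

lemma relative_structure_iff:
  "(f, g) \<in> relative_structure A E \<X> \<longleftrightarrow> (f, g) \<in> E \<and> (\<forall>W\<in>\<X>. Hom A W (tgt A g) \<subseteq> hom_image A g W)"
  by (simp add: relative_structure_def)

lemma relative_deflation_iff: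
  "g \<in> snd ` relative_structure A E \<X> \<longleftrightarrow> g \<in> snd ` E \<and> (\<forall>W\<in>\<X>. Hom A W (tgt A g) \<subseteq> hom_image A g W)"
  by (force simp: relative_structure_def image_iff)

text \<open>
  The condition on a conflation concerns its deflation alone, so that the axioms for deflations are
  immediate, while pushouts keep the end term.  In the remaining axiom, for composites of inflations
  \<open>A \<rightarrow> B \<rightarrow> C\<close>, a morphism to \<open>C/A\<close> is first lifted modulo \<open>B/A\<close>; the error lies in \<open>B/A\<close> and is lifted
  to \<open>B\<close>.
\<close>

lemma relative_exact: "exact_structure A (relative_structure A E \<X>)"
proof (unfold_locales, goal_cases)
  case (1 \<delta>)
  then show ?case using conflation_kernel_cokernel by (auto simp: relative_structure_def)
next
  case (2 \<delta> \<delta>')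
  obtain f g f' g' where d: "\<delta> = (f, g)" "\<delta>' = (f', g')" by fastforce
  then have fg: "(f, g) \<in> E" and sub: "\<And>W. W \<in> \<X> \<Longrightarrow> Hom A W (tgt A g) \<subseteq> hom_image A g W"
    using 2(1) by (auto simp: relative_structure_def)
  have fg': "(f', g') \<in> E" using iso_closed[OF fg] 2(2) d by auto
  obtain b c where bc: "b \<in> Hom A (src A g) (src A g')" "c \<in> Hom A (tgt A g) (tgt A g')" "is_iso A c" "c \<cdot> g = g' \<cdot> b"
    using 2(2) d by (auto simp: pair_isomorphic_def)
  obtain c' where c': "c' \<in> Arr A" "src A c' = tgt A g'" "tgt A c' = tgt A g" "c \<cdot> c' = ident A (tgt A g')"
    using isoE[OF bc(3)] bc(2) by (auto simp: Hom_iff)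
  note [simp] = bc(1,2)[unfolded Hom_iff] c' conflation_Arr(1-3)[OF fg] conflation_Arr(1-3)[OF fg']
  have "h \<in> hom_image A g' W" if W: "W \<in> \<X>" "h \<in> Hom A W (tgt A g')" for W h
  proof -
    note [simp] = W(2)[unfolded Hom_iff]
    have "c' \<cdot> h \<in> Hom A W (tgt A g)" by (auto simp: Hom_iff)
    then have "c' \<cdot> h \<in> hom_image A g W" using sub W by blast
    then obtain k where k: "k \<in> Hom A W (src A g)" "g \<cdot> k = c' \<cdot> h" by (auto simp: hom_image_iff)
    have "g' \<cdot> (b \<cdot> k) = c \<cdot> (g \<cdot> k)" using k(1) comp_assoc_eq[OF bc(4)[symmetric], of k] by (simp add: Hom_iff)
    also have "\<dots> = h" by (simp add: k(2) comp_assoc_eq[OF c'(4)])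
    finally show ?thesis using k(1) by (auto simp: hom_image_iff Hom_iff intro!: bexI[of _ "b \<cdot> k"])
  qed
  then show ?case using fg' d by (auto simp: relative_structure_def)
next
  case (3 X)
  then obtain z where z: "(ident A X, z) \<in> E" using ident_inflation by force
  note Z = conflation_Arr[OF z]
  have z0: "z = hzero A X (tgt A z)" using Z 3 by simp
  have "hzero A (tgt A z) (tgt A z) = ident A (tgt A z)"
    by (rule cokernel_epi[OF conflationD(2)[OF z], of _ "tgt A z"]) (use Z 3 z0 in \<open>auto simp: Hom_iff\<close>)
  then have "is_retraction A z" using Z 3
    by (intro retractionI[of z X _ "hzero A (tgt A z) X"]) (auto simp: Hom_iff)
  then have "(ident A X, z) \<in> relative_structure A E \<X>"
    using z by (auto simp: relative_structure_iff hom_image_retraction)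
  then show ?case by force
next
  case (4 X)
  then have "is_retraction A (ident A X)" by (intro retractionI[of _ X X "ident A X"]) (auto simp: Hom_iff)
  then show ?case unfolding relative_deflation_iff using ident_deflation[OF 4]
    by (auto simp: hom_image_retraction)
next
  case (5 i j)
  then obtain p q where ip: "(i, p) \<in> E" and jq: "(j, q) \<in> E"
    and p: "\<And>W. W \<in> \<X> \<Longrightarrow> Hom A W (tgt A p) \<subseteq> hom_image A p W"
    and q: "\<And>W. W \<in> \<X> \<Longrightarrow> Hom A W (tgt A q) \<subseteq> hom_image A q W"
    by (auto simp: relative_structure_def)
  have "j \<cdot> i \<in> fst ` E" using ip jq 5(3) by (intro inflation_comp) force+
  then obtain c where c: "(j \<cdot> i, c) \<in> E" by force
  obtain s r where sr: "(s, r) \<in> E" "tgt A s = tgt A c" "src A s = tgt A p" "r \<cdot> c = q" "c \<cdot> j = s \<cdot> p"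
    using inflation_comp_cokernels[OF ip jq c 5(3)] by blast
  note [simp] = conflation_Arr(1-3)[OF ip] conflation_Arr(1-3)[OF jq] conflation_Arr(1-3)[OF sr(1)] 5(3) sr(2,3)
  have [simp]: "c \<in> Arr A" "src A c = tgt A j" using conflation_Arr[OF c] by auto
  have tr: "tgt A r = tgt A q" by (subst sr(4)[symmetric]) simp
  note [simp] = tr
  have "h \<in> hom_image A c W" if W: "W \<in> \<X>" "h \<in> Hom A W (tgt A c)" for W h
  proof -
    note [simp] = W(2)[unfolded Hom_iff] and [simp] = Hom_Ob[OF W(2)]
    have "r \<cdot> h \<in> Hom A W (tgt A q)" by (auto simp: Hom_iff)
    then have "r \<cdot> h \<in> hom_image A q W" using q W by blast
    then obtain l where l: "l \<in> Hom A W (tgt A j)" "q \<cdot> l = r \<cdot> h" by (auto simp: hom_image_iff)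
    note [simp] = l(1)[unfolded Hom_iff]
    have "r \<cdot> (h \<boxminus> c \<cdot> l) = hzero A W (tgt A r)" by (simp add: comp_assoc_eq[OF sr(4)] l(2))
    then obtain m where m: "m \<in> Hom A W (tgt A p)" "s \<cdot> m = h \<boxminus> c \<cdot> l"
      by (rule kernel_lift[OF conflationD(1)[OF sr(1)], of "h \<boxminus> c \<cdot> l" W, rotated]) (auto simp: Hom_iff)
    then have "m \<in> hom_image A p W" using p W by blast
    then obtain n where n: "n \<in> Hom A W (tgt A i)" "p \<cdot> n = m" by (auto simp: hom_image_iff)
    note [simp] = n(1)[unfolded Hom_iff]
    have "c \<cdot> (j \<cdot> n \<boxplus> l) = s \<cdot> m \<boxplus> c \<cdot> l" by (simp add: comp_assoc_eq[OF sr(5)] n(2))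
    also have "\<dots> = h" by (simp add: m(2))
    finally show ?thesis by (auto simp: hom_image_iff Hom_iff intro!: bexI[of _ "j \<cdot> n \<boxplus> l"])
  qed
  then have "(j \<cdot> i, c) \<in> relative_structure A E \<X>" using c by (auto simp: relative_structure_iff)
  then show ?case by force
next
  case (6 p q)
  then have pq: "p \<in> snd ` E" "q \<in> snd ` E" and p: "\<And>W. W \<in> \<X> \<Longrightarrow> Hom A W (tgt A p) \<subseteq> hom_image A p W"
    and q: "\<And>W. W \<in> \<X> \<Longrightarrow> Hom A W (tgt A q) \<subseteq> hom_image A q W"
    by (auto simp: relative_deflation_iff)
  note [simp] = deflation_Arr[OF pq(1)] deflation_Arr[OF pq(2)] 6(3)
  have "h \<in> hom_image A (q \<cdot> p) W" if W: "W \<in> \<X>" "h \<in> Hom A W (tgt A q)" for W h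
  proof -
    obtain k where k: "k \<in> Hom A W (src A q)" "q \<cdot> k = h" using subsetD[OF q[OF W(1)] W(2)] by (auto simp: hom_image_iff)
    obtain l where l: "l \<in> Hom A W (src A p)" "p \<cdot> l = k" using subsetD[OF p[OF W(1)]] k(1) 6(3) by (auto simp: hom_image_iff)
    then have "(q \<cdot> p) \<cdot> l = h" using k by (simp add: Hom_iff)
    then show ?thesis using l by (auto simp: hom_image_iff)
  qed
  then show ?case using deflation_comp[OF pq 6(3)] by (auto simp: relative_deflation_iff)
next
  case (7 i f)
  then obtain c where c: "(i, c) \<in> E" and sub: "\<And>W. W \<in> \<X> \<Longrightarrow> Hom A W (tgt A c) \<subseteq> hom_image A c W"
    by (auto simp: relative_structure_def)
  obtain i' f' where i': "is_pushout A i f i' f'" "i' \<in> fst ` E"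
    using inflation_pushout[of i f] c 7 by force
  note P = pushoutD[OF i'(1)] and C = conflation_Arr[OF c]
  obtain d where d: "is_cokernel A d i'" "tgt A d = tgt A c" "d \<cdot> f' = c"
    using pushout_cokernel[OF i'(1) conflationD(2)[OF c]] by blast
  have [simp]: "f' \<in> Arr A" "src A f' = src A c" "d \<in> Arr A" "tgt A f' = src A d"
    using P C cokernelD[OF d(1)] by auto
  have "h \<in> hom_image A d W" if W: "W \<in> \<X>" "h \<in> Hom A W (tgt A d)" for W h
  proof -
    have "h \<in> hom_image A c W" using sub[OF W(1)] W(2) d(2) by auto
    then obtain l where l: "l \<in> Hom A W (src A c)" "c \<cdot> l = h" by (auto simp: hom_image_iff)
    then have "d \<cdot> (f' \<cdot> l) = h" by (simp add: comp_assoc_eq[OF d(3)] Hom_iff)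
    then show ?thesis using l by (auto simp: hom_image_iff Hom_iff intro!: bexI[of _ "f' \<cdot> l"])
  qed
  then have "(i', d) \<in> relative_structure A E \<X>"
    using inflation_cokernel[OF i'(2) d(1)] by (auto simp: relative_structure_iff)
  with i' show ?case by force
next
  case (8 p f)
  then have p: "p \<in> snd ` E" and sub: "\<And>W. W \<in> \<X> \<Longrightarrow> Hom A W (tgt A p) \<subseteq> hom_image A p W"
    by (auto simp: relative_deflation_iff)
  obtain p' f' where p': "is_pullback A p f p' f'" "p' \<in> snd ` E"
    using deflation_pullback[OF p 8(2,3)] by auto
  have "h \<in> hom_image A p' W" if W: "W \<in> \<X>" "h \<in> Hom A W (tgt A p')" for W h
  proof -
    have "f \<cdot> h \<in> Hom A W (tgt A p)" using W pullbackD[OF p'(1)] by (auto simp: Hom_iff)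
    then show ?thesis using sub[OF W(1)] W pullbackD[OF p'(1)] by (auto simp: pullback_hom_image[OF p'(1)])
  qed
  then have "p' \<in> snd ` relative_structure A E \<X>" using p' by (auto simp: relative_deflation_iff)
  with p' show ?case by blast
qed

end

section \<open>Simple defects and defects of finite length\<close>

text \<open>
  The defect is a simple functor: it does not vanish, and each of its nonzero elements \<open>u\<close> generates
  the class of the identity.
\<close>

definition simple_defect :: "('o, 'm, 'z) precat_scheme \<Rightarrow> 'm \<Rightarrow> bool" where
  "simple_defect A g \<longleftrightarrow> g \<in> Arr A \<and> \<not> is_retraction A g \<and>
     (\<forall>W. \<forall>u\<in>Hom A W (tgt A g). u \<in> hom_image A g W \<or>
        (\<exists>h\<in>Hom A (tgt A g) W. \<exists>v\<in>hom_image A g (tgt A g). ident A (tgt A g) = hadd A v (cmps A u h)))"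

text \<open>
  A composition series of the defect of \<open>g\<close>, read from the top.  The class of \<open>a\<close> generates a maximal
  subobject, which is the defect of \<open>g'\<close>; the defect of \<open>G\<close> is the simple quotient.
\<close>

inductive finite_defect :: "('o, 'm, 'z) precat_scheme \<Rightarrow> ('m \<times> 'm) set \<Rightarrow> 'm \<Rightarrow> bool"
  for A :: "('o, 'm, 'z) precat_scheme" and E :: "('m \<times> 'm) set" where
  zero: "\<lbrakk>g \<in> snd ` E; is_retraction A g\<rbrakk> \<Longrightarrow> finite_defect A E g"
| extension: "\<lbrakk>g \<in> snd ` E; G \<in> snd ` E; adjoined A g a G; simple_defect A G;
     is_pullback A g a g' a'; finite_defect A E g'\<rbrakk> \<Longrightarrow> finite_defect A E g"

context preadditive_category
begin

lemma hom_image_ident: "g \<in> Arr C \<Longrightarrow> g \<in> hom_image C g (src C g)"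
  by (auto simp: hom_image_iff Hom_iff intro!: bexI[of _ "ident C (src C g)"])

lemma adjoined_hom_image:
  "adjoined C g x G \<Longrightarrow> W \<in> Ob C \<Longrightarrow> h \<in> hom_image C G W \<longleftrightarrow>
     (\<exists>u\<in>hom_image C g W. \<exists>m\<in>Hom C W (src C x). h = u \<boxplus> x \<cdot> m)"
  by (simp add: adjoined_def)

lemma adjoined_subset:
  assumes "adjoined C g x G" "W \<in> Ob C" shows "hom_image C g W \<subseteq> hom_image C G W"
proof
  fix u assume u: "u \<in> hom_image C g W"
  have A: "g \<in> Arr C" "x \<in> Arr C" "tgt C x = tgt C g" using assms by (auto simp: adjoined_def)
  then have "u \<in> Hom C W (tgt C g)" using u hom_image_sub by blast
  then have "u = u \<boxplus> x \<cdot> hzero C W (src C x)" using A assms(2) by (simp add: Hom_iff)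
  then show "u \<in> hom_image C G W" using assms A u
    unfolding adjoined_def by (metis Hom_iff hzero_Arr src_closed)
qed

text \<open>
  A nonzero element \<open>u\<close> over \<open>Z\<close> makes the simple functor a quotient of \<open>Hom(-, Z)\<close>.  When \<open>Z\<close> is local,
  \<open>J(-, Z)\<close> is the only maximal subfunctor of \<open>Hom(-, Z)\<close>.
\<close>

lemma simple_defect_radical:
  assumes g: "simple_defect C g" and Z: "local_object Z" and u: "u \<in> Hom C Z (tgt C g)" "u \<notin> hom_image C g Z"
    and h: "h \<in> Hom C W Z"
  shows "u \<cdot> h \<in> hom_image C g W \<longleftrightarrow> h \<in> jacobson_radical C W Z"
proof
  have gA [simp]: "g \<in> Arr C" using g by (simp add: simple_defect_def)
  note [simp] = u(1)[unfolded Hom_iff] h[unfolded Hom_iff]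
  have [simp]: "Z \<in> Ob C" "W \<in> Ob C" using Z Hom_Ob[OF h] by auto
  {
    assume uh: "u \<cdot> h \<in> hom_image C g W"
    have "\<not> is_retraction C h"
    proof
      assume "is_retraction C h"
      then obtain s where s: "s \<in> Hom C Z W" "h \<cdot> s = ident C Z" using h by (auto simp: is_retraction_def)
      have "(u \<cdot> h) \<cdot> s \<in> hom_image C g Z" by (rule hom_image_comp[OF gA uh s(1)])
      then show False using u s by (simp add: Hom_iff)
    qed
    then show "h \<in> jacobson_radical C W Z" using h by (simp add: jacobson_radical_local[OF Z])
  }
  assume hJ: "h \<in> jacobson_radical C W Z"
  show "u \<cdot> h \<in> hom_image C g W"
  proof (rule ccontr)
    assume "u \<cdot> h \<notin> hom_image C g W"
    moreover have "u \<cdot> h \<in> Hom C W (tgt C g)" by (simp add: Hom_iff)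
    ultimately obtain m v where m: "m \<in> Hom C (tgt C g) W" and v: "v \<in> hom_image C g (tgt C g)"
      "ident C (tgt C g) = v \<boxplus> (u \<cdot> h) \<cdot> m"
      using g unfolding simple_defect_def by blast
    have vH: "v \<in> Hom C (tgt C g) (tgt C g)" using v hom_image_sub[OF gA] by blast
    note [simp] = m[unfolded Hom_iff] vH[unfolded Hom_iff]
    have "ident C Z \<boxminus> h \<cdot> (m \<cdot> u) \<in> Units (End_ring C Z)"
      by (rule jacobson_radical_unit[OF hJ]) (auto simp: Hom_iff)
    then obtain w where w: "w \<in> Hom C Z Z" "(ident C Z \<boxminus> h \<cdot> (m \<cdot> u)) \<cdot> w = ident C Z"
      by (auto simp: End_Units_iff)
    note [simp] = w(1)[unfolded Hom_iff]
    have "ident C (tgt C g) \<cdot> u = (v \<boxplus> (u \<cdot> h) \<cdot> m) \<cdot> u" unfolding v(2)[symmetric] ..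
    then have "u = v \<cdot> u \<boxplus> u \<cdot> (h \<cdot> (m \<cdot> u))" by simp
    then have vu: "u \<boxminus> u \<cdot> (h \<cdot> (m \<cdot> u)) = v \<cdot> u" by (subst diff_eq_iff) auto
    have "(v \<cdot> u) \<cdot> w = u \<cdot> ((ident C Z \<boxminus> h \<cdot> (m \<cdot> u)) \<cdot> w)" unfolding vu[symmetric] by simp
    also have "\<dots> = u" unfolding w(2) by simp
    finally have "(v \<cdot> u) \<cdot> w = u" .
    moreover have "(v \<cdot> u) \<cdot> w \<in> hom_image C g Z"
      by (rule hom_image_comp[OF gA hom_image_comp[OF gA v(1) u(1)] w(1)])
    ultimately show False using u by simp
  qed
qed

lemma simple_defect_adjoined_retraction:
  assumes g: "simple_defect C g" and u: "u \<in> Hom C Z (tgt C g)" "u \<notin> hom_image C g Z" and G: "adjoined C g u G"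
  shows "is_retraction C G"
proof -
  have GA: "G \<in> Arr C" "tgt C G = tgt C g" "g \<in> Arr C" using G by (auto simp: adjoined_def)
  have su: "src C u = Z" using u by (simp add: Hom_iff)
  obtain h v where hv: "h \<in> Hom C (tgt C g) Z" "v \<in> hom_image C g (tgt C g)" "ident C (tgt C g) = v \<boxplus> u \<cdot> h"
    using g u unfolding simple_defect_def by blast
  have "ident C (tgt C g) \<in> hom_image C G (tgt C g)"
    using hv adjoined_hom_image[OF G, of "tgt C g" "ident C (tgt C g)"] GA su by auto
  then have "ident C (tgt C G) \<in> hom_image C G (tgt C G)" unfolding GA(2) .
  then show ?thesis using GA by (simp add: retraction_iff_hom_image)
qed

lemma iso_of_units:
  assumes b: "b \<in> Hom C X Y" "b' \<in> Hom C Y X" and u: "b' \<cdot> b \<in> Units (End_ring C X)" "b \<cdot> b' \<in> Units (End_ring C Y)"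
  shows "is_iso C b"
proof -
  obtain v w where v: "v \<in> Hom C X X" "v \<cdot> (b' \<cdot> b) = ident C X" and w: "w \<in> Hom C Y Y" "(b \<cdot> b') \<cdot> w = ident C Y"
    using u by (auto simp: End_Units_iff)
  note [simp] = b[unfolded Hom_iff] v(1)[unfolded Hom_iff] w(1)[unfolded Hom_iff]
  have "v \<cdot> b' = v \<cdot> (b' \<cdot> ((b \<cdot> b') \<cdot> w))" unfolding w(2) by simp
  also have "\<dots> = (v \<cdot> (b' \<cdot> b)) \<cdot> (b' \<cdot> w)" by simp
  also have "\<dots> = b' \<cdot> w" unfolding v(2) by simp
  finally have e: "v \<cdot> b' = b' \<cdot> w" .
  show ?thesis
  proof (rule isoI[of b X Y "b' \<cdot> w"])
    show "(b' \<cdot> w) \<cdot> b = ident C X" unfolding e[symmetric] using v(2) by simp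
    show "b \<cdot> (b' \<cdot> w) = ident C Y" using w(2) by simp
  qed (auto simp: Hom_iff)
qed

lemma kernel_map_iso:
  assumes k: "is_kernel C f g" "is_kernel C f' g'" and b: "b \<in> Hom C (src C g) (src C g')" "is_iso C b"
    and c: "c \<in> Hom C (tgt C g) (tgt C g')" "is_iso C c" and bc: "c \<cdot> g = g' \<cdot> b"
  shows "pair_isomorphic C (f, g) (f', g')"
proof -
  note K = kernelD[OF k(1)] and K' = kernelD[OF k(2)]
  note [simp] = K(1-3) K'(1-3) b(1)[unfolded Hom_iff] c(1)[unfolded Hom_iff]
  obtain b' where b': "b' \<in> Arr C" "src C b' = src C g'" "tgt C b' = src C g" "b' \<cdot> b = ident C (src C g)" "b \<cdot> b' = ident C (src C g')"
    using isoE[OF b(2)] b(1) by (auto simp: Hom_iff)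
  obtain c' where c': "c' \<in> Arr C" "src C c' = tgt C g'" "tgt C c' = tgt C g" "c' \<cdot> c = ident C (tgt C g)"
    using isoE[OF c(2)] c(1) by (auto simp: Hom_iff)
  note [simp] = b'(1-3) c'(1-3)
  have "c' \<cdot> (g' \<cdot> (b \<cdot> b')) = c' \<cdot> (c \<cdot> (g \<cdot> b'))" using comp_assoc_eq[OF bc[symmetric], of b'] by simp
  then have cb: "c' \<cdot> g' = g \<cdot> b'" by (simp add: b'(5) comp_assoc_eq[OF c'(4)])
  obtain a where a: "a \<in> Hom C (src C f) (src C f')" "f' \<cdot> a = b \<cdot> f"
    by (rule kernel_lift[OF k(2), of "b \<cdot> f" "src C f"]) (auto simp: Hom_iff comp_assoc_eq[OF bc[symmetric]] K(4))
  obtain a' where a': "a' \<in> Hom C (src C f') (src C f)" "f \<cdot> a' = b' \<cdot> f'"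
    by (rule kernel_lift[OF k(1), of "b' \<cdot> f'" "src C f'"]) (auto simp: Hom_iff comp_assoc_eq[OF cb[symmetric]] K'(4))
  note [simp] = a(1)[unfolded Hom_iff] a'(1)[unfolded Hom_iff]
  have "a' \<cdot> a = ident C (src C f)"
    by (rule kernel_mono[OF k(1), of _ "src C f"]) (auto simp: Hom_iff comp_assoc_eq[OF a'(2)] a(2) comp_assoc_eq[OF b'(4)])
  moreover have "a \<cdot> a' = ident C (src C f')"
    by (rule kernel_mono[OF k(2), of _ "src C f'"]) (auto simp: Hom_iff comp_assoc_eq[OF a(2)] a'(2) comp_assoc_eq[OF b'(5)])
  ultimately have "is_iso C a" by (intro isoI[OF a(1) a'(1)])
  then show ?thesis using a b c bc
    by (intro pair_isomorphicI[of _ _ _ _ a b c]) auto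
qed

end

section \<open>Projective objects\<close>

context exact_structure
begin

lemma split_subset: "split_exact_structure A \<subseteq> E"
  using split_deflation by (auto simp: split_exact_structure_def kernel_cokernel_pair_def)

lemma split_decomposition:
  assumes "(f, g) \<in> E" "is_retraction A g"
  obtains r s where "r \<in> Hom A (tgt A f) (src A f)" "s \<in> Hom A (tgt A g) (tgt A f)" "r \<cdot> f = ident A (src A f)"
    "g \<cdot> s = ident A (tgt A g)" "r \<cdot> s = hzero A (tgt A g) (src A f)" "f \<cdot> r \<boxplus> s \<cdot> g = ident A (tgt A f)"
proof -
  note C = conflation_Arr[OF assms(1)] and k = conflationD(1)[OF assms(1)]
  note [simp] = C(1-3)
  note gf = C(4) comp_assoc_eq[OF C(4)]
  obtain s where s: "s \<in> Arr A" "src A s = tgt A g" "tgt A s = src A g" "g \<cdot> s = ident A (tgt A g)"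
    using retractionE[OF assms(2)] by blast
  note [simp] = s(1-3)
  obtain r where r: "r \<in> Hom A (tgt A f) (src A f)" "f \<cdot> r = ident A (tgt A f) \<boxminus> s \<cdot> g"
    by (rule kernel_lift[OF k, of "ident A (tgt A f) \<boxminus> s \<cdot> g" "tgt A f"]) (auto simp: Hom_iff comp_assoc_eq[OF s(4)])
  note [simp] = r(1)[unfolded Hom_iff]
  have "r \<cdot> f = ident A (src A f)"
    by (rule kernel_mono[OF k, of _ "src A f"]) (auto simp: Hom_iff comp_assoc_eq[OF r(2)] gf)
  moreover have "r \<cdot> s = hzero A (tgt A g) (src A f)"
    by (rule kernel_mono[OF k, of _ "tgt A g"]) (auto simp: Hom_iff comp_assoc_eq[OF r(2)] s(4))
  moreover have "f \<cdot> r \<boxplus> s \<cdot> g = ident A (tgt A f)" unfolding r(2) by simp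
  ultimately show ?thesis using that[of r s] r s by (auto simp: Hom_iff)
qed

lemma split_yoneda_equivalent:
  assumes fg: "(f, g) \<in> conflations_between A E P B" "is_retraction A g"
    and fg': "(f', g') \<in> conflations_between A E P B" "is_retraction A g'"
  shows "((f, g), (f', g')) \<in> yoneda_equivalence A E P B"
proof -
  have E: "(f, g) \<in> E" "(f', g') \<in> E" and PB: "src A f = B" "src A f' = B" "tgt A g = P" "tgt A g' = P"
    using fg fg' by (auto simp: conflations_between_def)
  note C = conflation_Arr[OF E(1)] and C' = conflation_Arr[OF E(2)]
  obtain r s where rs: "r \<in> Hom A (tgt A f) (src A f)" "s \<in> Hom A (tgt A g) (tgt A f)" "r \<cdot> f = ident A (src A f)"
    "g \<cdot> s = ident A (tgt A g)" "r \<cdot> s = hzero A (tgt A g) (src A f)" "f \<cdot> r \<boxplus> s \<cdot> g = ident A (tgt A f)"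
    using split_decomposition[OF E(1) fg(2)] by blast
  obtain r' s' where rs': "r' \<in> Hom A (tgt A f') (src A f')" "s' \<in> Hom A (tgt A g') (tgt A f')" "r' \<cdot> f' = ident A (src A f')"
    "g' \<cdot> s' = ident A (tgt A g')" "r' \<cdot> s' = hzero A (tgt A g') (src A f')" "f' \<cdot> r' \<boxplus> s' \<cdot> g' = ident A (tgt A f')"
    using split_decomposition[OF E(2) fg'(2)] by blast
  note [simp] = C(1-3) C'(1-3) PB rs(1,2)[unfolded Hom_iff] rs'(1,2)[unfolded Hom_iff]
  have Ob [simp]: "P \<in> Ob A" "B \<in> Ob A" using PB(1,3) C src_closed tgt_closed by metis+
  note eqs = C(4) C'(4) rs(3-5) rs'(3-5)
  note eqs' = eqs eqs[THEN comp_assoc_eq]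
  define b where "b = f' \<cdot> r \<boxplus> s' \<cdot> g"
  define b' where "b' = f \<cdot> r' \<boxplus> s \<cdot> g'"
  have [simp]: "b \<in> Arr A" "src A b = tgt A f" "tgt A b = tgt A f'" "b' \<in> Arr A" "src A b' = tgt A f'" "tgt A b' = tgt A f"
    by (auto simp: b_def b'_def)
  have "b' \<cdot> b = ident A (tgt A f)" unfolding rs(6)[symmetric] by (simp add: b_def b'_def eqs')
  moreover have "b \<cdot> b' = ident A (tgt A f')" unfolding rs'(6)[symmetric] by (simp add: b_def b'_def eqs')
  ultimately have "is_iso A b" by (intro isoI[of b "tgt A f" "tgt A f'" b']) (auto simp: Hom_iff)
  moreover have "b \<cdot> f = f'" "g' \<cdot> b = g" by (simp_all add: b_def eqs')
  moreover have "b \<in> Hom A (src A g) (src A g')" by (simp add: Hom_iff)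
  ultimately show ?thesis using fg(1) fg'(1) by (simp only: yoneda_equivalence_def mem_Collect_eq split_conv) blast
qed

lemma split_conflation_exists:
  assumes "B \<in> Ob A" "P \<in> Ob A"
  obtains f g where "(f, g) \<in> conflations_between A E P B" "is_retraction A g"
proof -
  obtain D i0 i1 p0 p1 where H: "i0 \<in> Hom A B D" "i1 \<in> Hom A P D" "p0 \<in> Hom A D B" "p1 \<in> Hom A D P"
    and inv: "p0 \<cdot> i0 = ident A B" "p1 \<cdot> i1 = ident A P"
    and orth: "p0 \<cdot> i1 = hzero A P B" "p1 \<cdot> i0 = hzero A B P"
    and ip: "i0 \<cdot> p0 \<boxplus> i1 \<cdot> p1 = ident A D"
    by (rule biproduct_exists[OF assms])
  note [simp] = H[unfolded Hom_iff] inv orth assms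
  have [simp]: "D \<in> Ob A" using Hom_Ob[OF H(1)] by simp
  have r: "is_retraction A p1" by (rule retractionI[of p1 D _ i1]) (auto simp: Hom_iff)
  have "is_kernel A i0 p1"
  proof (rule kernelI)
    fix W h assume "W \<in> Ob A" "h \<in> Hom A W (tgt A i0)" and h: "p1 \<cdot> h = hzero A W (tgt A p1)"
    then have [simp]: "h \<in> Arr A" "src A h = W" "tgt A h = D" "W \<in> Ob A" by (auto simp: Hom_iff)
    have "h = (i0 \<cdot> p0 \<boxplus> i1 \<cdot> p1) \<cdot> h" unfolding ip by simp
    also have "\<dots> = i0 \<cdot> (p0 \<cdot> h)" using h by simp
    finally show "\<exists>k\<in>Hom A W (src A i0). i0 \<cdot> k = h" by (intro bexI[of _ "p0 \<cdot> h"]) (auto simp: Hom_iff)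
  next
    fix W x y assume xy: "x \<in> Hom A W (src A i0)" "y \<in> Hom A W (src A i0)" "i0 \<cdot> x = i0 \<cdot> y"
    then have "p0 \<cdot> (i0 \<cdot> x) = p0 \<cdot> (i0 \<cdot> y)" by (simp only:)
    then show "x = y" using xy(1,2) by (simp add: comp_assoc_eq[OF inv(1)] Hom_iff)
  qed auto
  then have "(i0, p1) \<in> E" by (rule split_deflation[OF r])
  then show ?thesis using r that[of i0 p1] by (auto simp: conflations_between_def)
qed

text \<open>
  If all conflations ending in \<open>P\<close> split, then \<open>Ext1\<close> has a single element, since two split conflations
  with the same ends are Yoneda equivalent.  Conversely the class of a conflation contains it.
\<close>

lemma projective_iff:
  "projective A E P \<longleftrightarrow> P \<in> Ob A \<and> (\<forall>(f, g)\<in>E. tgt A g = P \<longrightarrow> is_retraction A g)"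
proof
  assume pr: "projective A E P"
  have "is_retraction A g" if fg: "(f, g) \<in> E" "tgt A g = P" for f g
  proof -
    note C = conflation_Arr[OF fg(1)]
    have cb: "(f, g) \<in> conflations_between A E P (src A f)" using fg by (auto simp: conflations_between_def)
    have "((f, g), (f, g)) \<in> yoneda_equivalence A E P (src A f)"
      using cb C by (auto simp: yoneda_equivalence_def Hom_iff iso_ident intro!: bexI[of _ "ident A (src A g)"])
    moreover have "yoneda_equivalence A E P (src A f) `` {(f, g)} \<in> Ext1 A E P (src A f)"
      unfolding Ext1_def using cb by (rule quotientI)
    ultimately have "(f, g) \<in> Ext1_zero A P (src A f)"
      using pr C unfolding projective_def by auto
    then show ?thesis by (auto simp: Ext1_zero_def conflations_between_def split_exact_structure_def)
  qed
  then show "P \<in> Ob A \<and> (\<forall>(f, g)\<in>E. tgt A g = P \<longrightarrow> is_retraction A g)"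
    using pr by (auto simp: projective_def)
next
  assume pr: "P \<in> Ob A \<and> (\<forall>(f, g)\<in>E. tgt A g = P \<longrightarrow> is_retraction A g)"
  have "Ext1 A E P B = {Ext1_zero A P B}" if B: "B \<in> Ob A" for B
  proof -
    have eq: "conflations_between A E P B = Ext1_zero A P B"
      using pr split_subset conflation_kernel_cokernel
      by (auto simp: Ext1_zero_def conflations_between_def split_exact_structure_def)
    have retr: "is_retraction A g" if "(f, g) \<in> conflations_between A E P B" for f g
      using that pr by (auto simp: conflations_between_def)
    have "yoneda_equivalence A E P B `` {\<delta>} = Ext1_zero A P B" if "\<delta> \<in> conflations_between A E P B" for \<delta>
    proof -
      have "(\<delta>, \<delta>') \<in> yoneda_equivalence A E P B" if "\<delta>' \<in> conflations_between A E P B" for \<delta>'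
        using split_yoneda_equivalent[of "fst \<delta>" "snd \<delta>" P B "fst \<delta>'" "snd \<delta>'"] retr
          that \<open>\<delta> \<in> _\<close> by (metis prod.collapse)
      moreover have "yoneda_equivalence A E P B `` {\<delta>} \<subseteq> conflations_between A E P B"
        by (auto simp: yoneda_equivalence_def)
      ultimately show ?thesis using eq by auto
    qed
    moreover obtain f g where "(f, g) \<in> conflations_between A E P B"
      using split_conflation_exists B pr by metis
    ultimately show ?thesis unfolding Ext1_def quotient_def by auto
  qed
  then show "projective A E P" using pr by (simp add: projective_def)
qed

section \<open>Existence and uniqueness of AR conflations\<close>

lemma AR_conflations_iff:
  "(f, g) \<in> AR_conflations A E \<longleftrightarrow> (f, g) \<in> E \<and> indecomposable A (src A f) \<and> indecomposable A (tgt A g) \<and>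
     \<not> is_retraction A g \<and> (\<forall>W\<in>Ob A. jacobson_radical A W (tgt A g) \<subseteq> hom_image A g W)"
  by (auto simp: AR_conflations_def hom_image_iff subset_iff)

text \<open>
  As \<open>g (1 - e) = 0\<close>, there is \<open>t\<close> with \<open>1 - e = f t\<close>.  Here \<open>t f\<close> is not a unit because \<open>f\<close> is not a
  section, so \<open>1 - t f\<close> is a unit of the local ring \<open>End X\<close>.  By \<open>unit_one_minus_swap\<close> so is
  \<open>1 - f t = e\<close>.
\<close>

lemma endo_unit:
  assumes fg: "(f, g) \<in> E" and X: "local_object (src A f)" and r: "\<not> is_retraction A g"
    and e: "e \<in> Hom A (src A g) (src A g)" "g \<cdot> e = g"
  shows "e \<in> Units (End_ring A (src A g))"
proof -
  note C = conflation_Arr[OF fg]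
  note [simp] = C(1-3) e(1)[unfolded Hom_iff]
  obtain t where t: "t \<in> Hom A (tgt A f) (src A f)" "f \<cdot> t = ident A (tgt A f) \<boxminus> e"
    by (rule kernel_lift[OF conflationD(1)[OF fg], of "ident A (tgt A f) \<boxminus> e" "tgt A f"]) (auto simp: Hom_iff e(2))
  note [simp] = t(1)[unfolded Hom_iff]
  have "t \<cdot> f \<notin> Units (End_ring A (src A f))"
  proof
    assume "t \<cdot> f \<in> Units (End_ring A (src A f))"
    then obtain v where "v \<in> Hom A (src A f) (src A f)" "v \<cdot> (t \<cdot> f) = ident A (src A f)" by (auto simp: End_Units_iff)
    then have "\<exists>r\<in>Hom A (tgt A f) (src A f). r \<cdot> f = ident A (src A f)"
      by (intro bexI[of _ "v \<cdot> t"]) (auto simp: Hom_iff)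
    then show False using r kernel_section_retraction[OF conflationD[OF fg]] by blast
  qed
  then have "ident A (src A f) \<boxminus> t \<cdot> f \<in> Units (End_ring A (src A f))"
    by (intro local_objectD(2)[OF X]) (auto simp: Hom_iff)
  then have "ident A (tgt A f) \<boxminus> f \<cdot> t \<in> Units (End_ring A (tgt A f))"
    by (rule unit_one_minus_swap[rotated 2]) (auto simp: Hom_iff)
  moreover have "ident A (tgt A f) \<boxminus> f \<cdot> t = e" unfolding t(2) by (subst diff_eq_iff) (auto simp: add_comm)
  ultimately show ?thesis by simp
qed

end

locale krull_schmidt_exact = krull_schmidt_category A + exact_structure A E
  for A :: "('o, 'm, 'z) precat_scheme" (structure) and E :: "('m \<times> 'm) set"
begin

text \<open>
  If all inclusions \<open>i\<^sub>j\<close> of a decomposition of \<open>C\<close> factored through \<open>g\<close>, the identity would, too.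
\<close>

lemma nonretraction_local:
  assumes g: "g \<in> Arr A" "\<not> is_retraction A g"
  obtains Z u where "local_object Z" "u \<in> Hom A Z (tgt A g)" "u \<notin> hom_image A g Z"
proof -
  obtain n X i p where ds: "direct_sum A n X (tgt A g) i p" and loc: "\<And>j. j < n \<Longrightarrow> local_ring (End_ring A (X j))"
    using krull_schmidt[of "tgt A g"] g by auto
  note D = direct_sumD[OF ds]
  have "\<exists>j<n. i j \<notin> hom_image A g (X j)"
  proof (rule ccontr)
    assume "\<not> (\<exists>j<n. i j \<notin> hom_image A g (X j))"
    then have "i j \<cdot> p j \<in> hom_image A g (tgt A g)" if "j < n" for j
      using that D(4)[OF that] by (intro hom_image_comp[OF g(1)]) auto
    then have "ident A (tgt A g) \<in> hom_image A g (tgt A g)"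
      by (rule direct_sum_induct[OF ds]) (use g in \<open>auto intro: hom_image_add hom_image_zero\<close>)
    then show False using g by (simp add: retraction_iff_hom_image)
  qed
  then show ?thesis using that loc D by blast
qed

lemma nonsection_local:
  assumes f: "f \<in> Arr A" "\<And>r. r \<in> Hom A (tgt A f) (src A f) \<Longrightarrow> r \<cdot> f \<noteq> ident A (src A f)"
  obtains Z u where "local_object Z" "u \<in> Hom A (src A f) Z" "\<And>r. r \<in> Hom A (tgt A f) Z \<Longrightarrow> r \<cdot> f \<noteq> u"
proof -
  obtain n X i p where ds: "direct_sum A n X (src A f) i p" and loc: "\<And>j. j < n \<Longrightarrow> local_ring (End_ring A (X j))"
    using krull_schmidt[of "src A f"] f by auto
  note D = direct_sumD[OF ds]
  have "\<exists>j<n. \<forall>r\<in>Hom A (tgt A f) (X j). r \<cdot> f \<noteq> p j"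
  proof (rule ccontr)
    assume neg: "\<not> ?thesis"
    have "\<exists>r\<in>Hom A (tgt A f) (src A f). r \<cdot> f = i j \<cdot> p j" if j: "j < n" for j
    proof -
      obtain r where r: "r \<in> Hom A (tgt A f) (X j)" "r \<cdot> f = p j" using neg j by blast
      then show ?thesis using f(1) D(3)[OF j] by (intro bexI[of _ "i j \<cdot> r"]) (auto simp: Hom_iff)
    qed
    then have "\<exists>r\<in>Hom A (tgt A f) (src A f). r \<cdot> f = ident A (src A f)"
    proof (rule direct_sum_induct[OF ds])
      show "\<exists>r\<in>Hom A (tgt A f) (src A f). r \<cdot> f = hzero A (src A f) (src A f)"
        using f(1) by (intro bexI[of _ "hzero A (tgt A f) (src A f)"]) (auto simp: Hom_iff)
      fix a b assume "\<exists>r\<in>Hom A (tgt A f) (src A f). r \<cdot> f = a" "\<exists>r\<in>Hom A (tgt A f) (src A f). r \<cdot> f = b"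
      then obtain r s where "r \<in> Hom A (tgt A f) (src A f)" "s \<in> Hom A (tgt A f) (src A f)" "r \<cdot> f = a" "s \<cdot> f = b" by blast
      then show "\<exists>r\<in>Hom A (tgt A f) (src A f). r \<cdot> f = a \<boxplus> b"
        using f(1) by (intro bexI[of _ "r \<boxplus> s"]) (auto simp: Hom_iff)
    qed
    then show False using f(2) by blast
  qed
  then obtain j where j: "j < n" "\<forall>r\<in>Hom A (tgt A f) (X j). r \<cdot> f \<noteq> p j" by blast
  show ?thesis by (rule that[of "X j" "p j"]) (use j loc D[OF j(1)] in auto)
qed

text \<open>
  Such a conflation can fail to be an AR conflation only by its kernel being decomposable.  As \<open>f\<close> is
  not a section, some component \<open>\<pi>\<close> of the kernel does not extend along \<open>f\<close>.  The pushout along \<open>\<pi>\<close>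
  does not split, and the image of its deflation contains that of \<open>g\<close>.
\<close>

lemma AR_of_radical_deflation:
  assumes fg: "(f, g) \<in> E" and Z: "local_object (tgt A g)" and nr: "\<not> is_retraction A g"
    and J: "\<And>W. W \<in> Ob A \<Longrightarrow> jacobson_radical A W (tgt A g) \<subseteq> hom_image A g W"
  obtains f' g' where "(f', g') \<in> AR_conflations A E" "tgt A g' = tgt A g"
proof -
  note C = conflation_Arr[OF fg]
  note [simp] = C(1-3)
  obtain K \<pi> where K: "local_object K" "\<pi> \<in> Hom A (src A f) K" "\<And>r. r \<in> Hom A (tgt A f) K \<Longrightarrow> r \<cdot> f \<noteq> \<pi>"
    using nonsection_local[of f] C(1) nr kernel_section_retraction[OF conflationD[OF fg]] by metis
  note [simp] = K(2)[unfolded Hom_iff]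
  obtain f' f'' where po: "is_pushout A f \<pi> f' f''" "f' \<in> fst ` E"
    using inflation_pushout[of f \<pi>] fg by force
  note P = pushoutD[OF po(1)]
  have [simp]: "f' \<in> Arr A" "f'' \<in> Arr A" "src A f' = K" "src A f'' = tgt A f" "tgt A f'' = tgt A f'"
    using P by auto
  obtain g' where g': "is_cokernel A g' f'" "tgt A g' = tgt A g" "g' \<cdot> f'' = g"
    using pushout_cokernel[OF po(1) conflationD(2)[OF fg]] by blast
  have fg': "(f', g') \<in> E" using po(2) g'(1) by (rule inflation_cokernel)
  note [simp] = conflation_Arr(2,3)[OF fg']
  have "\<not> is_retraction A g'"
  proof
    assume "is_retraction A g'"
    then obtain r where r: "r \<in> Hom A (tgt A f') K" "r \<cdot> f' = ident A K"
      using kernel_section_retraction[OF conflationD[OF fg']] by auto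
    note [simp] = r(1)[unfolded Hom_iff]
    have "(r \<cdot> f'') \<cdot> f = (r \<cdot> f') \<cdot> \<pi>" using P(9) by simp
    then have "(r \<cdot> f'') \<cdot> f = \<pi>" unfolding r(2) by simp
    then show False using K(3)[of "r \<cdot> f''"] by (auto simp: Hom_iff)
  qed
  moreover have "hom_image A g W \<subseteq> hom_image A g' W" for W
  proof
    fix h assume "h \<in> hom_image A g W"
    then obtain l where "l \<in> Hom A W (src A g)" "g \<cdot> l = h" by (auto simp: hom_image_iff)
    then show "h \<in> hom_image A g' W"
      using comp_assoc_eq[OF g'(3), of l] by (auto simp: hom_image_iff Hom_iff intro!: bexI[of _ "f'' \<cdot> l"])
  qed
  ultimately have "(f', g') \<in> AR_conflations A E"
    unfolding AR_conflations_iff using fg' K(1) Z J g'(2) by (auto simp: indecomposable_iff_local)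
  then show ?thesis using g'(2) that by blast
qed

lemma AR_hom_image:
  assumes "(f, g) \<in> AR_conflations A E" "W \<in> Ob A"
  shows "hom_image A g W = jacobson_radical A W (tgt A g)"
proof
  have fg: "(f, g) \<in> E" "local_object (tgt A g)" "\<not> is_retraction A g" "jacobson_radical A W (tgt A g) \<subseteq> hom_image A g W"
    using assms by (auto simp: AR_conflations_iff indecomposable_iff_local)
  note [simp] = conflation_Arr[OF fg(1)]
  show "jacobson_radical A W (tgt A g) \<subseteq> hom_image A g W" by fact
  show "hom_image A g W \<subseteq> jacobson_radical A W (tgt A g)"
  proof
    fix h assume h: "h \<in> hom_image A g W"
    then have hH: "h \<in> Hom A W (tgt A g)" using hom_image_sub[of g W] by auto
    have "\<not> is_retraction A h"
    proof
      assume "is_retraction A h"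
      then obtain s where s: "s \<in> Hom A (tgt A g) W" "h \<cdot> s = ident A (tgt A g)" using hH by (auto simp: is_retraction_def Hom_iff)
      then show False using hom_image_comp[OF _ h s(1)] fg(3) by (simp add: retraction_iff_hom_image)
    qed
    then show "h \<in> jacobson_radical A W (tgt A g)" using hH by (simp add: jacobson_radical_local[OF fg(2)])
  qed
qed

text \<open>
  After identification of the end terms by \<open>c\<close>, each of the two deflations is radical and so factors
  through the other one; \<open>endo_unit\<close> shows that the comparison maps are invertible.
\<close>

lemma AR_unique:
  assumes ar: "(f, g) \<in> AR_conflations A E" "(f', g') \<in> AR_conflations A E" and iso: "isomorphic A (tgt A g) (tgt A g')"
  shows "pair_isomorphic A (f, g) (f', g')"
proof -
  have fg: "(f, g) \<in> E" "local_object (src A f)" "local_object (tgt A g)" "\<not> is_retraction A g"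
    and fg': "(f', g') \<in> E" "local_object (src A f')" "local_object (tgt A g')" "\<not> is_retraction A g'"
    using ar by (auto simp: AR_conflations_iff indecomposable_iff_local)
  note [simp] = conflation_Arr(1-3)[OF fg(1)] conflation_Arr(1-3)[OF fg'(1)]
  obtain c where c: "c \<in> Hom A (tgt A g) (tgt A g')" "is_iso A c" using iso by (auto simp: isomorphic_def)
  obtain c' where c': "c' \<in> Arr A" "src A c' = tgt A g'" "tgt A c' = tgt A g" "c' \<cdot> c = ident A (tgt A g)" "c \<cdot> c' = ident A (tgt A g')"
    using isoE[OF c(2)] c(1) by (auto simp: Hom_iff)
  note [simp] = c(1)[unfolded Hom_iff] c'(1-3)
  have "\<not> is_retraction A (c \<cdot> g)"
  proof
    assume "is_retraction A (c \<cdot> g)"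
    then obtain s where s: "s \<in> Arr A" "src A s = tgt A g'" "tgt A s = src A g" "(c \<cdot> g) \<cdot> s = ident A (tgt A g')"
      by (auto elim!: retractionE)
    have "g \<cdot> (s \<cdot> c) = c' \<cdot> (((c \<cdot> g) \<cdot> s) \<cdot> c)" using s(1-3) by (simp add: comp_assoc_eq[OF c'(4)])
    also have "\<dots> = ident A (tgt A g)" unfolding s(4) using c'(4) by simp
    finally show False using fg(4) s(1-3) retractionI[of g "src A g" "tgt A g" "s \<cdot> c"] by (auto simp: Hom_iff)
  qed
  then have "c \<cdot> g \<in> hom_image A g' (src A g)"
    using AR_hom_image[OF ar(2), of "src A g"] by (auto simp: jacobson_radical_local[OF fg'(3)] Hom_iff)
  then obtain b where b: "b \<in> Hom A (src A g) (src A g')" "g' \<cdot> b = c \<cdot> g" by (auto simp: hom_image_iff)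
  have "\<not> is_retraction A (c' \<cdot> g')"
  proof
    assume "is_retraction A (c' \<cdot> g')"
    then obtain s where s: "s \<in> Arr A" "src A s = tgt A g" "tgt A s = src A g'" "(c' \<cdot> g') \<cdot> s = ident A (tgt A g)"
      by (auto elim!: retractionE)
    have "g' \<cdot> (s \<cdot> c') = c \<cdot> (((c' \<cdot> g') \<cdot> s) \<cdot> c')" using s(1-3) by (simp add: comp_assoc_eq[OF c'(5)])
    also have "\<dots> = ident A (tgt A g')" unfolding s(4) using c'(5) by simp
    finally show False using fg'(4) s(1-3) retractionI[of g' "src A g'" "tgt A g'" "s \<cdot> c'"] by (auto simp: Hom_iff)
  qed
  then have "c' \<cdot> g' \<in> hom_image A g (src A g')"
    using AR_hom_image[OF ar(1), of "src A g'"] by (auto simp: jacobson_radical_local[OF fg(3)] Hom_iff)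
  then obtain b' where b': "b' \<in> Hom A (src A g') (src A g)" "g \<cdot> b' = c' \<cdot> g'" by (auto simp: hom_image_iff)
  note [simp] = b(1)[unfolded Hom_iff] b'(1)[unfolded Hom_iff]
  have "b' \<cdot> b \<in> Units (End_ring A (src A g))"
    by (rule endo_unit[OF fg(1,2,4)]) (auto simp: Hom_iff comp_assoc_eq[OF b'(2)] b(2) comp_assoc_eq[OF c'(4)])
  moreover have "b \<cdot> b' \<in> Units (End_ring A (src A g'))"
    by (rule endo_unit[OF fg'(1,2,4)]) (auto simp: Hom_iff comp_assoc_eq[OF b(2)] b'(2) comp_assoc_eq[OF c'(5)])
  ultimately have "is_iso A b" by (rule iso_of_units[OF b(1) b'(1)])
  then show ?thesis
    by (intro kernel_map_iso[OF conflationD(1)[OF fg(1)] conflationD(1)[OF fg'(1)] b(1) _ c]) (simp_all add: b(2))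
qed

section \<open>Deflations that belong to a smaller exact structure\<close>

text \<open>
  In the induction step the deflation \<open>g'\<close> inherits the hypothesis on \<open>g\<close>, as \<open>u \<notin> im g'\<close> means
  \<open>a u \<notin> im g\<close>.  For \<open>G\<close>, let \<open>u : Z \<rightarrow> C\<close> be a nonzero element of its simple defect.  The pullback \<open>g1\<close>
  of \<open>G\<close> along \<open>u\<close> has the same image \<open>J(-, Z)\<close> as the AR deflation \<open>g0\<close> in \<open>F\<close>, so it belongs to
  \<open>F\<close>; moreover \<open>(G, u)\<close> splits.  Gluing puts \<open>G\<close> into \<open>F\<close>, and gluing again, along \<open>a\<close>, puts \<open>g\<close> into \<open>F\<close>.
\<close>

lemma deflation_in_substructure:
  assumes F: "exact_structure A F" "F \<subseteq> E" and g: "finite_defect A E g"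
    and ar: "\<And>Z u. \<lbrakk>local_object Z; u \<in> Hom A Z (tgt A g); u \<notin> hom_image A g Z\<rbrakk> \<Longrightarrow>
      \<exists>(f0, g0)\<in>AR_conflations A F. tgt A g0 = Z"
  shows "g \<in> snd ` F"
  using g ar
proof (induction rule: finite_defect.induct)
  case (zero g)
  interpret F: exact_structure A F by fact
  obtain f where "(f, g) \<in> E" using zero by auto
  then have "(f, g) \<in> F" by (intro F.split_deflation zero conflationD)
  then show ?case by force
next
  case (extension g G a g' a')
  interpret F: exact_structure A F by fact
  obtain f where f: "(f, g) \<in> E" using extension by auto
  have A: "a \<in> Arr A" "tgt A a = tgt A g" "G \<in> Arr A" "tgt A G = tgt A g"
    using extension.hyps(3) by (auto simp: adjoined_def)
  note P = pullbackD[OF extension.hyps(5)]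
  have "g' \<in> snd ` F"
  proof (rule extension.IH)
    fix Z u assume u: "local_object Z" "u \<in> Hom A Z (tgt A g')" "u \<notin> hom_image A g' Z"
    then have "a \<cdot> u \<notin> hom_image A g Z" "a \<cdot> u \<in> Hom A Z (tgt A g)"
      using A P by (auto simp: pullback_hom_image[OF extension.hyps(5)] Hom_iff)
    then show "\<exists>(f0, g0)\<in>AR_conflations A F. tgt A g0 = Z" using extension.prems u(1) by blast
  qed
  moreover have "G \<in> snd ` F"
  proof -
    have sd: "simple_defect A G" by fact
    then obtain Z u where u: "local_object Z" "u \<in> Hom A Z (tgt A G)" "u \<notin> hom_image A G Z"
      using nonretraction_local[of G] by (auto simp: simple_defect_def)
    have "u \<notin> hom_image A g Z" using u adjoined_subset[OF extension.hyps(3), of Z] by blast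
    then obtain f0 g0 where g0: "(f0, g0) \<in> AR_conflations A F" "tgt A g0 = Z"
      using extension.prems[of Z u] u A by auto
    then have g0': "g0 \<in> snd ` F" "\<not> is_retraction A g0" by (force simp: F.AR_conflations_iff)+
    have uA: "u \<in> Arr A" "tgt A G = tgt A u" "src A u = Z" using u(2) by (auto simp: Hom_iff)
    obtain g1 u1 where g1: "is_pullback A G u g1 u1" "g1 \<in> snd ` E"
      using deflation_pullback[OF extension.hyps(2) uA(1,2)] by auto
    then obtain f1 where f1: "(f1, g1) \<in> E" by auto
    have "g0 \<in> jacobson_radical A (src A g0) Z"
      using g0 g0' u(1) F.deflation_Arr[OF g0'(1)] by (simp add: jacobson_radical_local Hom_iff)
    then have "g0 \<in> hom_image A g1 (src A g0)"
      using simple_defect_radical[OF sd u(1,2,3), of g0 "src A g0"] g0(2) F.deflation_Arr[OF g0'(1)] uA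
      by (auto simp: pullback_hom_image[OF g1(1)] Hom_iff)
    then have "(f1, g1) \<in> F"
      using g0'(1) conflationD(1)[OF f1] by (intro F.deflation_of_image[of g0])
    then have g1F: "g1 \<in> snd ` F" by force
    obtain G' where G': "G' \<in> snd ` E" "adjoined A G u G'"
      using adjoin_deflation[OF extension.hyps(2), of u] uA by auto
    then obtain f' where f': "(f', G') \<in> E" by auto
    have "is_retraction A G'" by (rule simple_defect_adjoined_retraction[OF sd u(2,3) G'(2)])
    then have "(f', G') \<in> F" using conflationD(1)[OF f'] by (rule F.split_deflation)
    then have G'F: "G' \<in> snd ` F" by force
    obtain fG where fG: "(fG, G) \<in> E" using extension.hyps(2) by auto
    have "(fG, G) \<in> F" by (rule F.deflation_glue[OF conflationD(1)[OF fG] G'F G'(2) g1(1) g1F])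
    then show ?thesis by force
  qed
  ultimately have "(f, g) \<in> F"
    using conflationD(1)[OF f] extension.hyps(3,5) by (intro F.deflation_glue)
  then show ?case by force
qed

text \<open>
  The top factor of the defect of \<open>g\<close> is a simple quotient of \<open>Hom(-, Z)\<close>, so \<open>G\<close> has image
  \<open>J(-, Z)\<close>.  It belongs to \<open>F\<close> together with \<open>g\<close>, because adjoining a morphism to a deflation of \<open>F\<close>
  gives a deflation of \<open>F\<close> with the same image as \<open>G\<close>.
\<close>

lemma AR_conflation_exists:
  assumes F: "exact_structure A F" "F \<subseteq> E" and g: "finite_defect A E g" "g \<in> snd ` F" "\<not> is_retraction A g"
    and Z: "local_object (tgt A g)"
  obtains f' g' where "(f', g') \<in> AR_conflations A F" "tgt A g' = tgt A g"
  using g(1)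
proof cases
  case zero
  with g show ?thesis by simp
next
  case (extension G a g' a')
  interpret F: krull_schmidt_exact A F using F(1) krull_schmidt_category_axioms
    by (simp add: krull_schmidt_exact_def)
  have A: "a \<in> Arr A" "tgt A a = tgt A g" "G \<in> Arr A" "tgt A G = tgt A g"
    using extension(3) by (auto simp: adjoined_def)
  obtain G1 where G1: "G1 \<in> snd ` F" "adjoined A g a G1" using F.adjoin_deflation[OF g(2) A(1,2)] by blast
  have G1A: "G1 \<in> Arr A" using F.deflation_Arr[OF G1(1)] .
  have "hom_image A G1 W = hom_image A G W" if "W \<in> Ob A" for W
    using that G1(2) extension(3) unfolding adjoined_def by auto
  then have "G1 \<in> hom_image A G (src A G1)" using hom_image_ident[OF G1A] G1A by auto
  moreover obtain fG where fG: "(fG, G) \<in> E" using extension(2) by auto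
  ultimately have fGF: "(fG, G) \<in> F" using G1(1) conflationD(1)[OF fG] by (intro F.deflation_of_image[of G1])
  have nr: "\<not> is_retraction A G" using extension(4) by (simp add: simple_defect_def)
  have Z': "local_object (tgt A G)" using Z A by simp
  have "ident A (tgt A G) \<notin> hom_image A G (tgt A G)" using nr A by (simp add: retraction_iff_hom_image)
  moreover have "ident A (tgt A G) \<in> Hom A (tgt A G) (tgt A G)"
    using A F.deflation_Arr[OF g(2)] by (simp add: Hom_iff)
  ultimately have "jacobson_radical A W (tgt A G) \<subseteq> hom_image A G W" for W
    using simple_defect_radical[OF extension(4) Z', of "ident A (tgt A G)"]
    by (auto simp: jacobson_radical_iff Hom_iff)
  then obtain f'' g'' where "(f'', g'') \<in> AR_conflations A F" "tgt A g'' = tgt A G"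
    by (rule F.AR_of_radical_deflation[OF fGF Z' nr])
  then show ?thesis using that A by auto
qed

end

lemma Mod_sel [simp]:
  "src (Mod_category A) = nt_src" "tgt (Mod_category A) = nt_tgt"
  "F \<in> Ob (Mod_category A) \<longleftrightarrow> additive_presheaf A F"
  "t \<in> Arr (Mod_category A) \<longleftrightarrow> additive_presheaf A (nt_src t) \<and> additive_presheaf A (nt_tgt t) \<and> is_natural A t"
  by (simp_all add: Mod_category_def)

lemma Mod_Hom_iff:
  "t \<in> Hom (Mod_category A) N L \<longleftrightarrow> additive_presheaf A N \<and> additive_presheaf A L \<and> is_natural A t \<and> nt_src t = N \<and> nt_tgt t = L"
  by (auto simp: Hom_iff)

section \<open>Quotients of representable functors\<close>

context preadditive_category
begin

text \<open>
  The functor \<open>N\<close> is isomorphic to \<open>Hom(-, C) / im g\<close>, the class of the identity corresponding to \<open>x\<close>.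
\<close>

definition presents :: "('a, 'b, 'g) presheaf \<Rightarrow> 'g \<Rightarrow> 'b \<Rightarrow> bool" where
  "presents N x g \<longleftrightarrow> additive_presheaf C N \<and> g \<in> Arr C \<and> x \<in> carrier (fob N (tgt C g)) \<and>
     (\<forall>W\<in>Ob C. \<forall>y\<in>carrier (fob N W). \<exists>h\<in>Hom C W (tgt C g). farr N h x = y) \<and>
     (\<forall>W\<in>Ob C. \<forall>h\<in>Hom C W (tgt C g). farr N h x = \<one>\<^bsub>fob N W\<^esub> \<longleftrightarrow> h \<in> hom_image C g W)"

lemma presents_gen:
  "presents N x g \<Longrightarrow> W \<in> Ob C \<Longrightarrow> y \<in> carrier (fob N W) \<Longrightarrow> \<exists>h\<in>Hom C W (tgt C g). farr N h x = y"
  by (simp add: presents_def)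

lemma presents_ker:
  "presents N x g \<Longrightarrow> h \<in> Hom C W (tgt C g) \<Longrightarrow> farr N h x = \<one>\<^bsub>fob N W\<^esub> \<longleftrightarrow> h \<in> hom_image C g W"
  using Hom_Ob[of h W "tgt C g"] by (simp add: presents_def)

lemma presheaf_group: "additive_presheaf C N \<Longrightarrow> X \<in> Ob C \<Longrightarrow> comm_group (fob N X)"
  by (simp add: additive_presheaf_def)

lemma presheaf_hom: "additive_presheaf C N \<Longrightarrow> h \<in> Hom C W X \<Longrightarrow> farr N h \<in> hom (fob N X) (fob N W)"
  by (auto simp: additive_presheaf_def Hom_iff)

lemma presheaf_closed [simp]:
  "additive_presheaf C N \<Longrightarrow> h \<in> Hom C W X \<Longrightarrow> x \<in> carrier (fob N X) \<Longrightarrow> farr N h x \<in> carrier (fob N W)"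
  using presheaf_hom hom_in_carrier by metis

lemma presheaf_one:
  assumes "additive_presheaf C N" "h \<in> Hom C W X"
  shows "farr N h \<one>\<^bsub>fob N X\<^esub> = \<one>\<^bsub>fob N W\<^esub>"
  using presheaf_hom[OF assms] presheaf_group[OF assms(1)] Hom_Ob[OF assms(2)]
  by (intro hom_one) (auto simp: comm_group_def)

lemma presheaf_ident: "additive_presheaf C N \<Longrightarrow> X \<in> Ob C \<Longrightarrow> x \<in> carrier (fob N X) \<Longrightarrow> farr N (ident C X) x = x"
  by (simp add: additive_presheaf_def)

lemma presheaf_comp: "additive_presheaf C N \<Longrightarrow> f \<in> Hom C W X \<Longrightarrow> g \<in> Hom C X Y \<Longrightarrow> x \<in> carrier (fob N Y) \<Longrightarrow>
    farr N (g \<cdot> f) x = farr N f (farr N g x)"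
  by (auto simp: additive_presheaf_def Hom_iff)

lemma presheaf_add: "additive_presheaf C N \<Longrightarrow> f \<in> Hom C W X \<Longrightarrow> g \<in> Hom C W X \<Longrightarrow> x \<in> carrier (fob N X) \<Longrightarrow>
    farr N (f \<boxplus> g) x = farr N f x \<otimes>\<^bsub>fob N W\<^esub> farr N g x"
  using Hom_Ob[of f W X] by (auto simp: additive_presheaf_def)

lemma presheaf_diff:
  assumes N: "additive_presheaf C N" and fg: "f \<in> Hom C W X" "g \<in> Hom C W X" and x: "x \<in> carrier (fob N X)"
  shows "farr N (f \<boxminus> g) x = \<one>\<^bsub>fob N W\<^esub> \<longleftrightarrow> farr N f x = farr N g x"
proof -
  note [simp] = fg[unfolded Hom_iff]
  interpret G: comm_group "fob N W" using presheaf_group[OF N] Hom_Ob[OF fg(1)] by simp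
  have d: "f \<boxminus> g \<in> Hom C W X" by (simp add: Hom_iff)
  have "farr N (f \<boxminus> g \<boxplus> g) x = farr N (f \<boxminus> g) x \<otimes>\<^bsub>fob N W\<^esub> farr N g x"
    by (rule presheaf_add[OF N d fg(2) x])
  moreover have "f \<boxminus> g \<boxplus> g = f" by simp
  ultimately have e: "farr N f x = farr N (f \<boxminus> g) x \<otimes>\<^bsub>fob N W\<^esub> farr N g x" by simp
  show ?thesis unfolding e using presheaf_closed[OF N d x] presheaf_closed[OF N fg(2) x] by auto
qed

lemma Mod_hom: "t \<in> Hom (Mod_category C) N L \<Longrightarrow> X \<in> Ob C \<Longrightarrow> component t X \<in> hom (fob N X) (fob L X)"
  by (auto simp: Mod_Hom_iff is_natural_def)

lemma Mod_closed [simp]: "t \<in> Hom (Mod_category C) N L \<Longrightarrow> X \<in> Ob C \<Longrightarrow> y \<in> carrier (fob N X) \<Longrightarrow>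
    component t X y \<in> carrier (fob L X)"
  using Mod_hom hom_in_carrier by metis

lemma Mod_natural: "t \<in> Hom (Mod_category C) N L \<Longrightarrow> h \<in> Hom C W X \<Longrightarrow> y \<in> carrier (fob N X) \<Longrightarrow>
    component t W (farr N h y) = farr L h (component t X y)"
  by (auto simp: Mod_Hom_iff is_natural_def Hom_iff)

lemma Mod_one:
  assumes "t \<in> Hom (Mod_category C) N L" "X \<in> Ob C"
  shows "component t X \<one>\<^bsub>fob N X\<^esub> = \<one>\<^bsub>fob L X\<^esub>"
  using Mod_hom[OF assms] presheaf_group[OF _ assms(2)] assms(1)
  by (intro hom_one) (auto simp: comm_group_def Mod_Hom_iff)

lemma Mod_eqI:
  assumes t: "t \<in> Hom (Mod_category C) N L" "s \<in> Hom (Mod_category C) N L"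
    and eq: "\<And>X y. X \<in> Ob C \<Longrightarrow> y \<in> carrier (fob N X) \<Longrightarrow> component t X y = component s X y"
  shows "t = s"
proof -
  have nt: "is_natural C t" "is_natural C s" "nt_src t = N" "nt_src s = N" "nt_tgt t = nt_tgt s"
    using t by (auto simp: Mod_Hom_iff)
  have "component t X = component s X" for X
  proof (cases "X \<in> Ob C")
    case True
    then have "component t X \<in> extensional (carrier (fob N X))" "component s X \<in> extensional (carrier (fob N X))"
      using nt by (auto simp: is_natural_def)
    then show ?thesis using eq[OF True] by (rule extensionalityI)
  next
    case False
    then show ?thesis using nt unfolding is_natural_def extensional_def by auto
  qed
  then have "component t = component s" by blast
  then show ?thesis using nt by (intro nat_trans.equality) auto
qed

lemma Mod_comp_closed:
  assumes s: "s \<in> Hom (Mod_category C) N L" and t: "t \<in> Hom (Mod_category C) L K"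
  shows "cmps (Mod_category C) t s \<in> Hom (Mod_category C) N K"
    "\<And>X y. X \<in> Ob C \<Longrightarrow> y \<in> carrier (fob N X) \<Longrightarrow> component (cmps (Mod_category C) t s) X y = component t X (component s X y)"
proof -
  have st: "additive_presheaf C N" "additive_presheaf C L" "additive_presheaf C K" "nt_src s = N" "nt_tgt s = L" "nt_src t = L" "nt_tgt t = K"
    using s t by (auto simp: Mod_Hom_iff)
  have comp: "component (cmps (Mod_category C) t s) = (\<lambda>X\<in>Ob C. \<lambda>x\<in>carrier (fob N X). component t X (component s X x))"
    using st by (simp add: Mod_category_def)
  then show c: "component (cmps (Mod_category C) t s) X y = component t X (component s X y)"
    if "X \<in> Ob C" "y \<in> carrier (fob N X)" for X y using that by simp
  have "component (cmps (Mod_category C) t s) X \<in> hom (fob N X) (fob K X)" if X: "X \<in> Ob C" for X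
  proof (rule homI)
    interpret G: comm_group "fob N X" by (rule presheaf_group[OF st(1) X])
    show "component (cmps (Mod_category C) t s) X x \<in> carrier (fob K X)" if "x \<in> carrier (fob N X)" for x
      using that X s t by (simp add: c)
    show "component (cmps (Mod_category C) t s) X (x \<otimes>\<^bsub>fob N X\<^esub> y) =
      component (cmps (Mod_category C) t s) X x \<otimes>\<^bsub>fob K X\<^esub> component (cmps (Mod_category C) t s) X y"
      if "x \<in> carrier (fob N X)" "y \<in> carrier (fob N X)" for x y
      using that X s t by (simp add: c hom_mult[OF Mod_hom[OF s X]] hom_mult[OF Mod_hom[OF t X]])
  qed
  moreover have "component (cmps (Mod_category C) t s) (src C h) (farr N h x) = farr K h (component (cmps (Mod_category C) t s) (tgt C h) x)"
    if h: "h \<in> Arr C" "x \<in> carrier (fob N (tgt C h))" for h x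
  proof -
    have hH: "h \<in> Hom C (src C h) (tgt C h)" using h by (simp add: Hom_iff)
    show ?thesis using h hH st s t
      by (simp add: c Mod_natural[OF s hH] Mod_natural[OF t hH] presheaf_closed[OF st(1) hH])
  qed
  ultimately have "is_natural C (cmps (Mod_category C) t s)"
    unfolding is_natural_def using st comp by (auto simp: Mod_category_def)
  then show "cmps (Mod_category C) t s \<in> Hom (Mod_category C) N K"
    using st by (auto simp: Mod_Hom_iff) (simp_all add: Mod_category_def)
qed

lemma Mod_ident:
  assumes N: "additive_presheaf C N"
  shows "ident (Mod_category C) N \<in> Hom (Mod_category C) N N"
    "\<And>X y. X \<in> Ob C \<Longrightarrow> y \<in> carrier (fob N X) \<Longrightarrow> component (ident (Mod_category C) N) X y = y"
proof -
  show "component (ident (Mod_category C) N) X y = y" if "X \<in> Ob C" "y \<in> carrier (fob N X)" for X y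
    using that by (simp add: Mod_category_def)
  have "is_natural C (ident (Mod_category C) N)"
    unfolding is_natural_def
  proof (intro conjI ballI)
    fix X assume X: "X \<in> Ob C"
    interpret G: comm_group "fob N X" by (rule presheaf_group[OF N X])
    show "component (ident (Mod_category C) N) X \<in> hom (fob (nt_src (ident (Mod_category C) N)) X) (fob (nt_tgt (ident (Mod_category C) N)) X)"
      using X by (auto simp: Mod_category_def intro!: homI)
  next
    fix h x assume "h \<in> Arr C" "x \<in> carrier (fob (nt_src (ident (Mod_category C) N)) (tgt C h))"
    then show "component (ident (Mod_category C) N) (src C h) (farr (nt_src (ident (Mod_category C) N)) h x) =
       farr (nt_tgt (ident (Mod_category C) N)) h (component (ident (Mod_category C) N) (tgt C h) x)"
      using presheaf_closed[OF N, of h "src C h" "tgt C h" x] by (simp add: Mod_category_def Hom_iff)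
  qed (auto simp: Mod_category_def)
  then show "ident (Mod_category C) N \<in> Hom (Mod_category C) N N"
    using N by (auto simp: Mod_Hom_iff) (simp_all add: Mod_category_def)
qed

lemma Mod_zero:
  assumes N: "additive_presheaf C N" and L: "additive_presheaf C L"
  shows "hzero (Mod_category C) N L \<in> Hom (Mod_category C) N L"
    "\<And>X y. X \<in> Ob C \<Longrightarrow> y \<in> carrier (fob N X) \<Longrightarrow> component (hzero (Mod_category C) N L) X y = \<one>\<^bsub>fob L X\<^esub>"
proof -
  show "component (hzero (Mod_category C) N L) X y = \<one>\<^bsub>fob L X\<^esub>" if "X \<in> Ob C" "y \<in> carrier (fob N X)" for X y
    using that by (simp add: Mod_category_def)
  have "is_natural C (hzero (Mod_category C) N L)"
    unfolding is_natural_def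
  proof (intro conjI ballI)
    fix X assume X: "X \<in> Ob C"
    interpret G: comm_group "fob N X" by (rule presheaf_group[OF N X])
    interpret H: comm_group "fob L X" by (rule presheaf_group[OF L X])
    show "component (hzero (Mod_category C) N L) X \<in> hom (fob (nt_src (hzero (Mod_category C) N L)) X) (fob (nt_tgt (hzero (Mod_category C) N L)) X)"
      using X by (auto simp: Mod_category_def intro!: homI)
  next
    fix h x assume "h \<in> Arr C" "x \<in> carrier (fob (nt_src (hzero (Mod_category C) N L)) (tgt C h))"
    then show "component (hzero (Mod_category C) N L) (src C h) (farr (nt_src (hzero (Mod_category C) N L)) h x) =
       farr (nt_tgt (hzero (Mod_category C) N L)) h (component (hzero (Mod_category C) N L) (tgt C h) x)"
      using presheaf_closed[OF N, of h "src C h" "tgt C h" x] presheaf_one[OF L, of h "src C h" "tgt C h"]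
      by (simp add: Mod_category_def Hom_iff)
  qed (auto simp: Mod_category_def)
  then show "hzero (Mod_category C) N L \<in> Hom (Mod_category C) N L"
    using N L by (auto simp: Mod_Hom_iff) (simp_all add: Mod_category_def)
qed

text \<open>
  The Yoneda lemma: a natural transformation \<open>Hom(-, C) / im g \<rightarrow> L\<close> amounts to an element \<open>z\<close> of \<open>L\<close> over
  \<open>C\<close> that is annihilated by \<open>im g\<close>.  All natural transformations below are constructed in this way.
\<close>

lemma presents_map:
  assumes N: "presents N x g" and L: "additive_presheaf C L" and z: "z \<in> carrier (fob L (tgt C g))"
    and gz: "\<And>W h. h \<in> Hom C W (tgt C g) \<Longrightarrow> h \<in> hom_image C g W \<Longrightarrow> farr L h z = \<one>\<^bsub>fob L W\<^esub>"
  obtains t where "t \<in> Hom (Mod_category C) N L"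
    "\<And>W h. h \<in> Hom C W (tgt C g) \<Longrightarrow> component t W (farr N h x) = farr L h z"
proof -
  have Np: "additive_presheaf C N" and x: "x \<in> carrier (fob N (tgt C g))" and g: "g \<in> Arr C"
    using N by (auto simp: presents_def)
  define rep where "rep W y = (SOME h. h \<in> Hom C W (tgt C g) \<and> farr N h x = y)" for W y
  have rep: "rep W y \<in> Hom C W (tgt C g) \<and> farr N (rep W y) x = y" if "W \<in> Ob C" "y \<in> carrier (fob N W)" for W y
  proof -
    have "\<exists>h. h \<in> Hom C W (tgt C g) \<and> farr N h x = y" using presents_gen[OF N that] by blast
    then show ?thesis unfolding rep_def by (rule someI_ex)
  qed
  have wd: "farr L h z = farr L h' z" if hh: "h \<in> Hom C W (tgt C g)" "h' \<in> Hom C W (tgt C g)" "farr N h x = farr N h' x" for W h h'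
  proof -
    have W: "W \<in> Ob C" using Hom_Ob[OF hh(1)] by simp
    have d: "h \<boxminus> h' \<in> Hom C W (tgt C g)" using hh(1,2) by (simp add: Hom_iff)
    have "farr N (h \<boxminus> h') x = \<one>\<^bsub>fob N W\<^esub>" using presheaf_diff[OF Np hh(1,2) x] hh(3) by simp
    then have "h \<boxminus> h' \<in> hom_image C g W" using presents_ker[OF N d] by simp
    then have "farr L (h \<boxminus> h') z = \<one>\<^bsub>fob L W\<^esub>" using gz[OF d] by simp
    then show ?thesis using presheaf_diff[OF L hh(1,2) z] by simp
  qed
  define t where "t = \<lparr>nt_src = N, nt_tgt = L, component = (\<lambda>W\<in>Ob C. \<lambda>y\<in>carrier (fob N W). farr L (rep W y) z)\<rparr>"
  have comp: "component t W (farr N h x) = farr L h z" if h: "h \<in> Hom C W (tgt C g)" for W h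
  proof -
    have W: "W \<in> Ob C" using Hom_Ob[OF h] by simp
    have y: "farr N h x \<in> carrier (fob N W)" using presheaf_closed[OF Np h x] .
    have "component t W (farr N h x) = farr L (rep W (farr N h x)) z" using W y by (simp add: t_def)
    also have "\<dots> = farr L h z" using rep[OF W y] h by (intro wd) auto
    finally show ?thesis .
  qed
  have surj: "\<exists>h\<in>Hom C W (tgt C g). y = farr N h x" if "W \<in> Ob C" "y \<in> carrier (fob N W)" for W y
    using rep[OF that] by metis
  have "is_natural C t" unfolding is_natural_def
  proof (intro conjI ballI)
    fix X assume X: "X \<in> Ob C"
    have "component t X \<in> hom (fob N X) (fob L X)"
    proof (rule homI)
      fix y assume "y \<in> carrier (fob N X)"
      then obtain h where h: "h \<in> Hom C X (tgt C g)" "y = farr N h x" using surj X by blast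
      then show "component t X y \<in> carrier (fob L X)" using presheaf_closed[OF L h(1) z] by (simp add: comp)
      fix y' assume "y' \<in> carrier (fob N X)"
      then obtain h' where h': "h' \<in> Hom C X (tgt C g)" "y' = farr N h' x" using surj X by blast
      have "h \<boxplus> h' \<in> Hom C X (tgt C g)" using h(1) h'(1) by (simp add: Hom_iff)
      then show "component t X (y \<otimes>\<^bsub>fob N X\<^esub> y') = component t X y \<otimes>\<^bsub>fob L X\<^esub> component t X y'"
        using h h' by (simp add: presheaf_add[OF Np h(1) h'(1) x, symmetric] comp presheaf_add[OF L h(1) h'(1) z])
    qed
    then show "component t X \<in> hom (fob (nt_src t) X) (fob (nt_tgt t) X)" by (simp add: t_def)
  next
    fix k y assume k: "k \<in> Arr C" "y \<in> carrier (fob (nt_src t) (tgt C k))"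
    then have y: "y \<in> carrier (fob N (tgt C k))" by (simp add: t_def)
    then obtain h where h: "h \<in> Hom C (tgt C k) (tgt C g)" "y = farr N h x" using surj[OF _ y] k by auto
    have kH: "k \<in> Hom C (src C k) (tgt C k)" using k by (simp add: Hom_iff)
    have hk: "h \<cdot> k \<in> Hom C (src C k) (tgt C g)" using h k by (simp add: Hom_iff)
    have "component t (src C k) (farr N k y) = farr L k (component t (tgt C k) y)"
      unfolding h(2) by (simp add: presheaf_comp[OF Np kH h(1) x, symmetric] comp[OF hk] comp[OF h(1)] presheaf_comp[OF L kH h(1) z])
    then show "component t (src C k) (farr (nt_src t) k y) = farr (nt_tgt t) k (component t (tgt C k) y)"
      by (simp add: t_def)
  qed (auto simp: t_def)
  then have "t \<in> Hom (Mod_category C) N L" using Np L by (simp add: Mod_Hom_iff t_def)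
  with comp show ?thesis by (rule that[rotated])
qed

lemma presents_iso:
  assumes N: "presents N x g" and t: "t \<in> Hom (Mod_category C) N L" "s \<in> Hom (Mod_category C) L N"
    and inv: "cmps (Mod_category C) s t = ident (Mod_category C) N" "cmps (Mod_category C) t s = ident (Mod_category C) L"
  shows "presents L (component t (tgt C g) x) g"
proof -
  have Np: "additive_presheaf C N" and L: "additive_presheaf C L" and x: "x \<in> carrier (fob N (tgt C g))" and g [simp]: "g \<in> Arr C"
    using N t by (auto simp: presents_def Mod_Hom_iff)
  have st: "component s X (component t X y) = y" if "X \<in> Ob C" "y \<in> carrier (fob N X)" for X y
    using Mod_comp_closed(2)[OF t(1,2) that] Mod_ident(2)[OF Np that] inv(1) by simp
  have ts: "component t X (component s X y) = y" if "X \<in> Ob C" "y \<in> carrier (fob L X)" for X y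
    using Mod_comp_closed(2)[OF t(2,1) that] Mod_ident(2)[OF L that] inv(2) by simp
  show ?thesis unfolding presents_def
  proof (intro conjI ballI)
    show "component t (tgt C g) x \<in> carrier (fob L (tgt C g))" using t x by simp
    fix W assume W: "W \<in> Ob C"
    {
      fix y assume y: "y \<in> carrier (fob L W)"
      then have "component s W y \<in> carrier (fob N W)" using t(2) W by simp
      then obtain h where h: "h \<in> Hom C W (tgt C g)" "farr N h x = component s W y" using presents_gen[OF N W] by blast
      then have "farr L h (component t (tgt C g) x) = y" using Mod_natural[OF t(1) h(1) x] ts[OF W y] by simp
      then show "\<exists>h\<in>Hom C W (tgt C g). farr L h (component t (tgt C g) x) = y" using h by blast
    }
    fix h assume h: "h \<in> Hom C W (tgt C g)"
    have "farr L h (component t (tgt C g) x) = \<one>\<^bsub>fob L W\<^esub> \<longleftrightarrow> component t W (farr N h x) = component t W \<one>\<^bsub>fob N W\<^esub>"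
      using Mod_natural[OF t(1) h x] Mod_one[OF t(1) W] by simp
    also have "\<dots> \<longleftrightarrow> farr N h x = \<one>\<^bsub>fob N W\<^esub>"
    proof -
      interpret G: comm_group "fob N W" by (rule presheaf_group[OF Np W])
      show ?thesis using st[OF W presheaf_closed[OF Np h x]] st[OF W G.one_closed] by metis
    qed
    also have "\<dots> \<longleftrightarrow> h \<in> hom_image C g W" by (rule presents_ker[OF N h])
    finally show "farr L h (component t (tgt C g) x) = \<one>\<^bsub>fob L W\<^esub> \<longleftrightarrow> h \<in> hom_image C g W" .
  qed (auto simp: L)
qed

section \<open>The defect as a functor\<close>

definition image_coset :: "'b \<Rightarrow> 'a \<Rightarrow> 'b \<Rightarrow> 'b set" where
  "image_coset g X u = hom_image C g X #>\<^bsub>hom_group C X (tgt C g)\<^esub> u"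

context
  fixes g assumes g [simp]: "g \<in> Arr C"
begin

lemma hom_image_subgroup:
  assumes X: "X \<in> Ob C"
  shows "subgroup (hom_image C g X) (hom_group C X (tgt C g))"
proof -
  interpret G: comm_group "hom_group C X (tgt C g)" using X by (intro hom_comm_group) auto
  have inv: "inv\<^bsub>hom_group C X (tgt C g)\<^esub> u = hneg u" if "u \<in> hom_image C g X" for u
    using subsetD[OF hom_image_sub[OF g] that] by (auto simp: hneg_def Hom_iff)
  show ?thesis
    by (rule subgroup.intro)
      (use X hom_image_sub[OF g] in \<open>auto simp: inv hom_image_add hom_image_neg hom_image_zero\<close>)
qed

lemma image_coset_eq_iff:
  assumes u: "u \<in> Hom C X (tgt C g)" "v \<in> Hom C X (tgt C g)"
  shows "image_coset g X u = image_coset g X v \<longleftrightarrow> u \<boxminus> v \<in> hom_image C g X"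
proof -
  note [simp] = u[unfolded Hom_iff]
  have X: "X \<in> Ob C" using Hom_Ob[OF u(1)] by simp
  interpret G: comm_group "hom_group C X (tgt C g)" using X by (intro hom_comm_group) auto
  note sg = hom_image_subgroup[OF X]
  have "image_coset g X u = image_coset g X v \<longleftrightarrow> u \<in> image_coset g X v"
    using G.repr_independence[OF _ _ sg, of u v] G.rcos_self[OF _ sg, of u] u by (auto simp: image_coset_def)
  also have "\<dots> \<longleftrightarrow> (\<exists>k\<in>hom_image C g X. u = k \<boxplus> v)" by (auto simp: image_coset_def r_coset_def)
  also have "\<dots> \<longleftrightarrow> u \<boxminus> v \<in> hom_image C g X"
  proof
    assume "\<exists>k\<in>hom_image C g X. u = k \<boxplus> v"
    then obtain k where k: "k \<in> hom_image C g X" "u = k \<boxplus> v" by blast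
    then have "k \<in> Hom C X (tgt C g)" using hom_image_sub[OF g] by blast
    then have "u \<boxminus> v = k" unfolding k(2) by (simp add: Hom_iff)
    then show "u \<boxminus> v \<in> hom_image C g X" using k by simp
  next
    assume "u \<boxminus> v \<in> hom_image C g X"
    then show "\<exists>k\<in>hom_image C g X. u = k \<boxplus> v" by (intro bexI[of _ "u \<boxminus> v"]) simp
  qed
  finally show ?thesis .
qed

lemma image_coset_one_iff:
  assumes u: "u \<in> Hom C X (tgt C g)"
  shows "image_coset g X u = hom_image C g X \<longleftrightarrow> u \<in> hom_image C g X"
proof -
  have X: "X \<in> Ob C" using Hom_Ob[OF u(1)] by simp
  interpret G: comm_group "hom_group C X (tgt C g)" using X by (intro hom_comm_group) auto
  show ?thesis using G.coset_join1[OF _ _ hom_image_subgroup[OF X], of u] G.coset_join2[OF _ hom_image_subgroup[OF X], of u] u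
    by (auto simp: image_coset_def)
qed

lemma defect_carrier: "carrier (fob (defect C (f, g)) X) = image_coset g X ` Hom C X (tgt C g)"
  by (auto simp: defect_def carrier_FactGroup image_coset_def)

lemma defect_one: "\<one>\<^bsub>fob (defect C (f, g)) X\<^esub> = hom_image C g X"
  by (simp add: defect_def)

lemma defect_mult:
  assumes u: "u \<in> Hom C X (tgt C g)" "v \<in> Hom C X (tgt C g)"
  shows "image_coset g X u \<otimes>\<^bsub>fob (defect C (f, g)) X\<^esub> image_coset g X v = image_coset g X (u \<boxplus> v)"
proof -
  have X: "X \<in> Ob C" using Hom_Ob[OF u(1)] by simp
  interpret G: comm_group "hom_group C X (tgt C g)" using X by (intro hom_comm_group) auto
  interpret N: normal "hom_image C g X" "hom_group C X (tgt C g)"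
    by (rule G.subgroup_imp_normal[OF hom_image_subgroup[OF X]])
  show ?thesis using N.rcos_sum[of u v] u by (simp add: defect_def image_coset_def)
qed

lemma defect_farr:
  assumes h: "h \<in> Hom C W X" and u: "u \<in> Hom C X (tgt C g)"
  shows "farr (defect C (f, g)) h (image_coset g X u) = image_coset g W (u \<cdot> h)"
proof -
  note [simp] = u[unfolded Hom_iff] h[unfolded Hom_iff]
  have X: "X \<in> Ob C" using Hom_Ob[OF u(1)] by simp
  interpret G: comm_group "hom_group C X (tgt C g)" using X by (intro hom_comm_group) auto
  have const: "image_coset g W (v \<cdot> h) = image_coset g W (u \<cdot> h)" if v: "v \<in> image_coset g X u" for v
  proof -
    obtain k where k: "k \<in> hom_image C g X" "v = k \<boxplus> u" using v by (auto simp: image_coset_def r_coset_def)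
    have kH: "k \<in> Hom C X (tgt C g)" using k hom_image_sub[OF g] by blast
    note [simp] = kH[unfolded Hom_iff]
    have "v \<cdot> h \<boxminus> u \<cdot> h = k \<cdot> h" unfolding k(2) by simp
    then show ?thesis using hom_image_comp[OF g k(1) h] k(2) by (subst image_coset_eq_iff) (auto simp: Hom_iff)
  qed
  have self: "u \<in> image_coset g X u"
    using G.rcos_self[OF _ hom_image_subgroup[OF X], of u] by (simp add: image_coset_def Hom_iff)
  have "farr (defect C (f, g)) h (image_coset g X u) = (\<Union>v\<in>image_coset g X u. image_coset g W (v \<cdot> h))"
    by (simp add: defect_def image_coset_def)
  also have "\<dots> = image_coset g W (u \<cdot> h)" by (intro UN_constant_eq[OF self] ballI const)
  finally show ?thesis .
qed

lemma defect_presheaf: "additive_presheaf C (defect C (f, g))"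
  unfolding additive_presheaf_def
proof (intro conjI ballI impI)
  fix X assume X: "X \<in> Ob C"
  interpret G: comm_group "hom_group C X (tgt C g)" using X by (intro hom_comm_group) auto
  interpret N: normal "hom_image C g X" "hom_group C X (tgt C g)"
    by (rule G.subgroup_imp_normal[OF hom_image_subgroup[OF X]])
  interpret Q: group "fob (defect C (f, g)) X" using N.factorgroup_is_group by (simp add: defect_def)
  show "comm_group (fob (defect C (f, g)) X)"
  proof (rule Q.group_comm_groupI)
    fix x y assume "x \<in> carrier (fob (defect C (f, g)) X)" "y \<in> carrier (fob (defect C (f, g)) X)"
    then obtain u v where "u \<in> Hom C X (tgt C g)" "v \<in> Hom C X (tgt C g)" "x = image_coset g X u" "y = image_coset g X v"
      by (auto simp: defect_carrier)
    then show "x \<otimes>\<^bsub>fob (defect C (f, g)) X\<^esub> y = y \<otimes>\<^bsub>fob (defect C (f, g)) X\<^esub> x"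
      using add_comm[of u v] by (simp add: defect_mult Hom_iff)
  qed
  fix x assume "x \<in> carrier (fob (defect C (f, g)) X)"
  then obtain u where u: "u \<in> Hom C X (tgt C g)" "x = image_coset g X u" by (auto simp: defect_carrier)
  then show "farr (defect C (f, g)) (ident C X) x = x"
    using defect_farr[of "ident C X" X X u] X by (simp add: Hom_iff)
next
  fix h assume h: "h \<in> Arr C"
  then have hH: "h \<in> Hom C (src C h) (tgt C h)" by (simp add: Hom_iff)
  show "farr (defect C (f, g)) h \<in> hom (fob (defect C (f, g)) (tgt C h)) (fob (defect C (f, g)) (src C h))"
  proof (rule homI)
    fix x assume "x \<in> carrier (fob (defect C (f, g)) (tgt C h))"
    then obtain u where u: "u \<in> Hom C (tgt C h) (tgt C g)" "x = image_coset g (tgt C h) u" by (auto simp: defect_carrier)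
    have uh: "u \<cdot> h \<in> Hom C (src C h) (tgt C g)" using u(1) h by (simp add: Hom_iff)
    then show "farr (defect C (f, g)) h x \<in> carrier (fob (defect C (f, g)) (src C h))"
      using defect_farr[OF hH u(1)] u(2) by (simp add: defect_carrier)
    fix y assume "y \<in> carrier (fob (defect C (f, g)) (tgt C h))"
    then obtain v where v: "v \<in> Hom C (tgt C h) (tgt C g)" "y = image_coset g (tgt C h) v" by (auto simp: defect_carrier)
    have vh: "v \<cdot> h \<in> Hom C (src C h) (tgt C g)" using v(1) h by (simp add: Hom_iff)
    have uv: "u \<boxplus> v \<in> Hom C (tgt C h) (tgt C g)" using u(1) v(1) by (simp add: Hom_iff)
    have d: "(u \<boxplus> v) \<cdot> h = u \<cdot> h \<boxplus> v \<cdot> h" using u(1) v(1) h by (simp add: Hom_iff)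
    show "farr (defect C (f, g)) h (x \<otimes>\<^bsub>fob (defect C (f, g)) (tgt C h)\<^esub> y) =
      farr (defect C (f, g)) h x \<otimes>\<^bsub>fob (defect C (f, g)) (src C h)\<^esub> farr (defect C (f, g)) h y"
      unfolding u(2) v(2) defect_mult[OF u(1) v(1)] defect_farr[OF hH u(1)] defect_farr[OF hH v(1)] defect_farr[OF hH uv]
        defect_mult[OF uh vh] d ..
  qed
next
  fix h k x assume hk: "h \<in> Arr C" "k \<in> Arr C" "tgt C h = src C k" "x \<in> carrier (fob (defect C (f, g)) (tgt C k))"
  then obtain u where u: "u \<in> Hom C (tgt C k) (tgt C g)" "x = image_coset g (tgt C k) u" by (auto simp: defect_carrier)
  then show "farr (defect C (f, g)) (k \<cdot> h) x = farr (defect C (f, g)) h (farr (defect C (f, g)) k x)"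
    using hk(1-3) defect_farr[of "k \<cdot> h" "src C h" "tgt C k" u] defect_farr[of k "src C k" "tgt C k" u]
      defect_farr[of h "src C h" "src C k" "u \<cdot> k"] by (simp add: Hom_iff)
next
  fix X Y h k x assume hk: "h \<in> Hom C X Y" "k \<in> Hom C X Y" "x \<in> carrier (fob (defect C (f, g)) Y)"
  then obtain u where u: "u \<in> Hom C Y (tgt C g)" "x = image_coset g Y u" by (auto simp: defect_carrier)
  have H: "u \<cdot> h \<in> Hom C X (tgt C g)" "u \<cdot> k \<in> Hom C X (tgt C g)" "h \<boxplus> k \<in> Hom C X Y" "u \<cdot> (h \<boxplus> k) = u \<cdot> h \<boxplus> u \<cdot> k"
    using u(1) hk by (auto simp: Hom_iff)
  show "farr (defect C (f, g)) (h \<boxplus> k) x = farr (defect C (f, g)) h x \<otimes>\<^bsub>fob (defect C (f, g)) X\<^esub> farr (defect C (f, g)) k x"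
    unfolding u(2) defect_farr[OF hk(1) u(1)] defect_farr[OF hk(2) u(1)] defect_farr[OF H(3) u(1)] H(4) defect_mult[OF H(1,2)] ..
qed

lemma defect_presents: "presents (defect C (f, g)) (image_coset g (tgt C g) (ident C (tgt C g))) g"
proof -
  have i: "ident C (tgt C g) \<in> Hom C (tgt C g) (tgt C g)" by (simp add: Hom_iff)
  have f: "farr (defect C (f, g)) h (image_coset g (tgt C g) (ident C (tgt C g))) = image_coset g W h"
    if "h \<in> Hom C W (tgt C g)" for h W
    using defect_farr[OF that i] that by (simp add: Hom_iff)
  show ?thesis unfolding presents_def
    using i by (auto simp: defect_presheaf defect_carrier f defect_one image_coset_one_iff)
qed

end

end

section \<open>Monomorphisms, cokernels and simple objects of eff\<close>

context exact_structure
begin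

lemma eff_sel [simp]:
  "src (eff A E) = nt_src" "tgt (eff A E) = nt_tgt" "cmps (eff A E) = cmps (Mod_category A)"
  "ident (eff A E) = ident (Mod_category A)" "hzero (eff A E) = hzero (Mod_category A)"
  by (simp_all add: eff_def full_subcategory_def Mod_category_def)

lemma eff_Ob: "F \<in> Ob (eff A E) \<longleftrightarrow> additive_presheaf A F \<and> (\<exists>\<delta>\<in>E. isomorphic (Mod_category A) F (defect A \<delta>))"
  by (simp add: eff_def full_subcategory_def)

lemma eff_Arr: "t \<in> Arr (eff A E) \<longleftrightarrow> t \<in> Hom (Mod_category A) (nt_src t) (nt_tgt t) \<and> nt_src t \<in> Ob (eff A E) \<and> nt_tgt t \<in> Ob (eff A E)"
  by (auto simp: eff_def full_subcategory_def Mod_Hom_iff)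

lemma eff_Hom: "t \<in> Hom (eff A E) N L \<longleftrightarrow> t \<in> Hom (Mod_category A) N L \<and> N \<in> Ob (eff A E) \<and> L \<in> Ob (eff A E)"
  by (auto simp: Hom_iff eff_Arr)

lemma defect_eff:
  assumes "(f, g) \<in> E" shows "defect A (f, g) \<in> Ob (eff A E)"
proof -
  have g: "g \<in> Arr A" using conflation_Arr[OF assms] by simp
  note p = defect_presheaf[OF g, of f]
  have "is_iso (Mod_category A) (ident (Mod_category A) (defect A (f, g)))"
    unfolding is_iso_def
    using Mod_ident[OF p] Mod_comp_closed[OF Mod_ident(1)[OF p] Mod_ident(1)[OF p]] p
    by (auto simp: Mod_Hom_iff intro!: bexI[of _ "ident (Mod_category A) (defect A (f, g))"]
        Mod_eqI[of _ "defect A (f, g)" "defect A (f, g)"])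
  then have "isomorphic (Mod_category A) (defect A (f, g)) (defect A (f, g))"
    unfolding isomorphic_def using Mod_ident(1)[OF p] by blast
  then show ?thesis using p assms by (auto simp: eff_Ob)
qed

lemma eff_presents:
  assumes "N \<in> Ob (eff A E)"
  obtains x g where "presents N x g" "g \<in> snd ` E"
proof -
  obtain f g where fg: "(f, g) \<in> E" and i: "isomorphic (Mod_category A) N (defect A (f, g))"
    using assms by (auto simp: eff_Ob)
  have g: "g \<in> Arr A" using conflation_Arr[OF fg] by simp
  obtain t where t: "t \<in> Hom (Mod_category A) N (defect A (f, g))" "is_iso (Mod_category A) t"
    using i by (auto simp: isomorphic_def)
  then obtain s where s: "s \<in> Hom (Mod_category A) (defect A (f, g)) N"
    "cmps (Mod_category A) s t = ident (Mod_category A) N" "cmps (Mod_category A) t s = ident (Mod_category A) (defect A (f, g))"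
    by (auto simp: is_iso_def Mod_Hom_iff)
  have "presents N (component s (tgt A g) (image_coset g (tgt A g) (ident A (tgt A g)))) g"
    by (rule presents_iso[OF defect_presents[OF g] s(1) t(1) s(3,2)])
  then show ?thesis using that fg by force
qed

lemma presents_pullback:
  assumes N: "presents N x g" and g: "g \<in> snd ` E" and a: "a \<in> Hom A W (tgt A g)"
  obtains g' a' where "is_pullback A g a g' a'" "g' \<in> snd ` E" "tgt A g' = W"
    "\<And>V h. h \<in> Hom A V W \<Longrightarrow> h \<in> hom_image A g' V \<longleftrightarrow> farr N h (farr N a x) = \<one>\<^bsub>fob N V\<^esub>"
proof -
  note [simp] = a[unfolded Hom_iff]
  have Np: "additive_presheaf A N" and x: "x \<in> carrier (fob N (tgt A g))"
    using N by (auto simp: presents_def)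
  obtain g' a' where g': "is_pullback A g a g' a'" "g' \<in> snd ` E"
    using deflation_pullback[OF g, of a] by auto
  have t: "tgt A g' = W" using pullbackD[OF g'(1)] by simp
  have "h \<in> hom_image A g' V \<longleftrightarrow> farr N h (farr N a x) = \<one>\<^bsub>fob N V\<^esub>" if h: "h \<in> Hom A V W" for V h
  proof -
    have V: "V \<in> Ob A" using Hom_Ob[OF h] by simp
    have ah: "a \<cdot> h \<in> Hom A V (tgt A g)" using h by (simp add: Hom_iff)
    have "h \<in> hom_image A g' V \<longleftrightarrow> a \<cdot> h \<in> hom_image A g V" using h by (simp add: pullback_hom_image[OF g'(1)])
    also have "\<dots> \<longleftrightarrow> farr N (a \<cdot> h) x = \<one>\<^bsub>fob N V\<^esub>" by (rule presents_ker[OF N ah, symmetric])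
    also have "farr N (a \<cdot> h) x = farr N h (farr N a x)" by (rule presheaf_comp[OF Np h a x])
    finally show ?thesis .
  qed
  then show ?thesis using that g' t by blast
qed

text \<open>
  The subobject generated by \<open>y\<close>, with \<open>y\<close> the class of \<open>a\<close>, is the defect of the pullback of \<open>g\<close> along \<open>a\<close>;
  in particular it lies in \<open>eff E\<close>.
\<close>

lemma generated_subobject:
  assumes N: "N \<in> Ob (eff A E)" and W: "W \<in> Ob A" and y: "y \<in> carrier (fob N W)"
  obtains D t c where "t \<in> Hom (eff A E) D N" "c \<in> carrier (fob D W)" "component t W c = y"
    "\<And>V d. V \<in> Ob A \<Longrightarrow> d \<in> carrier (fob D V) \<Longrightarrow> \<exists>h\<in>Hom A V W. d = farr D h c"
    "\<And>V. V \<in> Ob A \<Longrightarrow> inj_on (component t V) (carrier (fob D V))"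
proof -
  have Np: "additive_presheaf A N" using N by (simp add: eff_Ob)
  obtain x g where x: "presents N x g" "g \<in> snd ` E" using eff_presents[OF N] by blast
  obtain a where a: "a \<in> Hom A W (tgt A g)" "y = farr N a x" using presents_gen[OF x(1) W y] by blast
  obtain g' a' where g': "g' \<in> snd ` E" "tgt A g' = W"
    and im: "\<And>V h. h \<in> Hom A V W \<Longrightarrow> h \<in> hom_image A g' V \<longleftrightarrow> farr N h y = \<one>\<^bsub>fob N V\<^esub>"
    using presents_pullback[OF x a(1)] a(2) by metis
  obtain f' where f': "(f', g') \<in> E" using g' by auto
  define D where "D = defect A (f', g')"
  define c where "c = image_coset g' (tgt A g') (ident A (tgt A g'))"
  have gA: "g' \<in> Arr A" using deflation_Arr[OF g'(1)] .
  have D: "presents D c g'" unfolding D_def c_def by (rule defect_presents[OF gA])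
  then have Dp: "additive_presheaf A D" and c: "c \<in> carrier (fob D W)"
    and gen: "\<And>V d. V \<in> Ob A \<Longrightarrow> d \<in> carrier (fob D V) \<Longrightarrow> \<exists>h\<in>Hom A V W. farr D h c = d"
    using g'(2) presents_gen[OF D] by (auto simp: presents_def)
  have De: "D \<in> Ob (eff A E)" unfolding D_def by (rule defect_eff[OF f'])
  obtain t where t: "t \<in> Hom (Mod_category A) D N" "\<And>V h. h \<in> Hom A V W \<Longrightarrow> component t V (farr D h c) = farr N h y"
    using presents_map[OF D Np, of y] y im g'(2) by metis
  have iW: "ident A W \<in> Hom A W W" using W by (simp add: Hom_iff)
  have "component t W c = y"
    using t(2)[OF iW] presheaf_ident[OF Dp W c] presheaf_ident[OF Np W y] by simp
  moreover have "inj_on (component t V) (carrier (fob D V))" if V: "V \<in> Ob A" for V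
  proof (rule inj_onI)
    fix d e assume de: "d \<in> carrier (fob D V)" "e \<in> carrier (fob D V)" "component t V d = component t V e"
    obtain h k where hk: "h \<in> Hom A V W" "d = farr D h c" "k \<in> Hom A V W" "e = farr D k c" using gen[OF V] de(1,2) by metis
    have s: "h \<boxminus> k \<in> Hom A V W" using hk by (simp add: Hom_iff)
    have "farr N h y = farr N k y" using de(3) hk t(2) by simp
    then have "farr N (h \<boxminus> k) y = \<one>\<^bsub>fob N V\<^esub>" using presheaf_diff[OF Np hk(1,3) y] by simp
    then have "h \<boxminus> k \<in> hom_image A g' V" using im[OF s] by simp
    then have "farr D (h \<boxminus> k) c = \<one>\<^bsub>fob D V\<^esub>" using presents_ker[OF D, of "h \<boxminus> k" V] s g'(2) by simp
    then show "d = e" using presheaf_diff[OF Dp hk(1,3) c] hk by simp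
  qed
  ultimately show ?thesis using that[of t D c] t(1) N De c gen by (simp add: eff_Hom) metis
qed

text \<open>
  Were \<open>y\<close> a nonzero element of the pointwise kernel, then the subobject generated by \<open>y\<close> would have
  two different maps to the source of \<open>j\<close>, the inclusion and zero, with equal composites.
\<close>

lemma eff_mono_injective:
  assumes j: "is_mono (eff A E) j" and W: "W \<in> Ob A"
    and y: "y \<in> carrier (fob (nt_src j) W)" "component j W y = \<one>\<^bsub>fob (nt_tgt j) W\<^esub>"
  shows "y = \<one>\<^bsub>fob (nt_src j) W\<^esub>"
proof -
  let ?N = "nt_src j" and ?L = "nt_tgt j"
  have jA: "j \<in> Hom (Mod_category A) ?N ?L" and NL: "?N \<in> Ob (eff A E)" "?L \<in> Ob (eff A E)"
    using j by (auto simp: is_mono_def eff_Arr)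
  have Np: "additive_presheaf A ?N" and Lp: "additive_presheaf A ?L" using NL by (auto simp: eff_Ob)
  obtain D t c where t: "t \<in> Hom (eff A E) D ?N" "c \<in> carrier (fob D W)" "component t W c = y"
    "\<And>V d. V \<in> Ob A \<Longrightarrow> d \<in> carrier (fob D V) \<Longrightarrow> \<exists>h\<in>Hom A V W. d = farr D h c"
    using generated_subobject[OF NL(1) W y(1)] by metis
  have tM: "t \<in> Hom (Mod_category A) D ?N" and De: "D \<in> Ob (eff A E)" using t(1) by (auto simp: eff_Hom)
  have Dp: "additive_presheaf A D" using De by (simp add: eff_Ob)
  note z = Mod_zero[OF Dp Np]
  have zE: "hzero (Mod_category A) D ?N \<in> Hom (eff A E) D ?N" using z(1) De NL by (simp add: eff_Hom)
  have "cmps (Mod_category A) j t = cmps (Mod_category A) j (hzero (Mod_category A) D ?N)"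
  proof (rule Mod_eqI[OF Mod_comp_closed(1)[OF tM jA] Mod_comp_closed(1)[OF z(1) jA]])
    fix X d assume X: "X \<in> Ob A" and d: "d \<in> carrier (fob D X)"
    obtain h where h: "h \<in> Hom A X W" "d = farr D h c" using t(4)[OF X d] by blast
    have "component j X (component t X d) = \<one>\<^bsub>fob ?L X\<^esub>"
      using Mod_natural[OF tM h(1) t(2)] Mod_natural[OF jA h(1) y(1)] y(2) presheaf_one[OF Lp h(1)] t(3) h(2) by simp
    also have "\<dots> = component j X (component (hzero (Mod_category A) D ?N) X d)"
      using z(2)[OF X d] Mod_one[OF jA X] by simp
    finally show "component (cmps (Mod_category A) j t) X d = component (cmps (Mod_category A) j (hzero (Mod_category A) D ?N)) X d"
      using Mod_comp_closed(2)[OF tM jA X d] Mod_comp_closed(2)[OF z(1) jA X d] by simp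
  qed
  then have "t = hzero (Mod_category A) D ?N"
    using j t(1) zE De unfolding is_mono_def by simp
  then show ?thesis using t(3) z(2)[OF W t(2)] by simp
qed

lemma eff_zero_object:
  assumes N: "zero_object (eff A E) N" and X: "X \<in> Ob A" "y \<in> carrier (fob N X)"
  shows "y = \<one>\<^bsub>fob N X\<^esub>"
proof -
  have Ne: "N \<in> Ob (eff A E)" using N by (simp add: zero_object_def)
  then have Np: "additive_presheaf A N" by (simp add: eff_Ob)
  have "ident (Mod_category A) N \<in> Hom (eff A E) N N" "hzero (Mod_category A) N N \<in> Hom (eff A E) N N"
    using Mod_ident(1)[OF Np] Mod_zero(1)[OF Np Np] Ne by (auto simp: eff_Hom)
  then have "ident (Mod_category A) N = hzero (Mod_category A) N N"
    using N Ne unfolding zero_object_def by blast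
  then show ?thesis using Mod_ident(2)[OF Np X] Mod_zero(2)[OF Np Np X] by simp
qed

text \<open>
  The subobject generated by \<open>s\<close> is not zero, so its inclusion is an isomorphism.
\<close>

lemma simple_generated:
  assumes S: "simple_object (eff A E) S" and W: "W \<in> Ob A" and s: "s \<in> carrier (fob S W)" "s \<noteq> \<one>\<^bsub>fob S W\<^esub>"
    and V: "V \<in> Ob A" "s' \<in> carrier (fob S V)"
  shows "\<exists>h\<in>Hom A V W. farr S h s = s'"
proof -
  have Se: "S \<in> Ob (eff A E)" using S by (simp add: simple_object_def)
  obtain D t c where t: "t \<in> Hom (eff A E) D S" "c \<in> carrier (fob D W)" "component t W c = s"
    and gen: "\<And>V d. V \<in> Ob A \<Longrightarrow> d \<in> carrier (fob D V) \<Longrightarrow> \<exists>h\<in>Hom A V W. d = farr D h c"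
    and inj: "\<And>V. V \<in> Ob A \<Longrightarrow> inj_on (component t V) (carrier (fob D V))"
    using generated_subobject[OF Se W s(1)] by metis
  have tM: "t \<in> Hom (Mod_category A) D S" and De: "D \<in> Ob (eff A E)" using t(1) by (auto simp: eff_Hom)
  have Dp: "additive_presheaf A D" and Sp: "additive_presheaf A S" using De Se by (simp_all add: eff_Ob)
  have tst: "nt_src t = D" "nt_tgt t = S" using tM by (auto simp: Mod_Hom_iff)
  have "is_mono (eff A E) t"
    unfolding is_mono_def
  proof (intro conjI ballI impI)
    show "t \<in> Arr (eff A E)" using t(1) by (simp add: Hom_iff)
    fix K h k assume hk: "h \<in> Hom (eff A E) K (src (eff A E) t)" "k \<in> Hom (eff A E) K (src (eff A E) t)"
      "cmps (eff A E) t h = cmps (eff A E) t k"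
    then have M: "h \<in> Hom (Mod_category A) K D" "k \<in> Hom (Mod_category A) K D"
      "cmps (Mod_category A) t h = cmps (Mod_category A) t k"
      using tst by (auto simp: eff_Hom)
    show "h = k"
    proof (rule Mod_eqI[OF M(1,2)])
      fix X y assume X: "X \<in> Ob A" and y: "y \<in> carrier (fob K X)"
      have "component t X (component h X y) = component t X (component k X y)"
        using Mod_comp_closed(2)[OF M(1) tM X y] Mod_comp_closed(2)[OF M(2) tM X y] M(3) by simp
      then show "component h X y = component k X y"
        using inj[OF X] M(1,2) X y by (meson Mod_closed inj_onD)
    qed
  qed
  moreover have "\<not> zero_object (eff A E) D"
  proof
    assume "zero_object (eff A E) D"
    then have "c = \<one>\<^bsub>fob D W\<^esub>" using W t(2) by (rule eff_zero_object)
    then show False using Mod_one[OF tM W] t(3) s(2) by simp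
  qed
  ultimately have "is_iso (eff A E) t" using S tst unfolding simple_object_def by auto
  then obtain r where r: "r \<in> Hom (eff A E) S D" "cmps (Mod_category A) t r = ident (Mod_category A) S"
    using tst by (auto simp: is_iso_def)
  have rM: "r \<in> Hom (Mod_category A) S D" using r(1) by (simp add: eff_Hom)
  obtain h where h: "h \<in> Hom A V W" "component r V s' = farr D h c" using gen[OF V(1) Mod_closed[OF rM V]] by blast
  have "s' = component t V (component r V s')"
    using Mod_comp_closed(2)[OF rM tM V] r(2) Mod_ident(2)[OF Sp V] by simp
  also have "\<dots> = farr S h s" using h Mod_natural[OF tM h(1) t(2)] t(3) by simp
  finally show ?thesis using h(1) by metis
qed

text \<open>
  Let \<open>Y\<close> be a subobject of \<open>N = Hom(-, C) / im g\<close> with simple quotient \<open>S\<close>, and let the generator \<open>y\<close> of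
  \<open>Y\<close> be the class of \<open>a : X \<rightarrow> C\<close>.  The pointwise cokernel of \<open>j\<close> is the defect of \<open>G = (g, a)\<close>, which
  belongs to \<open>eff E\<close>; therefore it factors through \<open>p\<close>, and the pointwise kernel of \<open>p\<close> is the image of
  \<open>j\<close>.  Now the simplicity of \<open>S\<close> says that \<open>G\<close> has simple defect, and the injectivity of \<open>j\<close> says that
  \<open>Y\<close> is the defect of the pullback of \<open>g\<close> along \<open>a\<close>.
\<close>

lemma composition_step:
  assumes j: "j \<in> Hom (eff A E) Y N" "is_mono (eff A E) j"
    and p: "is_cokernel (eff A E) p j" "simple_object (eff A E) (tgt (eff A E) p)"
    and N: "presents N x g" "g \<in> snd ` E"
  obtains a G g' a' y where "G \<in> snd ` E" "adjoined A g a G" "simple_defect A G" "is_pullback A g a g' a'" "g' \<in> snd ` E"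
    "presents Y y g'"
proof -
  define S where "S = nt_tgt p"
  have jM: "j \<in> Hom (Mod_category A) Y N" and Ye: "Y \<in> Ob (eff A E)" and Ne: "N \<in> Ob (eff A E)"
    using j(1) by (auto simp: eff_Hom)
  have jst: "nt_src j = Y" "nt_tgt j = N" using jM by (auto simp: Mod_Hom_iff)
  have "p \<in> Arr (eff A E)" "nt_src p = N" using p(1) jst by (auto simp: is_cokernel_def)
  then have pM: "p \<in> Hom (Mod_category A) N S" and Se: "S \<in> Ob (eff A E)" by (auto simp: eff_Arr S_def)
  have pj: "cmps (Mod_category A) p j = hzero (Mod_category A) Y S" using p(1) jst by (simp add: is_cokernel_def S_def)
  have cok: "\<exists>!k. k \<in> Hom (eff A E) S W \<and> cmps (Mod_category A) k p = h"
    if "W \<in> Ob (eff A E)" "h \<in> Hom (eff A E) N W" "cmps (Mod_category A) h j = hzero (Mod_category A) Y W" for W h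
    using p(1) jst that unfolding is_cokernel_def by (simp add: S_def)
  have S: "simple_object (eff A E) S" using p(2) by (simp add: S_def)
  have Np: "additive_presheaf A N" and Yp: "additive_presheaf A Y" and Sp: "additive_presheaf A S"
    using Ne Ye Se by (simp_all add: eff_Ob)
  have x: "x \<in> carrier (fob N (tgt A g))" and gA [simp]: "g \<in> Arr A" using N(1) by (auto simp: presents_def)
  have gen: "\<And>W z. W \<in> Ob A \<Longrightarrow> z \<in> carrier (fob N W) \<Longrightarrow> \<exists>h\<in>Hom A W (tgt A g). farr N h x = z"
    and ker: "\<And>W h. h \<in> Hom A W (tgt A g) \<Longrightarrow> farr N h x = \<one>\<^bsub>fob N W\<^esub> \<longleftrightarrow> h \<in> hom_image A g W"
    using presents_gen[OF N(1)] presents_ker[OF N(1)] by blast+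
  obtain y g0 where y0: "presents Y y g0" "g0 \<in> snd ` E" using eff_presents[OF Ye] by blast
  define X where "X = tgt A g0"
  have X: "X \<in> Ob A" using deflation_Arr[OF y0(2)] by (simp add: X_def)
  have y: "y \<in> carrier (fob Y X)" using y0 by (simp add: presents_def X_def)
  obtain a where a: "a \<in> Hom A X (tgt A g)" "farr N a x = component j X y" using gen[OF X] Mod_closed[OF jM X y] by blast
  note aA = a(1)[unfolded Hom_iff]
  obtain G where G: "G \<in> snd ` E" "adjoined A g a G" using adjoin_deflation[OF N(2), of a] aA by auto
  have GA [simp]: "G \<in> Arr A" "tgt A G = tgt A g" using G(2) by (auto simp: adjoined_def)
  \<comment> \<open>Forwards, because the pointwise cokernel \<open>q\<close> of \<open>j\<close> factors through \<open>p\<close>; backwards, by \<open>p j = 0\<close>.\<close>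
  have pG: "component p W (farr N h x) = \<one>\<^bsub>fob S W\<^esub> \<longleftrightarrow> h \<in> hom_image A G W" if h: "h \<in> Hom A W (tgt A g)" for W h
  proof
    have W: "W \<in> Ob A" using Hom_Ob[OF h] by simp
    assume h1: "component p W (farr N h x) = \<one>\<^bsub>fob S W\<^esub>"
    obtain fG where fG: "(fG, G) \<in> E" using G(1) by auto
    define Q where "Q = defect A (fG, G)"
    define c where "c = image_coset G (tgt A G) (ident A (tgt A G))"
    have Q: "presents Q c G" unfolding Q_def c_def by (rule defect_presents) simp
    have Qe: "Q \<in> Ob (eff A E)" unfolding Q_def by (rule defect_eff[OF fG])
    have Qp: "additive_presheaf A Q" and c: "c \<in> carrier (fob Q (tgt A g))" using Q by (auto simp: presents_def)
    have kerQ: "farr Q k c = \<one>\<^bsub>fob Q V\<^esub> \<longleftrightarrow> k \<in> hom_image A G V" if "k \<in> Hom A V (tgt A g)" for k V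
      using presents_ker[OF Q, of k V] that by simp
    obtain q where q: "q \<in> Hom (Mod_category A) N Q" "\<And>V k. k \<in> Hom A V (tgt A g) \<Longrightarrow> component q V (farr N k x) = farr Q k c"
    proof (rule presents_map[OF N(1) Qp c])
      fix V k assume k: "k \<in> Hom A V (tgt A g)" "k \<in> hom_image A g V"
      then have "k \<in> hom_image A G V" using adjoined_subset[OF G(2)] Hom_Ob[OF k(1)] by blast
      then show "farr Q k c = \<one>\<^bsub>fob Q V\<^esub>" using kerQ[OF k(1)] by simp
    qed blast
    have "cmps (Mod_category A) q j = hzero (Mod_category A) Y Q"
    proof (rule Mod_eqI[OF Mod_comp_closed(1)[OF jM q(1)] Mod_zero(1)[OF Yp Qp]])
      fix V z assume V: "V \<in> Ob A" and z: "z \<in> carrier (fob Y V)"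
      obtain m where m: "m \<in> Hom A V X" "farr Y m y = z" using presents_gen[OF y0(1) V z] by (auto simp: X_def)
      have am: "a \<cdot> m \<in> Hom A V (tgt A g)" using a(1) m(1) by (simp add: Hom_iff)
      have "component j V z = farr N m (farr N a x)" using m a Mod_natural[OF jM m(1) y] by simp
      also have "\<dots> = farr N (a \<cdot> m) x" by (rule presheaf_comp[OF Np m(1) a(1) x, symmetric])
      finally have "component q V (component j V z) = farr Q (a \<cdot> m) c" using q(2)[OF am] by simp
      moreover have "a \<cdot> m \<in> hom_image A G V"
        unfolding adjoined_hom_image[OF G(2) V] using am m(1) aA hom_image_zero[OF gA V] V
        by (intro bexI[of _ "hzero A V (tgt A g)"] bexI[of _ m]) (auto simp: Hom_iff)
      ultimately show "component (cmps (Mod_category A) q j) V z = component (hzero (Mod_category A) Y Q) V z"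
        using kerQ[OF am] Mod_comp_closed(2)[OF jM q(1) V z] Mod_zero(2)[OF Yp Qp V z] by simp
    qed
    moreover have "q \<in> Hom (eff A E) N Q" using q(1) Qe Ne by (simp add: eff_Hom)
    ultimately have "\<exists>r. r \<in> Hom (eff A E) S Q \<and> cmps (Mod_category A) r p = q"
      using cok Qe by blast
    then obtain r where r: "r \<in> Hom (Mod_category A) S Q" "cmps (Mod_category A) r p = q" by (auto simp: eff_Hom)
    have nh: "farr N h x \<in> carrier (fob N W)" by (rule presheaf_closed[OF Np h x])
    have "component q W (farr N h x) = \<one>\<^bsub>fob Q W\<^esub>"
      using Mod_comp_closed(2)[OF pM r(1) W nh] r(2) h1 Mod_one[OF r(1) W] by simp
    then show "h \<in> hom_image A G W" using q(2)[OF h] kerQ[OF h] by simp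
  next
    have W: "W \<in> Ob A" using Hom_Ob[OF h] by simp
    assume "h \<in> hom_image A G W"
    then obtain u m where um: "u \<in> hom_image A g W" "m \<in> Hom A W X" "h = u \<boxplus> a \<cdot> m"
      using adjoined_hom_image[OF G(2) W] aA by auto
    have u: "u \<in> Hom A W (tgt A g)" using um(1) hom_image_sub[of g] by auto
    have am: "a \<cdot> m \<in> Hom A W (tgt A g)" using a(1) um(2) by (simp add: Hom_iff)
    interpret GN: comm_group "fob N W" by (rule presheaf_group[OF Np W])
    have "farr N h x = farr N u x \<otimes>\<^bsub>fob N W\<^esub> farr N (a \<cdot> m) x" unfolding um(3) by (rule presheaf_add[OF Np u am x])
    also have "farr N u x = \<one>\<^bsub>fob N W\<^esub>" using ker[OF u] um(1) by simp
    also have "farr N (a \<cdot> m) x = farr N m (farr N a x)" by (rule presheaf_comp[OF Np um(2) a(1) x])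
    also have "\<dots> = component j W (farr Y m y)" using a(2) Mod_natural[OF jM um(2) y] by simp
    also have "\<one>\<^bsub>fob N W\<^esub> \<otimes>\<^bsub>fob N W\<^esub> component j W (farr Y m y) = component j W (farr Y m y)"
      using Mod_closed[OF jM W presheaf_closed[OF Yp um(2) y]] by simp
    finally show "component p W (farr N h x) = \<one>\<^bsub>fob S W\<^esub>"
      using Mod_comp_closed(2)[OF jM pM W presheaf_closed[OF Yp um(2) y]] pj
        Mod_zero(2)[OF Yp Sp W presheaf_closed[OF Yp um(2) y]] by simp
  qed
  have id: "ident A (tgt A g) \<in> Hom A (tgt A g) (tgt A g)" by (simp add: Hom_iff)
  have px: "component p (tgt A g) x \<in> carrier (fob S (tgt A g))" using Mod_closed[OF pM _ x] by simp
  have "simple_defect A G"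
    unfolding simple_defect_def
  proof (intro conjI allI ballI)
    show "G \<in> Arr A" by simp
    show "\<not> is_retraction A G"
    proof
      assume "is_retraction A G"
      then have p1: "component p W (farr N h x) = \<one>\<^bsub>fob S W\<^esub>" if "h \<in> Hom A W (tgt A g)" for W h
        using that pG[OF that] hom_image_retraction[of G W] by simp
      \<comment> \<open>Otherwise \<open>p = 0\<close>, and \<open>S\<close> vanishes because \<open>p\<close> is an epimorphism of \<open>eff E\<close>.\<close>
      note z = Mod_zero[OF Np Sp]
      have pz: "p = hzero (Mod_category A) N S"
        by (rule Mod_eqI[OF pM z(1)]) (use p1 gen z(2) in metis)
      have unit: "ident (Mod_category A) S \<in> Hom (eff A E) S S" "hzero (Mod_category A) S S \<in> Hom (eff A E) S S"
        using Mod_ident(1)[OF Sp] Mod_zero(1)[OF Sp Sp] Se by (auto simp: eff_Hom)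
      have comp: "cmps (Mod_category A) k p = hzero (Mod_category A) N K" if k: "k \<in> Hom (Mod_category A) S K" for k K
      proof -
        have Kp: "additive_presheaf A K" using k by (simp add: Mod_Hom_iff)
        show ?thesis
          by (rule Mod_eqI[OF Mod_comp_closed(1)[OF pM k] Mod_zero(1)[OF Np Kp]])
            (simp add: Mod_comp_closed(2)[OF pM k] Mod_zero(2)[OF Np Kp], simp add: pz z(2) Mod_one[OF k])
      qed
      have epi: "k = k'" if "k \<in> Hom (eff A E) S K" "k' \<in> Hom (eff A E) S K" for k k' K
      proof -
        have kM: "k \<in> Hom (Mod_category A) S K" "k' \<in> Hom (Mod_category A) S K" and Ke: "K \<in> Ob (eff A E)"
          using that by (auto simp: eff_Hom)
        have Kp: "additive_presheaf A K" using Ke by (simp add: eff_Ob)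
        have "cmps (Mod_category A) (hzero (Mod_category A) N K) j = hzero (Mod_category A) Y K"
          by (rule Mod_eqI[OF Mod_comp_closed(1)[OF jM Mod_zero(1)[OF Np Kp]] Mod_zero(1)[OF Yp Kp]])
            (simp add: Mod_comp_closed(2)[OF jM Mod_zero(1)[OF Np Kp]] Mod_zero(2)[OF Np Kp] Mod_zero(2)[OF Yp Kp] Mod_closed[OF jM])
        then have "\<exists>!k. k \<in> Hom (eff A E) S K \<and> cmps (Mod_category A) k p = hzero (Mod_category A) N K"
          using cok[OF Ke] Mod_zero(1)[OF Np Kp] Ke Ne by (simp only: eff_Hom simp_thms)
        then show ?thesis using that comp kM by metis
      qed
      have one: "s = \<one>\<^bsub>fob S V\<^esub>" if "V \<in> Ob A" "s \<in> carrier (fob S V)" for V s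
        using epi[OF unit] Mod_ident(2)[OF Sp that] Mod_zero(2)[OF Sp Sp that] by simp
      have "zero_object (eff A E) S" unfolding zero_object_def
      proof (intro conjI ballI Se)
        fix K assume K: "K \<in> Ob (eff A E)"
        then have Kp: "additive_presheaf A K" by (simp add: eff_Ob)
        have z1: "hzero (Mod_category A) S K \<in> Hom (eff A E) S K" "hzero (Mod_category A) K S \<in> Hom (eff A E) K S"
          using Mod_zero(1)[OF Sp Kp] Mod_zero(1)[OF Kp Sp] K Se by (auto simp: eff_Hom)
        show "\<exists>!f. f \<in> Hom (eff A E) S K" using z1(1) epi by metis
        show "\<exists>!f. f \<in> Hom (eff A E) K S"
        proof (rule ex1I[of _ "hzero (Mod_category A) K S"])
          show "hzero (Mod_category A) K S \<in> Hom (eff A E) K S" by (rule z1(2))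
          fix f assume "f \<in> Hom (eff A E) K S"
          then have fM: "f \<in> Hom (Mod_category A) K S" by (simp add: eff_Hom)
          show "f = hzero (Mod_category A) K S"
            by (rule Mod_eqI[OF fM Mod_zero(1)[OF Kp Sp]]) (simp add: Mod_zero(2)[OF Kp Sp] one[OF _ Mod_closed[OF fM]])
        qed
      qed
      then show False using S by (simp add: simple_object_def)
    qed
    fix W u assume "u \<in> Hom A W (tgt A G)"
    then have u: "u \<in> Hom A W (tgt A g)" by simp
    note uA = u[unfolded Hom_iff]
    have W: "W \<in> Ob A" using Hom_Ob[OF u] by simp
    show "u \<in> hom_image A G W \<or> (\<exists>h\<in>Hom A (tgt A G) W. \<exists>v\<in>hom_image A G (tgt A G). ident A (tgt A G) = v \<boxplus> u \<cdot> h)"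
    proof (cases "u \<in> hom_image A G W")
      case False
      let ?s = "component p W (farr N u x)"
      have s: "?s \<in> carrier (fob S W)" "?s \<noteq> \<one>\<^bsub>fob S W\<^esub>"
        using False pG[OF u] Mod_closed[OF pM W presheaf_closed[OF Np u x]] by auto
      obtain h where h: "h \<in> Hom A (tgt A g) W" "farr S h ?s = component p (tgt A g) x"
        using simple_generated[OF S W s _ px] by auto
      note hA = h(1)[unfolded Hom_iff]
      have uh: "u \<cdot> h \<in> Hom A (tgt A g) (tgt A g)" using uA hA by (simp add: Hom_iff)
      have d: "ident A (tgt A g) \<boxminus> u \<cdot> h \<in> Hom A (tgt A g) (tgt A g)" using uA hA by (simp add: Hom_iff)
      have T: "tgt A g \<in> Ob A" by simp
      interpret GN: comm_group "fob N (tgt A g)" by (rule presheaf_group[OF Np T])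
      interpret GS: comm_group "fob S (tgt A g)" by (rule presheaf_group[OF Sp T])
      let ?d = "farr N (ident A (tgt A g) \<boxminus> u \<cdot> h) x" and ?e = "farr N (u \<cdot> h) x"
      have dN: "?d \<in> carrier (fob N (tgt A g))" "?e \<in> carrier (fob N (tgt A g))"
        using presheaf_closed[OF Np d x] presheaf_closed[OF Np uh x] .
      have "x = farr N (ident A (tgt A g) \<boxminus> u \<cdot> h \<boxplus> u \<cdot> h) x"
        using presheaf_ident[OF Np T x] uA hA by simp
      also have "\<dots> = ?d \<otimes>\<^bsub>fob N (tgt A g)\<^esub> ?e" by (rule presheaf_add[OF Np d uh x])
      finally have "component p (tgt A g) x = component p (tgt A g) ?d \<otimes>\<^bsub>fob S (tgt A g)\<^esub> component p (tgt A g) ?e"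
        using hom_mult[OF Mod_hom[OF pM T] dN] by simp
      moreover have "component p (tgt A g) ?e = component p (tgt A g) x"
        using presheaf_comp[OF Np h(1) u x] Mod_natural[OF pM h(1) presheaf_closed[OF Np u x]] h(2) by simp
      ultimately have "component p (tgt A g) ?d = \<one>\<^bsub>fob S (tgt A g)\<^esub>"
        using px Mod_closed[OF pM T dN(1)] GS.r_cancel_one' by metis
      then have "ident A (tgt A g) \<boxminus> u \<cdot> h \<in> hom_image A G (tgt A g)" using pG[OF d] by simp
      then have "\<exists>h\<in>Hom A (tgt A G) W. \<exists>v\<in>hom_image A G (tgt A G). ident A (tgt A G) = v \<boxplus> u \<cdot> h"
        using h(1) uA hA by (intro bexI[of _ h] bexI[of _ "ident A (tgt A g) \<boxminus> u \<cdot> h"]) (auto simp: Hom_iff)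
      then show ?thesis ..
    qed simp
  qed
  moreover obtain g' a' where g': "is_pullback A g a g' a'" "g' \<in> snd ` E" "tgt A g' = X"
    "\<And>V h. h \<in> Hom A V X \<Longrightarrow> h \<in> hom_image A g' V \<longleftrightarrow> farr N h (farr N a x) = \<one>\<^bsub>fob N V\<^esub>"
    using presents_pullback[OF N a(1)] by metis
  moreover have "presents Y y g'"
    unfolding presents_def
  proof (intro conjI ballI Yp)
    show "g' \<in> Arr A" by (rule deflation_Arr[OF g'(2)])
    show "y \<in> carrier (fob Y (tgt A g'))" using y g'(3) by simp
    fix W assume W: "W \<in> Ob A"
    show "\<exists>h\<in>Hom A W (tgt A g'). farr Y h y = z" if "z \<in> carrier (fob Y W)" for z
      using presents_gen[OF y0(1) W that] g'(3) by (simp add: X_def)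
    fix h assume "h \<in> Hom A W (tgt A g')"
    then have h: "h \<in> Hom A W X" using g'(3) by simp
    have hy: "farr Y h y \<in> carrier (fob Y W)" by (rule presheaf_closed[OF Yp h y])
    have "farr Y h y = \<one>\<^bsub>fob Y W\<^esub> \<longleftrightarrow> component j W (farr Y h y) = \<one>\<^bsub>fob N W\<^esub>"
      using eff_mono_injective[OF j(2) W, of "farr Y h y"] hy jst Mod_one[OF jM W] by auto
    also have "\<dots> \<longleftrightarrow> h \<in> hom_image A g' W"
      using g'(4)[OF h] a(2) Mod_natural[OF jM h y] by simp
    finally show "farr Y h y = \<one>\<^bsub>fob Y W\<^esub> \<longleftrightarrow> h \<in> hom_image A g' W" .
  qed
  ultimately show ?thesis using that G by blast
qed

lemma finite_length_finite_defect:
  fixes M :: "nat \<Rightarrow> ('o, 'm, 'm set) presheaf"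
  assumes "\<And>k. k \<le> n \<Longrightarrow> M k \<in> Ob (eff A E)" "zero_object (eff A E) (M 0)"
    and "\<And>k. k < n \<Longrightarrow> j k \<in> Hom (eff A E) (M k) (M (Suc k)) \<and> is_mono (eff A E) (j k) \<and>
      (\<exists>p. is_cokernel (eff A E) p (j k) \<and> simple_object (eff A E) (tgt (eff A E) p))"
    and "presents (M n) x g" "g \<in> snd ` E"
  shows "finite_defect A E g"
  using assms
proof (induction n arbitrary: x g)
  case 0
  have g: "g \<in> Arr A" using 0 by (simp add: presents_def)
  have Mp: "additive_presheaf A (M 0)" and x: "x \<in> carrier (fob (M 0) (tgt A g))" using 0 by (auto simp: presents_def)
  have "x = \<one>\<^bsub>fob (M 0) (tgt A g)\<^esub>" using eff_zero_object[OF 0(2) _ x] g by simp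
  then have "farr (M 0) (ident A (tgt A g)) x = \<one>\<^bsub>fob (M 0) (tgt A g)\<^esub>"
    using presheaf_ident[OF Mp _ x] g by simp
  moreover have "ident A (tgt A g) \<in> Hom A (tgt A g) (tgt A g)" using g by (simp add: Hom_iff)
  ultimately have "ident A (tgt A g) \<in> hom_image A g (tgt A g)" using presents_ker[OF 0(4)] by blast
  then show ?case using 0(5) g by (intro finite_defect.zero) (auto simp: retraction_iff_hom_image)
next
  case (Suc n)
  have jn: "j n \<in> Hom (eff A E) (M n) (M (Suc n))" "is_mono (eff A E) (j n)" using Suc.prems(3)[of n] by auto
  obtain p where p: "is_cokernel (eff A E) p (j n)" "simple_object (eff A E) (tgt (eff A E) p)"
    using Suc.prems(3)[of n] by auto
  obtain a G g' a' y where G: "G \<in> snd ` E" "adjoined A g a G" "simple_defect A G" "is_pullback A g a g' a'" "g' \<in> snd ` E"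
    "presents (M n) y g'"
    by (rule composition_step[OF jn p Suc.prems(4,5)])
  have "finite_defect A E g'"
    by (rule Suc.IH[OF _ Suc.prems(2) _ G(6,5)]) (use Suc.prems in auto)
  then show ?case by (rule finite_defect.extension[OF Suc.prems(5) G(1-4)])
qed

theorem admissible_finite_defect:
  assumes "admissible A E" "g \<in> snd ` E"
  shows "finite_defect A E g"
proof -
  obtain f where fg: "(f, g) \<in> E" using assms by auto
  have g: "g \<in> Arr A" using deflation_Arr[OF assms(2)] .
  have "finite_length (eff A E) (defect A (f, g))" using assms(1) defect_eff[OF fg] by (simp add: admissible_def)
  then obtain n M j where M: "\<forall>k\<le>(n::nat). M k \<in> Ob (eff A E)" "zero_object (eff A E) (M 0)" "M n = defect A (f, g)"
    "\<forall>k<n. j k \<in> Hom (eff A E) (M k) (M (Suc k)) \<and> is_mono (eff A E) (j k) \<and>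
      (\<exists>p. is_cokernel (eff A E) p (j k) \<and> simple_object (eff A E) (tgt (eff A E) p))"
    unfolding finite_length_def by blast
  show ?thesis
    by (rule finite_length_finite_defect[of n M j]) (use M assms(2) defect_presents[OF g, of f] in auto)
qed

end

section \<open>Inclusion orders isomorphic to power sets\<close>

lemma inclusion_sel [simp]:
  "carrier (inclusion_order S) = S" "eq (inclusion_order S) = (=)" "le (inclusion_order S) = (\<subseteq>)"
  by (simp_all add: inclusion_order_def)

lemma inclusion_partial_order: "partial_order (inclusion_order S)"
  by unfold_locales auto

text \<open>
  Joins, meets and complements in the family \<open>S\<close> need not be unions, intersections and set
  complements.  They become so after an order isomorphism \<open>h\<close> onto a power set.
\<close>

locale power_set_order =
  fixes S :: "'a set set" and T :: "'b set" and h :: "'a set \<Rightarrow> 'b set"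
  assumes bij: "bij_betw h S (Pow T)" and order: "\<And>x y. x \<in> S \<Longrightarrow> y \<in> S \<Longrightarrow> x \<subseteq> y \<longleftrightarrow> h x \<subseteq> h y"
begin

abbreviation L where "L \<equiv> inclusion_order S"

lemma in_T: "x \<in> S \<Longrightarrow> h x \<subseteq> T"
  using bij by (auto simp: bij_betw_def)

lemma preimage:
  assumes "U \<subseteq> T" obtains z where "z \<in> S" "h z = U"
  using bij assms by (auto simp: bij_betw_def image_iff set_eq_iff) (metis PowI bij bij_betw_imp_surj_on imageE)

lemma join_least:
  assumes "x \<in> S" "y \<in> S" "z \<in> S" "h z = h x \<union> h y"
  shows "least L z (Upper L {x, y})"
proof -
  have "x \<subseteq> z" "y \<subseteq> z" using assms by (simp_all add: order)
  moreover have "z \<subseteq> u" if "u \<in> S" "x \<subseteq> u" "y \<subseteq> u" for u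
    using assms that order[of x u] order[of y u] order[of z u] by blast
  ultimately show ?thesis using assms(1-3) by (auto simp: least_def Upper_def)
qed

lemma meet_greatest:
  assumes "x \<in> S" "y \<in> S" "z \<in> S" "h z = h x \<inter> h y"
  shows "greatest L z (Lower L {x, y})"
proof -
  have "z \<subseteq> x" "z \<subseteq> y" using assms by (simp_all add: order)
  moreover have "u \<subseteq> z" if "u \<in> S" "u \<subseteq> x" "u \<subseteq> y" for u
    using assms that order[of u x] order[of u y] order[of u z] by blast
  ultimately show ?thesis using assms(1-3) by (auto simp: greatest_def Lower_def)
qed

lemma lattice: "lattice L"
proof -
  interpret partial_order L by (rule inclusion_partial_order)
  show ?thesis
  proof unfold_locales
    fix x y assume xy: "x \<in> carrier L" "y \<in> carrier L"
    then have "h x \<union> h y \<subseteq> T" "h x \<inter> h y \<subseteq> T" using in_T by auto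
    then obtain z w where "z \<in> S" "h z = h x \<union> h y" "w \<in> S" "h w = h x \<inter> h y" using preimage by metis
    then show "\<exists>s. least L s (Upper L {x, y})" "\<exists>s. greatest L s (Lower L {x, y})"
      using join_least[of x y z] meet_greatest[of x y w] xy by auto
  qed
qed

lemma h_join:
  assumes "x \<in> S" "y \<in> S" shows "x \<squnion>\<^bsub>L\<^esub> y \<in> S" "h (x \<squnion>\<^bsub>L\<^esub> y) = h x \<union> h y"
proof -
  interpret partial_order L by (rule inclusion_partial_order)
  have "h x \<union> h y \<subseteq> T" using in_T assms by auto
  then obtain z where z: "z \<in> S" "h z = h x \<union> h y" using preimage by metis
  then have l: "least L z (Upper L {x, y})" using join_least assms by auto
  have "x \<squnion>\<^bsub>L\<^esub> y = z" unfolding join_def sup_def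
    by (rule some_equality) (use l least_unique in auto)
  then show "x \<squnion>\<^bsub>L\<^esub> y \<in> S" "h (x \<squnion>\<^bsub>L\<^esub> y) = h x \<union> h y" using z by auto
qed

lemma h_meet:
  assumes "x \<in> S" "y \<in> S" shows "x \<sqinter>\<^bsub>L\<^esub> y \<in> S" "h (x \<sqinter>\<^bsub>L\<^esub> y) = h x \<inter> h y"
proof -
  interpret partial_order L by (rule inclusion_partial_order)
  have "h x \<inter> h y \<subseteq> T" using in_T assms by auto
  then obtain z where z: "z \<in> S" "h z = h x \<inter> h y" using preimage by metis
  then have l: "greatest L z (Lower L {x, y})" using meet_greatest assms by auto
  have "x \<sqinter>\<^bsub>L\<^esub> y = z" unfolding meet_def inf_def
    by (rule some_equality) (use l greatest_unique in auto)
  then show "x \<sqinter>\<^bsub>L\<^esub> y \<in> S" "h (x \<sqinter>\<^bsub>L\<^esub> y) = h x \<inter> h y" using z by auto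
qed

lemma h_inj: "x \<in> S \<Longrightarrow> y \<in> S \<Longrightarrow> h x = h y \<Longrightarrow> x = y"
  using bij by (auto simp: bij_betw_def inj_on_def)

lemma boolean: "boolean_lattice L"
proof -
  interpret lattice L by (rule lattice)
  obtain b where b: "b \<in> S" "h b = {}" using preimage[of "{}"] by auto
  obtain t where t: "t \<in> S" "h t = T" using preimage[of T] by auto
  have lb: "least L b (carrier L)" unfolding least_def using b order by auto
  have gt: "greatest L t (carrier L)" unfolding greatest_def using t order in_T by auto
  interpret bounded_lattice L
    by unfold_locales (use lb gt in auto)
  have bot: "\<bottom>\<^bsub>L\<^esub> = b" unfolding bottom_def by (rule some_equality) (use lb least_unique in auto)
  have top: "\<top>\<^bsub>L\<^esub> = t" unfolding top_def by (rule some_equality) (use gt greatest_unique in auto)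
  show ?thesis
  proof (unfold_locales, goal_cases)
    case (1 x y z)
    then show ?case by (intro h_inj) (auto simp: h_join h_meet)
  next
    case (2 x)
    have "T - h x \<subseteq> T" by auto
    then obtain y where y: "y \<in> S" "h y = T - h x" using preimage by metis
    have "x \<sqinter>\<^bsub>L\<^esub> y = b" by (rule h_inj) (use 2 y b in \<open>auto simp: h_meet\<close>)
    moreover have "x \<squnion>\<^bsub>L\<^esub> y = t" by (rule h_inj) (use 2 y t in_T[of x] in \<open>auto simp: h_join\<close>)
    ultimately show ?case using y bot top by auto
  qed
qed

end

lemma power_set_order_Pow: "power_set_order (Pow T) T (\<lambda>x. x)"
  by unfold_locales (auto simp: bij_betw_def)

lemma (in power_set_order) lattices_isomorphic: "lattices_isomorphic L (inclusion_order (Pow T))"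
proof -
  interpret P: power_set_order "Pow T" T "\<lambda>x. x" by (rule power_set_order_Pow)
  have "h (x \<squnion>\<^bsub>L\<^esub> y) = h x \<squnion>\<^bsub>P.L\<^esub> h y" "h (x \<sqinter>\<^bsub>L\<^esub> y) = h x \<sqinter>\<^bsub>P.L\<^esub> h y" if "x \<in> S" "y \<in> S" for x y
    using that in_T by (simp_all add: h_join h_meet P.h_join P.h_meet)
  then show ?thesis unfolding lattices_isomorphic_def join_pres_def meet_pres_def
    using bij lattice P.lattice by (intro exI[of _ h]) auto
qed

lemma (in power_set_order) compose_bij:
  assumes f: "bij_betw f T U" shows "power_set_order S U (\<lambda>x. f ` h x)"
proof
  show "bij_betw (\<lambda>x. f ` h x) S (Pow U)"
    using bij_betw_trans[OF bij bij_betw_Pow[OF f]] by (simp add: comp_def)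
  fix x y assume xy: "x \<in> S" "y \<in> S"
  have "h x \<subseteq> h y" if sub: "f ` h x \<subseteq> f ` h y"
  proof
    fix t assume t: "t \<in> h x"
    then obtain t' where t': "t' \<in> h y" "f t = f t'" using sub by blast
    then have "t = t'" using bij_betw_imp_inj_on[OF f] t in_T[OF xy(1)] in_T[OF xy(2)] by (meson inj_onD subsetD)
    then show "t \<in> h y" using t' by simp
  qed
  then show "x \<subseteq> y \<longleftrightarrow> f ` h x \<subseteq> f ` h y" using order[OF xy] by blast
qed

text \<open>
  A map that preserves and reflects the equivalence and meets every class induces a bijection of the
  quotients.
\<close>

lemma quotient_bij:
  assumes s: "equiv B s" and m: "\<And>a. a \<in> A \<Longrightarrow> m a \<in> B" and surj: "\<And>b. b \<in> B \<Longrightarrow> \<exists>a\<in>A. (m a, b) \<in> s"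
    and r: "r = {(a, a'). a \<in> A \<and> a' \<in> A \<and> (m a, m a') \<in> s}"
  shows "bij_betw (\<lambda>c. s `` (m ` c)) (A // r) (B // s)"
proof -
  have sym: "\<And>x y. (x, y) \<in> s \<Longrightarrow> (y, x) \<in> s" and trans: "\<And>x y z. (x, y) \<in> s \<Longrightarrow> (y, z) \<in> s \<Longrightarrow> (x, z) \<in> s"
    and refl: "\<And>x. x \<in> B \<Longrightarrow> (x, x) \<in> s"
    using s by (meson equivE symD, meson equivE transD, meson equivE refl_onD)
  have cls: "s `` (m ` (r `` {a})) = s `` {m a}" if "a \<in> A" for a
    using that m refl[OF m[OF that]] by (auto simp: r intro: trans)
  show ?thesis unfolding bij_betw_def
  proof
    show "inj_on (\<lambda>c. s `` (m ` c)) (A // r)"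
    proof (rule inj_onI)
      fix c d assume "c \<in> A // r" "d \<in> A // r" and eq: "s `` (m ` c) = s `` (m ` d)"
      then obtain a b where ab: "a \<in> A" "c = r `` {a}" "b \<in> A" "d = r `` {b}" by (auto elim!: quotientE)
      then have "s `` {m a} = s `` {m b}" using eq cls by simp
      then have "(m a, m b) \<in> s" using refl[OF m[OF ab(3)]] by auto
      then show "c = d" using ab by (auto simp: r intro: trans sym)
    qed
    show "(\<lambda>c. s `` (m ` c)) ` (A // r) = B // s"
    proof (intro equalityI subsetI)
      fix x assume "x \<in> (\<lambda>c. s `` (m ` c)) ` (A // r)"
      then obtain a where "a \<in> A" "x = s `` {m a}" using cls by (auto elim!: quotientE)
      then show "x \<in> B // s" using m by (auto intro: quotientI)
    next
      fix x assume "x \<in> B // s"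
      then obtain b where b: "b \<in> B" "x = s `` {b}" by (auto elim!: quotientE)
      then obtain a where a: "a \<in> A" "(m a, b) \<in> s" using surj by blast
      then have "x = s `` {m a}" using b by (auto intro: trans sym)
      then have "x = s `` (m ` (r `` {a}))" using cls a by simp
      then show "x \<in> (\<lambda>c. s `` (m ` c)) ` (A // r)" using a(1) by (auto intro: quotientI)
    qed
  qed
qed

section \<open>Exact substructures and nonprojective indecomposables\<close>

context category
begin

lemma isomorphic_refl: "X \<in> Ob C \<Longrightarrow> isomorphic C X X"
  unfolding isomorphic_def using iso_ident ident_closed by blast

lemma isomorphic_sym: "isomorphic C X Y \<Longrightarrow> isomorphic C Y X"
proof -
  assume "isomorphic C X Y"
  then obtain f where f: "f \<in> Hom C X Y" "is_iso C f" by (auto simp: isomorphic_def)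
  then obtain g where g: "g \<in> Arr C" "src C g = tgt C f" "tgt C g = src C f"
    "g \<cdot> f = ident C (src C f)" "f \<cdot> g = ident C (tgt C f)" by (auto elim: isoE)
  then show ?thesis using f isoI[of g Y X f] by (auto simp: isomorphic_def Hom_iff intro!: bexI[of _ g])
qed

lemma isomorphic_trans: "isomorphic C X Y \<Longrightarrow> isomorphic C Y Z \<Longrightarrow> isomorphic C X Z"
proof -
  assume "isomorphic C X Y" "isomorphic C Y Z"
  then obtain f h where f: "f \<in> Hom C X Y" "is_iso C f" "h \<in> Hom C Y Z" "is_iso C h" by (auto simp: isomorphic_def)
  obtain g where g: "g \<in> Arr C" "src C g = tgt C f" "tgt C g = src C f"
    "g \<cdot> f = ident C (src C f)" "f \<cdot> g = ident C (tgt C f)" using isoE[OF f(2)] by blast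
  obtain k where k: "k \<in> Arr C" "src C k = tgt C h" "tgt C k = src C h"
    "k \<cdot> h = ident C (src C h)" "h \<cdot> k = ident C (tgt C h)" using isoE[OF f(4)] by blast
  note [simp] = f(1,3)[unfolded Hom_iff] g(1-3) k(1-3)
  have "is_iso C (h \<cdot> f)"
    using f g k by (intro isoI[of "h \<cdot> f" X Z "g \<cdot> k"]) (auto simp: Hom_iff comp_assoc_eq[OF k(4)] comp_assoc_eq[OF g(5)])
  then show ?thesis using f by (auto simp: isomorphic_def Hom_iff intro!: bexI[of _ "h \<cdot> f"])
qed

end

lemma (in preadditive_category) pair_isomorphic_tgt:
  "pair_isomorphic C (f, g) (f', g') \<Longrightarrow> isomorphic C (tgt C g) (tgt C g')"
  by (auto simp: pair_isomorphic_def isomorphic_def)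

lemma (in krull_schmidt_exact) nonprojective_iff:
  "Z \<in> nonprojective_indecomposables A E \<longleftrightarrow> local_object Z \<and> (\<exists>(f, g)\<in>E. tgt A g = Z \<and> \<not> is_retraction A g)"
  by (auto simp: nonprojective_indecomposables_def projective_iff indecomposable_iff_local)

lemma (in krull_schmidt_exact) nonprojective_iso_closed:
  assumes Z: "Z \<in> nonprojective_indecomposables A E" and W: "indecomposable A W" "isomorphic A Z W"
  shows "W \<in> nonprojective_indecomposables A E"
proof -
  obtain f g where fg: "(f, g) \<in> E" "tgt A g = Z" "\<not> is_retraction A g" using Z by (auto simp: nonprojective_iff)
  obtain c where c: "c \<in> Hom A Z W" "is_iso A c" using W by (auto simp: isomorphic_def)
  obtain c' where c': "c' \<in> Arr A" "src A c' = W" "tgt A c' = Z" "c' \<cdot> c = ident A Z"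
    using isoE[OF c(2)] c(1) by (auto simp: Hom_iff)
  note C = conflation_Arr[OF fg(1)]
  note [simp] = C(1-3) c(1)[unfolded Hom_iff] c'(1-3) fg(2)
  have "pair_isomorphic A (f, g) (f, c \<cdot> g)"
    using c(2) by (intro pair_isomorphicI[where a = "ident A (src A f)" and b = "ident A (src A g)" and c = c])
      (auto simp: Hom_iff iso_ident)
  then have "(f, c \<cdot> g) \<in> E" by (rule iso_closed[OF fg(1)])
  moreover have "\<not> is_retraction A (c \<cdot> g)"
  proof
    assume "is_retraction A (c \<cdot> g)"
    then obtain s where s: "s \<in> Arr A" "src A s = W" "tgt A s = src A g" "(c \<cdot> g) \<cdot> s = ident A W"
      by (auto elim!: retractionE)
    have "g \<cdot> (s \<cdot> c) = c' \<cdot> (((c \<cdot> g) \<cdot> s) \<cdot> c)" using s(1-3) by (simp add: comp_assoc_eq[OF c'(4)])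
    also have "\<dots> = ident A Z" unfolding s(4) using c'(4) by simp
    finally show False using fg(3) s(1-3) retractionI[of g "src A g" Z "s \<cdot> c"] by (auto simp: Hom_iff)
  qed
  ultimately show ?thesis using W(1) by (auto simp: nonprojective_iff indecomposable_iff_local intro!: bexI[of _ "(f, c \<cdot> g)"])
qed

locale admissible_exact = krull_schmidt_exact A E
  for A :: "('o, 'm, 'z) precat_scheme" (structure) and E :: "('m \<times> 'm) set" +
  assumes admissible: "admissible A E"
begin

abbreviation NP where "NP F \<equiv> nonprojective_indecomposables A F"

abbreviation substructures where
  "substructures \<equiv> {F. exact_structure A F \<and> split_exact_structure A \<subseteq> F \<and> F \<subseteq> E}"

definition substructure_of :: "'o set \<Rightarrow> ('m \<times> 'm) set" where
  "substructure_of \<S> = relative_structure A E {W. indecomposable A W \<and> W \<notin> \<S>}"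

lemma substructure: "F \<in> substructures \<Longrightarrow> krull_schmidt_exact A F"
  using krull_schmidt_category_axioms by (simp add: krull_schmidt_exact_def)

lemma E_substructure: "E \<in> substructures"
  using exact_structure_axioms split_subset by auto

lemma substructure_of: "substructure_of \<S> \<in> substructures"
proof -
  interpret F: exact_structure A "substructure_of \<S>" unfolding substructure_of_def by (rule relative_exact)
  show ?thesis using F.exact_structure_axioms F.split_subset
    by (auto simp: substructure_of_def relative_structure_def)
qed

lemma NP_mono: "F \<in> substructures \<Longrightarrow> F' \<in> substructures \<Longrightarrow> F \<subseteq> F' \<Longrightarrow> NP F \<subseteq> NP F'"
proof -
  assume F: "F \<in> substructures" "F' \<in> substructures" "F \<subseteq> F'"
  interpret F: krull_schmidt_exact A F by (rule substructure[OF F(1)])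
  interpret F': krull_schmidt_exact A F' by (rule substructure[OF F(2)])
  show "NP F \<subseteq> NP F'" using F(3) by (fastforce simp: F.nonprojective_iff F'.nonprojective_iff)
qed

lemma NP_AR:
  assumes F: "F \<in> substructures"
  shows "Z \<in> NP F \<longleftrightarrow> (\<exists>(f, g)\<in>AR_conflations A F. tgt A g = Z)"
proof
  interpret F: krull_schmidt_exact A F by (rule substructure[OF F])
  {
    assume "Z \<in> NP F"
    then obtain f g where fg: "local_object Z" "(f, g) \<in> F" "tgt A g = Z" "\<not> is_retraction A g"
      by (auto simp: F.nonprojective_iff)
    have gF: "g \<in> snd ` F" "g \<in> snd ` E" using fg(2) F by force+
    have lZ: "local_object (tgt A g)" using fg by simp
    obtain f' g' where "(f', g') \<in> AR_conflations A F" "tgt A g' = tgt A g"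
      by (rule AR_conflation_exists[OF F.exact_structure_axioms _ admissible_finite_defect[OF admissible gF(2)] gF(1) fg(4) lZ])
        (use F in auto)
    then show "\<exists>(f, g)\<in>AR_conflations A F. tgt A g = Z" using fg(3) by auto
  }
  assume "\<exists>(f, g)\<in>AR_conflations A F. tgt A g = Z"
  then show "Z \<in> NP F" by (auto simp: F.nonprojective_iff F.AR_conflations_iff indecomposable_iff_local)
qed

text \<open>
  A deflation of \<open>F\<close> lifts all morphisms \<open>h\<close> from an \<open>F\<close>-projective object, because its pullback along \<open>h\<close>
  splits.  The other inclusion is \<open>deflation_in_substructure\<close>: an indecomposable from which some
  morphism does not lift is nonprojective in \<open>F\<close> and so is the end of an AR conflation in \<open>F\<close>.
\<close>

lemma substructure_of_NP:
  assumes F: "F \<in> substructures"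
  shows "substructure_of (NP F) = F"
proof
  interpret F: krull_schmidt_exact A F by (rule substructure[OF F])
  show "F \<subseteq> substructure_of (NP F)"
  proof
    fix \<delta> assume d: "\<delta> \<in> F"
    obtain f g where fg: "\<delta> = (f, g)" by fastforce
    have gF: "g \<in> snd ` F" using d fg by force
    have "h \<in> hom_image A g W" if W: "indecomposable A W" "W \<notin> NP F" "h \<in> Hom A W (tgt A g)" for W h
    proof -
      have h: "h \<in> Arr A" "tgt A g = tgt A h" "src A h = W" using W(3) by (auto simp: Hom_iff)
      obtain g' h' where g': "is_pullback A g h g' h'" "g' \<in> snd ` F" using F.deflation_pullback[OF gF h(1,2)] by blast
      have t: "tgt A g' = W" using pullbackD[OF g'(1)] h by simp
      then have "is_retraction A g'" using W g'(2) by (force simp: F.nonprojective_iff indecomposable_iff_local)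
      then have "hom_image A g' W = Hom A W W" using hom_image_retraction t by simp
      moreover have "ident A W \<in> Hom A W W" using h by (auto simp: Hom_iff)
      ultimately have "h \<cdot> ident A W \<in> hom_image A g W" using pullback_hom_image[OF g'(1), of W] by auto
      then show ?thesis using h by simp
    qed
    then show "\<delta> \<in> substructure_of (NP F)" using d fg F
      by (auto simp: substructure_of_def relative_structure_def)
  qed
  show "substructure_of (NP F) \<subseteq> F"
  proof
    fix \<delta> assume d: "\<delta> \<in> substructure_of (NP F)"
    obtain f g where fg: "\<delta> = (f, g)" by fastforce
    then have fgE: "(f, g) \<in> E" and rel: "\<And>W. indecomposable A W \<Longrightarrow> W \<notin> NP F \<Longrightarrow> Hom A W (tgt A g) \<subseteq> hom_image A g W"
      using d by (auto simp: substructure_of_def relative_structure_def)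
    have gE: "g \<in> snd ` E" using fgE by force
    have "g \<in> snd ` F"
    proof (rule deflation_in_substructure[OF F.exact_structure_axioms _ admissible_finite_defect[OF admissible gE]])
      fix Z u assume Z: "local_object Z" "u \<in> Hom A Z (tgt A g)" "u \<notin> hom_image A g Z"
      then have "Z \<in> NP F" using rel[of Z] by (auto simp: indecomposable_iff_local)
      then show "\<exists>(f0, g0)\<in>AR_conflations A F. tgt A g0 = Z" by (simp add: NP_AR[OF F])
    qed (use F in auto)
    then show "\<delta> \<in> F" unfolding fg using conflationD(1)[OF fgE] by (rule F.deflation_kernel)
  qed
qed

text \<open>
  If \<open>Z \<in> \<S>\<close>, the AR conflation ending in \<open>Z\<close> belongs to the structure of \<open>\<S>\<close>: a morphism \<open>h : W \<rightarrow> Z\<close> from an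
  indecomposable \<open>W \<notin> \<S>\<close> is no isomorphism, thus no retraction, thus radical.  If \<open>Z \<notin> \<S>\<close>, every deflation
  onto \<open>Z\<close> in the structure lifts the identity of \<open>Z\<close>.
\<close>

lemma NP_substructure_of:
  assumes S: "\<S> \<subseteq> NP E" and closed: "\<And>Z W. Z \<in> \<S> \<Longrightarrow> W \<in> NP E \<Longrightarrow> isomorphic A Z W \<Longrightarrow> W \<in> \<S>"
  shows "NP (substructure_of \<S>) = \<S>"
proof
  interpret F: krull_schmidt_exact A "substructure_of \<S>" by (rule substructure[OF substructure_of])
  show "NP (substructure_of \<S>) \<subseteq> \<S>"
  proof
    fix Z assume "Z \<in> NP (substructure_of \<S>)"
    then obtain f g where fg: "local_object Z" "(f, g) \<in> substructure_of \<S>" "tgt A g = Z" "\<not> is_retraction A g"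
      by (auto simp: F.nonprojective_iff)
    show "Z \<in> \<S>"
    proof (rule ccontr)
      assume "Z \<notin> \<S>"
      then have "Hom A Z (tgt A g) \<subseteq> hom_image A g Z"
        using fg by (auto simp: substructure_of_def relative_structure_def indecomposable_iff_local)
      moreover have "ident A Z \<in> Hom A Z (tgt A g)" using fg by (auto simp: Hom_iff)
      ultimately show False using fg F.conflation_Arr[OF fg(2)] by (auto simp: retraction_iff_hom_image)
    qed
  qed
  show "\<S> \<subseteq> NP (substructure_of \<S>)"
  proof
    fix Z assume Z: "Z \<in> \<S>"
    then have "Z \<in> NP E" using S by blast
    then obtain f g where fg: "(f, g) \<in> AR_conflations A E" "tgt A g = Z" using NP_AR[OF E_substructure] by auto
    then have fgE: "(f, g) \<in> E" "local_object Z" "\<not> is_retraction A g" by (auto simp: AR_conflations_iff indecomposable_iff_local)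
    have "h \<in> hom_image A g W" if W: "indecomposable A W" "W \<notin> \<S>" "h \<in> Hom A W Z" for W h
    proof -
      have lW: "local_object W" using W by (simp add: indecomposable_iff_local)
      have "\<not> is_retraction A h"
      proof
        assume "is_retraction A h"
        then have "is_iso A h" using local_retraction_iso[OF lW fgE(2) W(3)] by simp
        then have iso: "isomorphic A Z W" using W(3) isomorphic_sym by (auto simp: isomorphic_def)
        then have "W \<in> NP E" using nonprojective_iso_closed[OF \<open>Z \<in> NP E\<close> W(1)] by simp
        then show False using closed[OF Z _ iso] W(2) by simp
      qed
      then show ?thesis using AR_hom_image[OF fg(1), of W] W(3) lW fg(2) jacobson_radical_local[OF fgE(2)] by simp
    qed
    then have "(f, g) \<in> substructure_of \<S>" using fgE(1) fg(2) by (auto simp: substructure_of_def relative_structure_def)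
    then show "Z \<in> NP (substructure_of \<S>)" using fgE(2,3) fg(2) by (auto simp: F.nonprojective_iff)
  qed
qed

abbreviation NP_iso where
  "NP_iso \<equiv> {(X, Y). X \<in> NP E \<and> Y \<in> NP E \<and> isomorphic A X Y}"

lemma NP_iso_equiv: "equiv (NP E) NP_iso"
proof (rule equivI)
  show "refl_on (NP E) NP_iso"
    by (auto simp: refl_on_def nonprojective_indecomposables_def indecomposable_def intro: isomorphic_refl)
  show "sym NP_iso" by (auto simp: sym_def intro: isomorphic_sym)
  show "trans NP_iso" by (auto simp: trans_def intro: isomorphic_trans)
qed auto

lemma substructures_power_set:
  "power_set_order substructures (nonprojective_indecomposable_classes A E)
     (\<lambda>F. {c \<in> nonprojective_indecomposable_classes A E. c \<subseteq> NP F})"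
proof -
  let ?T = "nonprojective_indecomposable_classes A E"
  let ?h = "\<lambda>F. {c \<in> ?T. c \<subseteq> NP F}"
  have T: "?T = NP E // NP_iso" by (simp add: nonprojective_indecomposable_classes_def)
  note eqv = NP_iso_equiv
  have cls: "c = NP_iso `` {Z}" if "c \<in> ?T" "Z \<in> c" for c Z
  proof -
    have "c \<in> NP E // NP_iso" "Z \<in> c" using that unfolding T by auto
    then obtain X where X: "c = NP_iso `` {X}" by (auto elim: quotientE)
    then have "(X, Z) \<in> NP_iso" using \<open>Z \<in> c\<close> by blast
    then show ?thesis unfolding X by (rule equiv_class_eq[OF eqv])
  qed
  have ne: "c \<noteq> {}" "c \<subseteq> NP E" if "c \<in> ?T" for c using that eqv unfolding T by (auto elim!: quotientE simp: isomorphic_refl nonprojective_indecomposables_def indecomposable_def)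
  have union: "\<Union> (?h F) = NP F" if F: "F \<in> substructures" for F
  proof
    interpret F: krull_schmidt_exact A F by (rule substructure[OF F])
    show "NP F \<subseteq> \<Union> (?h F)"
    proof
      fix Z assume Z: "Z \<in> NP F"
      then have ZE: "Z \<in> NP E" using NP_mono[OF F E_substructure] F by blast
      have "NP_iso `` {Z} \<subseteq> NP F"
        using F.nonprojective_iso_closed[OF Z] by (auto simp: nonprojective_indecomposables_def)
      moreover have "NP_iso `` {Z} \<in> ?T" unfolding T using ZE by (rule quotientI)
      moreover have "Z \<in> NP_iso `` {Z}" using eqv ZE by (rule equiv_class_self)
      ultimately show "Z \<in> \<Union> (?h F)" by blast
    qed
  qed auto
  have left_inverse: "substructure_of (\<Union> (?h F)) = F" if "F \<in> substructures" for F
    using union[OF that] substructure_of_NP[OF that] by simp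
  have right_inverse: "?h (substructure_of (\<Union>U)) = U" if U: "U \<subseteq> ?T" for U
  proof -
    have "NP (substructure_of (\<Union>U)) = \<Union>U"
    proof (rule NP_substructure_of)
      show "\<Union>U \<subseteq> NP E" using U ne by blast
      fix Z W assume Z: "Z \<in> \<Union>U" and W: "W \<in> NP E" "isomorphic A Z W"
      then obtain c where c: "c \<in> U" "Z \<in> c" by blast
      then have "c = NP_iso `` {Z}" using cls U by blast
      moreover have "Z \<in> NP E" using c ne U by blast
      ultimately have "W \<in> c" using W by auto
      then show "W \<in> \<Union>U" using c by blast
    qed
    moreover have "{c \<in> ?T. c \<subseteq> \<Union>U} = U"
    proof
      show "{c \<in> ?T. c \<subseteq> \<Union>U} \<subseteq> U"
      proof
        fix c assume c: "c \<in> {c \<in> ?T. c \<subseteq> \<Union>U}"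
        then obtain Z where Z: "Z \<in> c" using ne by blast
        then obtain d where "d \<in> U" "Z \<in> d" using c by blast
        then have "c = d" using cls[of c Z] cls[of d Z] Z c U by blast
        then show "c \<in> U" using \<open>d \<in> U\<close> by simp
      qed
    qed (use U in auto)
    ultimately show ?thesis by simp
  qed
  show ?thesis
  proof
    show "bij_betw ?h substructures (Pow ?T)"
    proof (rule bij_betw_byWitness[where f' = "\<lambda>U. substructure_of (\<Union>U)"])
      show "\<forall>F\<in>substructures. substructure_of (\<Union> (?h F)) = F" using left_inverse by blast
      show "\<forall>U\<in>Pow ?T. ?h (substructure_of (\<Union>U)) = U" using right_inverse by blast
      show "(\<lambda>U. substructure_of (\<Union>U)) ` Pow ?T \<subseteq> substructures" using substructure_of by blast
    qed auto
    fix F F' assume F: "F \<in> substructures" "F' \<in> substructures"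
    show "F \<subseteq> F' \<longleftrightarrow> ?h F \<subseteq> ?h F'"
    proof
      assume "F \<subseteq> F'"
      then have "NP F \<subseteq> NP F'" by (rule NP_mono[OF F])
      then show "?h F \<subseteq> ?h F'" by auto
    next
      assume "?h F \<subseteq> ?h F'"
      then have "NP F \<subseteq> NP F'" using union[OF F(1)] union[OF F(2)] by blast
      then have "substructure_of (NP F) \<subseteq> substructure_of (NP F')"
        by (auto simp: substructure_of_def relative_structure_def)
      then show "F \<subseteq> F'" using substructure_of_NP F by simp
    qed
  qed
qed

text \<open>
  An AR conflation corresponds to its end term; by \<open>AR_unique\<close> this loses nothing.
\<close>

lemma AR_classes_bij:
  "\<exists>\<phi>. bij_betw \<phi> (AR_conflation_classes A E) (nonprojective_indecomposable_classes A E)"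
proof -
  let ?r = "{(\<delta>, \<delta>'). \<delta> \<in> AR_conflations A E \<and> \<delta>' \<in> AR_conflations A E \<and> pair_isomorphic A \<delta> \<delta>'}"
  have tgt: "tgt A (snd \<delta>) \<in> NP E" if "\<delta> \<in> AR_conflations A E" for \<delta>
    using that NP_AR[OF E_substructure, of "tgt A (snd \<delta>)"] by (cases \<delta>) auto
  have iff: "pair_isomorphic A \<delta> \<delta>' \<longleftrightarrow> isomorphic A (tgt A (snd \<delta>)) (tgt A (snd \<delta>'))"
    if "\<delta> \<in> AR_conflations A E" "\<delta>' \<in> AR_conflations A E" for \<delta> \<delta>'
    using that AR_unique pair_isomorphic_tgt by (cases \<delta>, cases \<delta>') auto
  have r: "?r = {(\<delta>, \<delta>'). \<delta> \<in> AR_conflations A E \<and> \<delta>' \<in> AR_conflations A E \<and> (tgt A (snd \<delta>), tgt A (snd \<delta>')) \<in> NP_iso}"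
    using tgt iff by auto
  have "bij_betw (\<lambda>c. NP_iso `` ((\<lambda>\<delta>. tgt A (snd \<delta>)) ` c)) (AR_conflations A E // ?r) (NP E // NP_iso)"
  proof (rule quotient_bij[OF NP_iso_equiv tgt _ r])
    fix Z assume Z: "Z \<in> NP E"
    then obtain f g where "(f, g) \<in> AR_conflations A E" "tgt A g = Z" using NP_AR[OF E_substructure] by auto
    then show "\<exists>\<delta>\<in>AR_conflations A E. (tgt A (snd \<delta>), Z) \<in> NP_iso"
      using Z by (intro bexI[of _ "(f, g)"])
        (auto simp: nonprojective_indecomposables_def indecomposable_def isomorphic_refl)
  qed
  then show ?thesis unfolding AR_conflation_classes_def nonprojective_indecomposable_classes_def by blast
qed

lemma interval: "interval_lattice (exact_structure_lattice A) (split_exact_structure A) E = inclusion_order substructures"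
  by (simp add: interval_lattice_def exact_structure_lattice_def inclusion_order_def at_least_at_most_def)

end

theorem theorem2:
  fixes A :: "('o, 'm, 'z) precat_scheme"
    and E :: "('m \<times> 'm) set"
  assumes "krull_schmidt_category A"
    and "exact_structure A E"
    and "admissible A E"
  shows "lattices_isomorphic
           (interval_lattice (exact_structure_lattice A) (split_exact_structure A) E)
           (inclusion_order (Pow (AR_conflation_classes A E))) \<and>
         lattices_isomorphic
           (interval_lattice (exact_structure_lattice A) (split_exact_structure A) E)
           (inclusion_order (Pow (nonprojective_indecomposable_classes A E))) \<and>
         lattices_isomorphic
           (inclusion_order (Pow (AR_conflation_classes A E)))
           (inclusion_order (Pow (nonprojective_indecomposable_classes A E))) \<and>
         boolean_lattice
           (interval_lattice (exact_structure_lattice A) (split_exact_structure A) E)"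
proof -
  interpret admissible_exact A E
    using assms by (simp add: admissible_exact_def admissible_exact_axioms_def krull_schmidt_exact_def)
  interpret NP: power_set_order substructures "nonprojective_indecomposable_classes A E"
    "\<lambda>F. {c \<in> nonprojective_indecomposable_classes A E. c \<subseteq> NP F}"
    by (rule substructures_power_set)
  obtain \<phi> where \<phi>: "bij_betw \<phi> (AR_conflation_classes A E) (nonprojective_indecomposable_classes A E)"
    using AR_classes_bij by blast
  show ?thesis unfolding interval
    using power_set_order.lattices_isomorphic[OF NP.compose_bij[OF bij_betw_inv_into[OF \<phi>]]] NP.lattices_isomorphic
      power_set_order.lattices_isomorphic[OF power_set_order.compose_bij[OF power_set_order_Pow \<phi>]] NP.boolean
    by blast
qed

end
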